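(* Let $D$ be a compact metric space with metric $d$, $\lambda$ a Radon measure on $D$ and $\mu>0$. Consider the backward detailed process $\{\hat\eta_t\}$ of the first-in-first-match (FIFM) matching process on $D$, i.e. the Markov jump process on valid finite lists of elements of $D\times\{\mathtt R,\mathtt B\}\times\{\mathtt u,\mathtt m\}$ whose transitions and rates are given in the context. For a list $\gamma$ let $|\gamma|$ be its length, let $Q^i_{\mathtt u}(\gamma)$ be the number of elements with mark $\mathtt u$ among the first $i$ elements of $\gamma$, and let $\rho(n)=2\lambda(D)+n\mu$. Then the stationary distribution of $\{\hat\eta_t\}$ has density, with respect to the measure $\bigoplus_{n\ge 0}(\lambda\otimes m_c\otimes m_c)^{n}$ on $\bigsqcup_{n\ge0}(D\times\{\mathtt R,\mathtt B\}\times\{\mathtt u,\mathtt m\})^n$ (where $m_c$ denotes counting measure on the relevant two-point set), given by $$\hat\pi(\gamma)=K\,\mathbf 1(\gamma\text{ is valid})\prod_{i=1}^{|\gamma|}\frac{1}{\rho(Q^i_{\mathtt u}(\gamma))},\qquad \hat\pi(\emptyset)=K,$$ where $K$ is the normalizing constant $$K^{-1}=\sum_{n=0}^\infty\int_{(D\times\{\mathtt R,\mathtt B\}\times\{\mathtt u,\mathtt m\})^n}\mathbf 1(\gamma\text{ is valid})\prod_{i=1}^n\frac{1}{\rho(Q^i_{\mathtt u}(\gamma))}\,(\lambda\otimes m_c\otimes m_c)^{n}(d\gamma).$$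
   Context: Notation. $\mathbf C=\{\mathtt R,\mathtt B\}$ (colors); $\bar{\mathtt R}=\mathtt B$, $\bar{\mathtt B}=\mathtt R$. An element $x$ of $D\times\mathbf C$ or $D\times\mathbf C\times\{\mathtt u,\mathtt m\}$ has position $p_x\in D$, color $c_x\in\mathbf C$ and (in the second case) mark $s_x\in\{\mathtt u,\mathtt m\}$ ($\mathtt u$ = unmatched, $\mathtt m$ = matched). $N(x)=\{y\in D\times\mathbf C: c_y=\bar c_x,\ d(p_x,p_y)<1\}$ and $N(A)=\bigcup_{x\in A}N(x)$. $\bar\lambda=\lambda\otimes m_c$ on $D\times\mathbf C$. Valid lists. A finite list $(x_1,\dots,x_n)$ of elements of $D\times\mathbf C\times\{\mathtt u,\mathtt m\}$ is valid if: (1) $s_{x_1}=\mathtt u$ when $n\ge1$; (2) for all $i,j$: $s_{x_i}=s_{x_j}=\mathtt u$ and $d(p_{x_i},p_{x_j})<1$ imply $c_{x_i}=c_{x_j}$; (3) for all $i<j$: $s_{x_i}=\mathtt u$, $s_{x_j}=\mathtt m$ and $d(p_{x_i},p_{x_j})<1$ imply $c_{x_i}=c_{x_j}$. The empty list is valid. Backward detailed process. It is the Markov jump process on valid lists with the following transitions from $\hat\eta=(x_1,\dots,x_n)$. "Pruning" a list means deleting the maximal initial run of elements with mark $\mathtt m$. For $x_i$ with $s_{x_i}=\mathtt u$ put $W_{x_i}=N(x_i)\setminus\bigcup_{j<i,\,s_{x_j}=\mathtt u}N(x_j)$. (1) For each $i$ with $s_{x_i}=\mathtt u$, at rate $\mu$: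 delete $x_i$ from the list, append $(p_{x_i},c_{x_i},\mathtt m)$ at the end, then prune. (2) For each $i$ with $s_{x_i}=\mathtt u$, at rate $\bar\lambda(dy)\mathbf 1(y\in W_{x_i})$, $y=(p_y,c_y)\in D\times\mathbf C$: replace $x_i$ (in place) by $(p_y,c_y,\mathtt m)$, append $(p_{x_i},c_{x_i},\mathtt m)$ at the end, then prune. (3) At rate $\bar\lambda(dy)\mathbf 1(y\notin N(\{x_j:s_{x_j}=\mathtt u\}))$: append $(p_y,c_y,\mathtt u)$ at the end. (The elements marked $\mathtt u$, in order, form the FIFM matching process: red and blue particles arrive as Poisson processes of intensity $\lambda$ per unit time, each arrival is matched with the earliest-arrived present particle of opposite color within distance less than $1$ and both disappear, otherwise it joins the end of the list; each present particle also leaves at rate $\mu$.) *)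

theory Defs
  imports "HOL-Probability.Probability"
begin

section \<open>Finite lists over a measurable space\<close>

text \<open>The disjoint union of the finite powers of \<open>M\<close>, realised on lists: the sigma-algebra is generated by
  the measurable boxes of all lengths.\<close>

definition list_space :: "'a measure \<Rightarrow> 'a list measure" where
  "list_space M = sigma (lists (space M)) {listset As | As. set As \<subseteq> sets M}"

definition list_measure :: "'a measure \<Rightarrow> 'a list measure" where
  "list_measure M = measure_of (lists (space M)) (sets (list_space M))
     (\<lambda>A. \<Sum>n. emeasure (distr (Pi\<^sub>M {..<n} (\<lambda>_. M)) (list_space M) (\<lambda>\<omega>. map \<omega> [0..<n])) A)"


section \<open>Markov jump processes\<close>

text \<open>A Markov jump process is given by its rate kernel \<open>q\<close>: in state \<open>x\<close> it waits an exponential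
  time of parameter \<open>q x (space (q x))\<close> and then jumps to a point chosen with law
  \<open>q x / q x (space (q x))\<close>. \<open>jump_prob q n t x A\<close> is the probability that the process started
  at \<open>x\<close> makes exactly \<open>n\<close> jumps up to time \<open>t\<close> and is then in \<open>A\<close>; for \<open>n > 0\<close> one conditions on
  the time \<open>s\<close> and the target \<open>y\<close> of the first jump (their joint law has density
  \<open>exp (- total_rate q x * s)\<close> with respect to \<open>ds q(x, dy)\<close>).\<close>

definition total_rate :: "('s \<Rightarrow> 's measure) \<Rightarrow> 's \<Rightarrow> real" where
  "total_rate q x = measure (q x) (space (q x))"

primrec jump_prob :: "('s \<Rightarrow> 's measure) \<Rightarrow> nat \<Rightarrow> real \<Rightarrow> 's \<Rightarrow> 's set \<Rightarrow> ennreal" where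
  "jump_prob q 0 t x A = ennreal (exp (- total_rate q x * t)) * indicator A x"
| "jump_prob q (Suc n) t x A =
     (\<integral>\<^sup>+ s \<in> {0..t}. ennreal (exp (- total_rate q x * s)) *
        (\<integral>\<^sup>+ y. jump_prob q n (t - s) y A \<partial>q x) \<partial>lborel)"

text \<open>If the process can explode, the mass lost at infinity is not put back (minimal process).\<close>

definition transition_prob :: "('s \<Rightarrow> 's measure) \<Rightarrow> real \<Rightarrow> 's \<Rightarrow> 's set \<Rightarrow> ennreal" where
  "transition_prob q t x A = (\<Sum>n. jump_prob q n t x A)"

definition stationary_distribution ::
  "'s measure \<Rightarrow> ('s \<Rightarrow> 's measure) \<Rightarrow> 's measure \<Rightarrow> bool" where
  "stationary_distribution S q \<nu> \<longleftrightarrow> prob_space \<nu> \<and> sets \<nu> = sets S \<and>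
     (\<forall>t\<ge>0. \<forall>A\<in>sets S. (\<integral>\<^sup>+ x. transition_prob q t x A \<partial>\<nu>) = emeasure \<nu> A)"


section \<open>Radon measures\<close>

definition radon_measure :: "'a::metric_space measure \<Rightarrow> bool" where
  "radon_measure M \<longleftrightarrow> sets M = sets borel \<and>
     (\<forall>K. compact K \<longrightarrow> emeasure M K < \<infinity>) \<and>
     (\<forall>B\<in>sets borel. emeasure M B = (SUP K\<in>{K. compact K \<and> K \<subseteq> B}. emeasure M K))"


section \<open>The backward detailed process of first-in-first-match matching\<close>

datatype color = Red | Blue

datatype mark = Unmatched | Matched

fun opp :: "color \<Rightarrow> color" where
  "opp Red = Blue"
| "opp Blue = Red"

type_synonym 'a particle = "'a \<times> color \<times> mark"

definition pos :: "'a particle \<Rightarrow> 'a" where "pos x = fst x"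

definition col :: "'a particle \<Rightarrow> color" where "col x = fst (snd x)"

definition is_u :: "'a particle \<Rightarrow> bool" where "is_u x \<longleftrightarrow> snd (snd x) = Unmatched"

definition is_m :: "'a particle \<Rightarrow> bool" where "is_m x \<longleftrightarrow> snd (snd x) = Matched"

definition nbhd :: "'a::metric_space particle \<Rightarrow> ('a \<times> color) set" where
  "nbhd x = {y. snd y = opp (col x) \<and> dist (pos x) (fst y) < 1}"

definition valid :: "'a::metric_space particle list \<Rightarrow> bool" where
  "valid xs \<longleftrightarrow>
     (xs \<noteq> [] \<longrightarrow> is_u (xs ! 0)) \<and>
     (\<forall>i<length xs. \<forall>j<length xs.
        is_u (xs ! i) \<and> is_u (xs ! j) \<and> dist (pos (xs ! i)) (pos (xs ! j)) < 1
          \<longrightarrow> col (xs ! i) = col (xs ! j)) \<and>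
     (\<forall>j<length xs. \<forall>i<j.
        is_u (xs ! i) \<and> is_m (xs ! j) \<and> dist (pos (xs ! i)) (pos (xs ! j)) < 1
          \<longrightarrow> col (xs ! i) = col (xs ! j))"

definition prune :: "'a particle list \<Rightarrow> 'a particle list" where
  "prune xs = dropWhile is_m xs"

definition depart :: "'a particle list \<Rightarrow> nat \<Rightarrow> 'a particle list" where
  "depart xs i =
     prune (take i xs @ drop (Suc i) xs @ [(pos (xs ! i), col (xs ! i), Matched)])"

definition exchange :: "'a particle list \<Rightarrow> nat \<Rightarrow> 'a \<times> color \<Rightarrow> 'a particle list" where
  "exchange xs i y =
     prune (xs[i := (fst y, snd y, Matched)] @ [(pos (xs ! i), col (xs ! i), Matched)])"

definition arrive :: "'a particle list \<Rightarrow> 'a \<times> color \<Rightarrow> 'a particle list" where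
  "arrive xs y = xs @ [(fst y, snd y, Unmatched)]"

definition match_region :: "'a::metric_space particle list \<Rightarrow> nat \<Rightarrow> ('a \<times> color) set" where
  "match_region xs i = nbhd (xs ! i) - (\<Union>j\<in>{j. j < i \<and> is_u (xs ! j)}. nbhd (xs ! j))"

definition free_region :: "'a::metric_space particle list \<Rightarrow> ('a \<times> color) set" where
  "free_region xs = - (\<Union>j\<in>{j. j < length xs \<and> is_u (xs ! j)}. nbhd (xs ! j))"

definition colored :: "'a measure \<Rightarrow> ('a \<times> color) measure" where
  "colored L = L \<Otimes>\<^sub>M count_space UNIV"

definition marked :: "'a measure \<Rightarrow> 'a particle measure" where
  "marked L = L \<Otimes>\<^sub>M count_space UNIV \<Otimes>\<^sub>M count_space UNIV"

definition fifm_rates ::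
  "'a::metric_space measure \<Rightarrow> real \<Rightarrow> 'a particle list \<Rightarrow> 'a particle list measure" where
  "fifm_rates L \<mu> xs = measure_of (space (list_space (marked L))) (sets (list_space (marked L)))
     (\<lambda>A. (\<Sum>i | i < length xs \<and> is_u (xs ! i).
             ennreal \<mu> * indicator A (depart xs i)
             + (\<integral>\<^sup>+ y \<in> match_region xs i. indicator A (exchange xs i y) \<partial>colored L))
          + (\<integral>\<^sup>+ y \<in> free_region xs. indicator A (arrive xs y) \<partial>colored L))"


section \<open>The product-form density\<close>

definition rho :: "'a measure \<Rightarrow> real \<Rightarrow> nat \<Rightarrow> real" where
  "rho L \<mu> n = 2 * measure L (space L) + real n * \<mu>"

definition Qu :: "nat \<Rightarrow> 'a particle list \<Rightarrow> nat" where
  "Qu i xs = length (filter is_u (take i xs))"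

text \<open>On valid lists \<open>Qu i xs \<ge> 1\<close> for every factor, so there is no division by zero,
  even if \<open>L\<close> is the zero measure.\<close>

definition fifm_weight :: "'a::metric_space measure \<Rightarrow> real \<Rightarrow> 'a particle list \<Rightarrow> real" where
  "fifm_weight L \<mu> xs =
     indicator {xs. valid xs} xs * (\<Prod>i=1..length xs. 1 / rho L \<mu> (Qu i xs))"

end

theory Submission
  imports Defs
begin

text \<open>
  Invariance. In the balance equation \<open>\<integral> q(x, A) \<pi>(dx) = \<integral>\<^sub>A q(x) \<pi>(dx)\<close> the arrivals account exactly for
  the lists that end in an unmatched element. For a list ending in a matched element \<open>b\<close>, every list from which it
  can be reached is obtained by inserting the unmatched \<open>b\<close> somewhere, possibly in place of a matched
  element; the weights of these insertions telescope along the list, and what is left at the front is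
  accounted for by the matched run that pruning removes. The minimal process started from a measure satisfying
  the balance equation never exceeds that measure (induction over the number of jumps, decomposing at the last
  jump), and it conserves mass because every jump raises the number of unmatched elements by at most one.

  Uniqueness. If \<open>\<nu>\<close> is another stationary law, take a Hahn decomposition of the two laws. The flow between
  the two parts is the same under both laws, which is impossible unless the laws agree, because from
  every valid list the empty list is reached with positive probability.
\<close>

section \<open>Jump processes with finite rates\<close>

text \<open>\<open>jump_prob\<close> conditions on the first jump, whereas the balance equation
  describes what one jump does to a law; hence the detour through \<open>jump_int\<close> and the
  decomposition at the last jump. The rates grow without bound along long lists, so everything is
  done with partial sums over the number of jumps. The hard point of the balance equation is
  pruning. Fix the newcomer \<open>b\<close> and call \<open>v @ [as_m b]\<close> the list before
  pruning. If \<open>v\<close> does not start with a matched entry, the inflow falls short of the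
  outflow by \<open>a\<close> times the weight of \<open>as_u b # v\<close>, where \<open>a\<close>
  is the total arrival rate. So no equation holds list by list. Lists \<open>v\<close> with a
  matched run in front have weight 0 themselves but still receive inflow, and pruning forgets the
  run. Peeling off one entry of the run reproduces the same integral up to a factor, as in a
  geometric series, and this inflow is exactly the deficit. Since all this lives in
  \<open>ennreal\<close>, every cancellation needs finiteness, in particular of the normalizing sum.
  That sum converges because \<open>r q\<close> exceeds \<open>a\<close> by \<mu> q and the first
  entry of a nonempty valid list is unmatched, so that q is at least 1.\<close>

lemma nn_integral_triangle:
  fixes H :: "real \<Rightarrow> real \<Rightarrow> ennreal"
  assumes H: "(\<lambda>(s, r). H s r) \<in> borel_measurable (borel \<Otimes>\<^sub>M borel)"
  shows "(\<integral>\<^sup>+ s\<in>{0..t}. (\<integral>\<^sup>+ r\<in>{0..t - s}. H s r \<partial>lborel) \<partial>lborel)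
    = (\<integral>\<^sup>+ u\<in>{0..t}. (\<integral>\<^sup>+ s\<in>{0..u}. H s (u - s) \<partial>lborel) \<partial>lborel)"
proof -
  have [measurable]: "(\<lambda>x. H (f x) (g x)) \<in> borel_measurable N"
    if "f \<in> borel_measurable N" "g \<in> borel_measurable N" for f g and N :: "'b measure"
    using measurable_compose[OF measurable_Pair[OF that] H] by simp
  have "(\<integral>\<^sup>+ u\<in>{0..t}. (\<integral>\<^sup>+ s\<in>{0..u}. H s (u - s) \<partial>lborel) \<partial>lborel)
      = (\<integral>\<^sup>+ u. (\<integral>\<^sup>+ s. H s (u - s) * of_bool (0 \<le> s \<and> s \<le> u \<and> u \<le> t) \<partial>lborel) \<partial>lborel)"
    by (subst nn_integral_multc[symmetric])
      (auto intro!: nn_integral_cong simp: indicator_def split: if_splits)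
  also have "\<dots> = (\<integral>\<^sup>+ s. (\<integral>\<^sup>+ u. H s (u - s) * of_bool (0 \<le> s \<and> s \<le> u \<and> u \<le> t) \<partial>lborel) \<partial>lborel)"
    by (intro lborel_pair.Fubini') simp
  also have "\<dots> = (\<integral>\<^sup>+ s. (\<integral>\<^sup>+ r. H s r * of_bool (0 \<le> s \<and> 0 \<le> r \<and> s + r \<le> t) \<partial>lborel) \<partial>lborel)"
    apply (rule nn_integral_cong)
    subgoal for s
      using nn_integral_real_affine[where c=1 and t=s
          and f="\<lambda>u. H s (u - s) * of_bool (0 \<le> s \<and> s \<le> u \<and> u \<le> t)"]
      by (cases "0 \<le> s") simp_all
    done
  also have "\<dots> = (\<integral>\<^sup>+ s\<in>{0..t}. (\<integral>\<^sup>+ r\<in>{0..t - s}. H s r \<partial>lborel) \<partial>lborel)"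
    by (subst nn_integral_multc[symmetric])
      (auto intro!: nn_integral_cong simp: indicator_def split: if_splits)
  finally show ?thesis by simp
qed

lemma nn_integral_exp_interval:
  fixes a t :: real
  assumes "0 \<le> a" "0 \<le> t"
  shows "ennreal (exp (- a * t)) + (\<integral>\<^sup>+ s\<in>{0..t}. ennreal (a * exp (- a * s)) \<partial>lborel) = 1"
proof -
  have "(\<integral>\<^sup>+ s\<in>{0..t}. ennreal (a * exp (- a * s)) \<partial>lborel) = ennreal (- exp (- a * t) - - exp (- a * 0))"
    by (rule nn_integral_FTC_Icc[where F="\<lambda>s. - exp (- a * s)"])
      (use assms in \<open>auto intro!: derivative_eq_intros\<close>)
  then show ?thesis using assms
    by (simp flip: ennreal_plus ennreal_1 )
qed

text \<open>Each factor is 1 minus the reciprocal of its denominator. The denominators grow only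
  linearly, so the reciprocals sum to infinity like the harmonic series. The product will bound the
  probability of many jumps in bounded time.\<close>

lemma prod_frac_tendsto_0:
  assumes "0 \<le> c" "0 \<le> m"
  shows "(\<lambda>n. \<Prod>j<n. (c + m * real (k + j)) / (c + m * real (k + j) + 1)) \<longlonglongrightarrow> 0"
proof -
  \<comment> \<open>Chosen so that the j-th denominator is at most \<open>C * real (Suc j)\<close>
    for every j.\<close>
  define C where "C = c + m * real k + m + 1"
  have C: "0 < C" using assms by (simp add: C_def add_nonneg_pos)
  have "(\<Prod>j<n. (c + m * real (k + j)) / (c + m * real (k + j) + 1)) \<le> exp (- (harm n / C))" for n
  proof -
    have "(c + m * real (k + j)) / (c + m * real (k + j) + 1) \<le> exp (- (inverse (real (Suc j)) / C))" for j
    proof -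
      have pos: "0 < c + m * real (k + j) + 1" using assms by (simp add: add_nonneg_pos)
      have "c + m * real (k + j) + 1 \<le> C * real (Suc j)"
        using assms by (simp add: C_def algebra_simps)
      then have "inverse (real (Suc j)) / C \<le> 1 / (c + m * real (k + j) + 1)"
        using pos C by (simp add: field_simps)
      moreover have "(c + m * real (k + j)) / (c + m * real (k + j) + 1) = 1 + - (1 / (c + m * real (k + j) + 1))"
        using pos by (simp add: divide_simps)
      moreover have "1 + - (1 / (c + m * real (k + j) + 1)) \<le> exp (- (1 / (c + m * real (k + j) + 1)))"
        by (rule exp_ge_add_one_self)
      ultimately show ?thesis by (smt (verit) exp_le_cancel_iff)
    qed
    then have "(\<Prod>j<n. (c + m * real (k + j)) / (c + m * real (k + j) + 1)) \<le> (\<Prod>j<n. exp (- (inverse (real (Suc j)) / C)))"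
      using assms by (intro prod_mono) auto
    also have "\<dots> = exp (- (harm n / C))"
      by (simp add: harm_def exp_sum[symmetric] sum_negf sum_divide_distrib atLeast1_lessThan_eq_remove0
          sum.atLeast1_atMost_eq)
    finally show ?thesis .
  qed
  moreover have "(\<lambda>n. exp (- (harm n / C))) \<longlonglongrightarrow> 0"
  proof -
    have "filterlim (\<lambda>n. harm n * inverse C) at_top sequentially"
      using C by (intro filterlim_at_top_mult_tendsto_pos[OF tendsto_const _ harm_at_top]) auto
    then have "filterlim (\<lambda>n. - (harm n / C)) at_bot sequentially"
      by (simp add: filterlim_uminus_at_bot divide_inverse)
    then show ?thesis
      by (rule filterlim_compose[OF exp_at_bot])
  qed
  moreover have "0 \<le> (\<Prod>j<n. (c + m * real (k + j)) / (c + m * real (k + j) + 1))" for n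
    using assms by (simp add: prod_nonneg)
  ultimately show ?thesis
    by - (rule real_tendsto_sandwich[where f="\<lambda>_. 0" and h="\<lambda>n. exp (- (harm n / C))", OF always_eventually always_eventually tendsto_const], blast+)
qed

lemma ennreal_add_eq_imp_eq:
  fixes a b c d :: ennreal
  assumes "a \<le> c" "b \<le> d" "a + b = c + d" "c + d \<noteq> top"
  shows "a = c"
  using assms
  by (cases a; cases b; cases c; cases d) (auto simp flip: ennreal_plus)

text \<open>Finiteness is required state by state only: in the application the total rate grows with
  the number of unmatched entries.\<close>

locale jump_kernel =
  fixes S :: "'s measure" and q :: "'s \<Rightarrow> 's measure"
  assumes sets_q [measurable_cong]: "sets (q x) = sets S"
    and finite_q: "finite_measure (q x)"
    and measurable_q: "A \<in> sets S \<Longrightarrow> (\<lambda>x. emeasure (q x) A) \<in> borel_measurable S"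
begin

lemma space_q: "space (q x) = space S"
  using sets_q by (rule sets_eq_imp_space_eq)

lemma measurable_total_rate [measurable]: "total_rate q \<in> borel_measurable S"
  using measurable_q[OF sets.top]
  by (auto simp: total_rate_def[abs_def] measure_def space_q)

lemma total_rate_nonneg: "0 \<le> total_rate q x"
  by (simp add: total_rate_def)

lemma emeasure_q_space: "emeasure (q x) (space S) = ennreal (total_rate q x)"
  using finite_measure.emeasure_eq_measure[OF finite_q, of x "space S"]
  by (simp add: total_rate_def space_q)

text \<open>Dividing \<open>q x\<close> by \<open>1 + total_rate q x\<close> gives a subprobability
  kernel, for which measurability of integrals is known; the factor is multiplied back afterwards.
  The added 1 keeps the denominator positive at absorbing states.\<close>

lemma measurable_nn_integral_q:
  assumes f: "f \<in> borel_measurable (W \<Otimes>\<^sub>M S)"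
  shows "(\<lambda>(w, x). \<integral>\<^sup>+ y. f (w, y) \<partial>q x) \<in> borel_measurable (W \<Otimes>\<^sub>M S)"
proof -
  define k where "k x = scale_measure (ennreal (1 / (1 + total_rate q x))) (q x)" for x
  have k: "k \<in> S \<rightarrow>\<^sub>M subprob_algebra S"
  proof (rule measurable_subprob_algebra)
    fix x assume x: "x \<in> space S"
    show "subprob_space (k x)"
      using x total_rate_nonneg[of x]
      by (intro subprob_spaceI)
        (auto simp: k_def space_scale_measure space_q emeasure_q_space simp flip: ennreal_mult)
  next
    fix A assume [measurable]: "A \<in> sets S"
    note measurable_q[measurable]
    show "(\<lambda>x. emeasure (k x) A) \<in> borel_measurable S"
      by (simp add: k_def)
  qed (simp add: k_def sets_q)
  have "(\<lambda>p. \<integral>\<^sup>+ y. f (fst p, y) \<partial>k (snd p)) \<in> borel_measurable (W \<Otimes>\<^sub>M S)"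
    by (intro nn_integral_measurable_subprob_algebra2[where N=S] measurable_compose[OF measurable_snd k])
      (use measurable_compose[OF _ f, of "\<lambda>z. (fst (fst z), snd z)" "(W \<Otimes>\<^sub>M S) \<Otimes>\<^sub>M S"] in \<open>simp_all add: split_beta'\<close>)
  then have "(\<lambda>p. ennreal (1 + total_rate q (snd p)) * (\<integral>\<^sup>+ y. f (fst p, y) \<partial>k (snd p))) \<in> borel_measurable (W \<Otimes>\<^sub>M S)"
    by measurable
  also have "?this \<longleftrightarrow> ?thesis"
  proof (intro measurable_cong)
    fix p assume p: "p \<in> space (W \<Otimes>\<^sub>M S)"
    then have [measurable]: "(\<lambda>y. f (fst p, y)) \<in> borel_measurable S"
      using f by (auto simp: space_pair_measure)
    have "1 + total_rate q (snd p) > 0"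
      using total_rate_nonneg[of "snd p"] by simp
    then show "ennreal (1 + total_rate q (snd p)) * (\<integral>\<^sup>+ y. f (fst p, y) \<partial>k (snd p)) = (case p of (w, x) \<Rightarrow> \<integral>\<^sup>+ y. f (w, y) \<partial>q x)"
      by (auto simp: k_def nn_integral_scale_measure mult.assoc[symmetric] split_beta sets_q simp flip: ennreal_mult)
  qed
  finally show ?thesis .
qed

lemma measurable_nn_integral_q' [measurable (raw)]:
  assumes "(\<lambda>p. f (fst p) (snd p)) \<in> borel_measurable (W \<Otimes>\<^sub>M S)" "g \<in> W \<rightarrow>\<^sub>M S"
  shows "(\<lambda>w. \<integral>\<^sup>+ y. f w y \<partial>q (g w)) \<in> borel_measurable W"
  using measurable_compose[OF measurable_Pair[OF measurable_ident assms(2)] measurable_nn_integral_q[OF assms(1)]]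
  by simp

text \<open>\<open>jump_prob\<close> with a function in place of the indicator. The decomposition at
  the last jump needs this generality, because there the target set is replaced by the integral over
  the last jump and the final wait.\<close>

primrec jump_int :: "nat \<Rightarrow> ('s \<Rightarrow> ennreal) \<Rightarrow> real \<Rightarrow> 's \<Rightarrow> ennreal" where
  "jump_int 0 f t x = ennreal (exp (- total_rate q x * t)) * f x"
| "jump_int (Suc n) f t x =
     (\<integral>\<^sup>+ s \<in> {0..t}. ennreal (exp (- total_rate q x * s)) *
        (\<integral>\<^sup>+ y. jump_int n f (t - s) y \<partial>q x) \<partial>lborel)"

lemma jump_prob_eq_jump_int: "jump_prob q n t x A = jump_int n (indicator A) t x"
  by (induction n arbitrary: t x) auto

text \<open>The extra parameter in \<open>W\<close> is carried along because the functions put into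
  \<open>jump_int\<close> later depend on the time of the last jump.\<close>

lemma measurable_jump_int:
  assumes f: "f \<in> borel_measurable (W \<Otimes>\<^sub>M S)"
  shows "(\<lambda>p. jump_int n (\<lambda>y. f (fst (fst p), y)) (snd (fst p)) (snd p))
    \<in> borel_measurable ((W \<Otimes>\<^sub>M borel) \<Otimes>\<^sub>M S)"
proof (induction n)
  case 0
  note f[measurable]
  show ?case by simp
next
  case (Suc n)
  have [measurable]: "(\<lambda>z. jump_int n (\<lambda>y. f (a z, y)) (b z) (c z)) \<in> borel_measurable N"
    if [measurable]: "a \<in> N \<rightarrow>\<^sub>M W" "b \<in> borel_measurable N" "c \<in> N \<rightarrow>\<^sub>M S" for a b c and N :: "'c measure"
  proof -
    have "(\<lambda>z. ((a z, b z), c z)) \<in> N \<rightarrow>\<^sub>M ((W \<Otimes>\<^sub>M borel) \<Otimes>\<^sub>M S)" by measurable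
    from measurable_compose[OF this Suc] show ?thesis by simp
  qed
  show ?case by (simp add: indicator_def[of "{_.._}"])
qed

lemma measurable_jump_int' [measurable (raw)]:
  assumes "(\<lambda>p. f (fst p) (snd p)) \<in> borel_measurable (W \<Otimes>\<^sub>M S)" "b \<in> borel_measurable W" "c \<in> W \<rightarrow>\<^sub>M S"
  shows "(\<lambda>w. jump_int n (f w) (b w) (c w)) \<in> borel_measurable W"
proof -
  have "(\<lambda>w. ((w, b w), c w)) \<in> W \<rightarrow>\<^sub>M ((W \<Otimes>\<^sub>M borel) \<Otimes>\<^sub>M S)" using assms by measurable
  from measurable_compose[OF this measurable_jump_int[OF assms(1), of n]] show ?thesis by simp
qed

text \<open>The recursion peels off the first jump; this is the same quantity with the last jump, at
  time s, peeled off. In the induction the hypothesis is used behind the first jump, and the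
  triangle formula exchanges the order of the first and the last jump time.\<close>

lemma jump_int_forward:
  assumes f [measurable]: "f \<in> borel_measurable S" and x [measurable]: "x \<in> space S"
  shows "jump_int (Suc n) f t x = (\<integral>\<^sup>+ s\<in>{0..t}.
    jump_int n (\<lambda>y. \<integral>\<^sup>+ z. ennreal (exp (- total_rate q z * (t - s))) * f z \<partial>q y) s x \<partial>lborel)"
  using x
proof (induction n arbitrary: t x)
  case 0
  have [simp]: "- (a * t) - a * s = - (a * (t + s))" for a t s :: real by (simp add: algebra_simps)
  show ?case by simp
next
  case (Suc n)
  note [measurable] = \<open>x \<in> space S\<close>
  define g where "g v = (\<lambda>y. \<integral>\<^sup>+ z. ennreal (exp (- total_rate q z * v)) * f z \<partial>q y)" for v
  have [measurable]: "(\<lambda>w. g (a w) (b w)) \<in> borel_measurable N"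
    if [measurable]: "a \<in> borel_measurable N" "b \<in> N \<rightarrow>\<^sub>M S" for a b and N :: "'c measure"
    unfolding g_def by measurable
  have [simp]: "sigma_finite_measure (q x)" for x
    using finite_q[of x] by (simp add: finite_measure_def)
  \<comment> \<open>The contribution of paths whose first jump is at time s and whose last jump is
    at time s + r.\<close>
  define H where "H s r = ennreal (exp (- total_rate q x * s)) *
     (\<integral>\<^sup>+ y. jump_int n (g (t - s - r)) r y \<partial>q x)" for s r
  have H [measurable]: "(\<lambda>(s, r). H s r) \<in> borel_measurable (borel \<Otimes>\<^sub>M borel)"
    unfolding H_def by measurable
  have "jump_int (Suc (Suc n)) f t x =
      (\<integral>\<^sup>+ s \<in> {0..t}. ennreal (exp (- total_rate q x * s)) *
        (\<integral>\<^sup>+ y. (\<integral>\<^sup>+ r\<in>{0..t - s}. jump_int n (g (t - s - r)) r y \<partial>lborel) \<partial>q x) \<partial>lborel)"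
    using Suc.IH
    by (auto intro!: nn_integral_cong arg_cong2[where f="(*)"] simp: g_def space_q simp del: jump_int.simps simp: jump_int.simps(2)[of "Suc n"])
  also have "\<dots> = (\<integral>\<^sup>+ s \<in> {0..t}. ennreal (exp (- total_rate q x * s)) *
        (\<integral>\<^sup>+ r\<in>{0..t - s}. (\<integral>\<^sup>+ y. jump_int n (g (t - s - r)) r y \<partial>q x) \<partial>lborel) \<partial>lborel)"
    apply (intro nn_integral_cong arg_cong2[where f="(*)"] refl)
    apply (subst pair_sigma_finite.Fubini')
      apply (simp add: pair_sigma_finite_def sigma_finite_lborel)
     apply (simp add: indicator_def[of "{_.._}"])
    apply (simp add: indicator_def[of "{_.._}"] nn_integral_multc)
    done
  also have "\<dots> = (\<integral>\<^sup>+ s \<in> {0..t}. (\<integral>\<^sup>+ r\<in>{0..t - s}. H s r \<partial>lborel) \<partial>lborel)"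
    by (auto intro!: nn_integral_cong simp: H_def mult.assoc nn_integral_cmult indicator_def[of "{_.._}"])
  also have "\<dots> = (\<integral>\<^sup>+ u\<in>{0..t}. (\<integral>\<^sup>+ s\<in>{0..u}. H s (u - s) \<partial>lborel) \<partial>lborel)"
    by (rule nn_integral_triangle[OF H])
  also have "\<dots> = (\<integral>\<^sup>+ u\<in>{0..t}. jump_int (Suc n) (g (t - u)) u x \<partial>lborel)"
    by (simp add: H_def)
  finally show ?case by (simp only: g_def)
qed

section \<open>Conservation of mass under linearly growing rates\<close>

lemma sum_jump_int_Suc:
  assumes [measurable]: "f \<in> borel_measurable S" "x \<in> space S"
  shows "(\<Sum>k<Suc n. jump_int k f t x) = ennreal (exp (- total_rate q x * t)) * f x +
    (\<integral>\<^sup>+ s \<in> {0..t}. ennreal (exp (- total_rate q x * s)) *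
        (\<integral>\<^sup>+ y. (\<Sum>k<n. jump_int k f (t - s) y) \<partial>q x) \<partial>lborel)"
proof -
  have "(\<Sum>k<n. jump_int (Suc k) f t x) = (\<integral>\<^sup>+ s \<in> {0..t}. ennreal (exp (- total_rate q x * s)) *
        (\<integral>\<^sup>+ y. (\<Sum>k<n. jump_int k f (t - s) y) \<partial>q x) \<partial>lborel)"
    unfolding jump_int.simps
    by (subst nn_integral_sum[symmetric], simp, rule nn_integral_cong,
        simp add: nn_integral_sum flip: sum_distrib_left sum_distrib_right)
  then show ?thesis
    by (subst sum.lessThan_Suc_shift) simp
qed

lemma exp_total_rate_interval:
  assumes "0 \<le> t"
  shows "ennreal (exp (- total_rate q x * t)) +
    (\<integral>\<^sup>+ s\<in>{0..t}. ennreal (exp (- total_rate q x * s)) * ennreal (total_rate q x) \<partial>lborel) = 1"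
  using nn_integral_exp_interval[OF total_rate_nonneg assms, of x]
  by (simp add: total_rate_nonneg mult.commute flip: ennreal_mult)

lemma sum_jump_int_le_1:
  assumes "0 \<le> t" "x \<in> space S"
  shows "(\<Sum>k<n. jump_int k (\<lambda>_. 1) t x) \<le> 1"
  using assms
proof (induction n arbitrary: t x)
  case (Suc n)
  have "(\<Sum>k<Suc n. jump_int k (\<lambda>_. 1) t x) \<le> ennreal (exp (- total_rate q x * t)) +
      (\<integral>\<^sup>+ s \<in> {0..t}. ennreal (exp (- total_rate q x * s)) * (\<integral>\<^sup>+ y. 1 \<partial>q x) \<partial>lborel)"
    using Suc by (subst sum_jump_int_Suc)
      (auto intro!: add_mono nn_integral_mono mult_left_mono simp: indicator_def space_q simp del: nn_integral_const)
  also have "\<dots> = 1"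
    using exp_total_rate_interval[OF Suc.prems(1)] by (simp add: space_q emeasure_q_space)
  finally show ?case .
qed simp

text \<open>An exponential Markov inequality for the time T of the n-th jump: the probability of T
  \<le> t is at most \<open>exp t\<close> times the expectation of \<open>exp (- T)\<close>. An
  exponential waiting time of rate R contributes the factor R / (R + 1) to this expectation, and
  after j jumps the rate is at most \<open>c + m * real (\<kappa> x + j)\<close>.\<close>

lemma one_le_sum_jump_int:
  assumes c: "0 \<le> c" and m: "0 \<le> m"
    and rate: "\<And>x. x \<in> space S \<Longrightarrow> total_rate q x \<le> c + m * real (\<kappa> x)"
    and step: "\<And>x. x \<in> space S \<Longrightarrow> AE y in q x. \<kappa> y \<le> Suc (\<kappa> x)"
    and "0 \<le> t" "x \<in> space S"
  shows "1 \<le> (\<Sum>k<n. jump_int k (\<lambda>_. 1) t x) +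
    ennreal (exp t * (\<Prod>j<n. (c + m * real (\<kappa> x + j)) / (c + m * real (\<kappa> x + j) + 1)))"
  using \<open>0 \<le> t\<close> \<open>x \<in> space S\<close>
proof (induction n arbitrary: t x)
  case (Suc n)
  define R where "R = total_rate q x"
  define r where "r k = c + m * real k" for k
  define b where "b n k = (\<Prod>j<n. r (k + j) / (r (k + j) + 1))" for n k
  have r: "0 \<le> r k" for k using c m by (simp add: r_def)
  have R: "0 \<le> R" "R \<le> r (\<kappa> x)"
    using rate[OF Suc.prems(2)] by (simp_all add: R_def r_def total_rate_nonneg)
  have r_mono: "k \<le> l \<Longrightarrow> r k \<le> r l" for k l using m by (simp add: r_def mult_left_mono)
  have frac: "p / (p + 1) \<le> p' / (p' + 1)" if "0 \<le> p" "p \<le> p'" for p p' :: real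
    using that by (simp add: divide_simps algebra_simps)
  \<comment> \<open>A jump may also lower \<open>\<kappa>\<close>; monotonicity reduces every jump
    to the worst case of an increase by one.\<close>
  have b_mono: "b n k \<le> b n l" if "k \<le> l" for k l
    using that r unfolding b_def by (intro prod_mono conjI frac r_mono divide_nonneg_nonneg) (auto simp: add_nonneg_nonneg)
  have b_nonneg: "0 \<le> b n k" for n k
    unfolding b_def by (intro prod_nonneg) (simp add: r)
  have b_Suc: "b (Suc n) k = r k / (r k + 1) * b n (Suc k)" for k
    unfolding b_def by (subst prod.lessThan_Suc_shift) simp
  have inner: "ennreal R \<le> (\<integral>\<^sup>+ y. (\<Sum>k<n. jump_int k (\<lambda>_. 1) (t - s) y) \<partial>q x)
      + ennreal (R * (exp (t - s) * b n (Suc (\<kappa> x))))" if s: "s \<in> {0..t}" for s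
  proof -
    have "ennreal R = (\<integral>\<^sup>+ y. 1 \<partial>q x)"
      by (simp add: R_def space_q emeasure_q_space)
    also have "\<dots> \<le> (\<integral>\<^sup>+ y. (\<Sum>k<n. jump_int k (\<lambda>_. 1) (t - s) y) + ennreal (exp (t - s) * b n (Suc (\<kappa> x))) \<partial>q x)"
      using step[OF Suc.prems(2)] AE_space
    proof (intro nn_integral_mono_AE, eventually_elim)
      fix y assume y: "\<kappa> y \<le> Suc (\<kappa> x)" "y \<in> space (q x)"
      have "1 \<le> (\<Sum>k<n. jump_int k (\<lambda>_. 1) (t - s) y) + ennreal (exp (t - s) * b n (\<kappa> y))"
        using Suc.IH[of "t - s" y] y s by (simp add: space_q b_def r_def)
      also have "\<dots> \<le> (\<Sum>k<n. jump_int k (\<lambda>_. 1) (t - s) y) + ennreal (exp (t - s) * b n (Suc (\<kappa> x)))"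
        using b_mono[OF y(1)] by (intro add_mono ennreal_leI mult_left_mono) auto
      finally show "1 \<le> (\<Sum>k<n. jump_int k (\<lambda>_. 1) (t - s) y) + ennreal (exp (t - s) * b n (Suc (\<kappa> x)))" .
    qed
    also have "\<dots> = (\<integral>\<^sup>+ y. (\<Sum>k<n. jump_int k (\<lambda>_. 1) (t - s) y) \<partial>q x)
      + ennreal (R * (exp (t - s) * b n (Suc (\<kappa> x))))"
      using b_nonneg R by (subst nn_integral_add)
        (auto simp: space_q emeasure_q_space R_def ennreal_mult'' mult.commute)
    finally show ?thesis .
  qed
  \<comment> \<open>Pulling \<open>exp t\<close> out turns the integrand into R / (R + 1) times the
    exponential density of rate R + 1, whose integral over the interval is at most 1.\<close>
  have tail: "(\<integral>\<^sup>+ s \<in> {0..t}. ennreal (exp (- R * s)) * ennreal (R * (exp (t - s) * b n (Suc (\<kappa> x)))) \<partial>lborel)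
      \<le> ennreal (exp t * b (Suc n) (\<kappa> x))"
  proof -
    have "(\<integral>\<^sup>+ s \<in> {0..t}. ennreal (exp (- R * s)) * ennreal (R * (exp (t - s) * b n (Suc (\<kappa> x)))) \<partial>lborel)
      = (\<integral>\<^sup>+ s. ennreal (exp t * (R / (R + 1)) * b n (Suc (\<kappa> x))) *
          (ennreal ((R + 1) * exp (- (R + 1) * s)) * indicator {0..t} s) \<partial>lborel)"
    proof (intro nn_integral_cong)
      fix s
      define A B C D where "A = exp (- R * s)" and "B = R * (exp (t - s) * b n (Suc (\<kappa> x)))"
        and "C = exp t * (R / (R + 1)) * b n (Suc (\<kappa> x))" and "D = (R + 1) * exp (- (R + 1) * s)"
      have "exp (- R * s) * exp (t - s) = exp t * exp (- (R + 1) * s)"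
        by (simp add: algebra_simps flip: exp_add)
      moreover have "C * D = R * b n (Suc (\<kappa> x)) * (exp t * exp (- (R + 1) * s))"
        using R by (simp add: C_def D_def)
      moreover have "A * B = R * b n (Suc (\<kappa> x)) * (exp (- R * s) * exp (t - s))"
        by (simp add: A_def B_def)
      ultimately have "A * B = C * D" by simp
      moreover have "0 \<le> A" "0 \<le> B" "0 \<le> C" "0 \<le> D"
        using R b_nonneg by (simp_all add: A_def B_def C_def D_def)
      ultimately have "ennreal A * ennreal B = ennreal C * ennreal D"
        by (simp flip: ennreal_mult)
      then show "ennreal A * ennreal B * indicator {0..t} s = ennreal C * (ennreal D * indicator {0..t} s)"
        by (simp add: mult.assoc)
    qed
    also have "\<dots> = ennreal (exp t * (R / (R + 1)) * b n (Suc (\<kappa> x))) *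
        (\<integral>\<^sup>+ s\<in>{0..t}. ennreal ((R + 1) * exp (- (R + 1) * s)) \<partial>lborel)"
      by (rule nn_integral_cmult) simp
    also have "\<dots> \<le> ennreal (exp t * (R / (R + 1)) * b n (Suc (\<kappa> x))) * 1"
      using nn_integral_exp_interval[of "R + 1" t] R Suc.prems
      by (intro mult_left_mono) (auto intro: order_trans[OF add_increasing[OF zero_le order.refl] eq_refl])
    also have "\<dots> \<le> ennreal (exp t * b (Suc n) (\<kappa> x))"
      using b_nonneg unfolding b_Suc mult.assoc[symmetric] mult_1_right
      by (intro ennreal_leI mult_right_mono mult_left_mono frac[OF R]) auto
    finally show ?thesis .
  qed
  have "1 = ennreal (exp (- R * t)) + (\<integral>\<^sup>+ s\<in>{0..t}. ennreal (exp (- R * s)) * ennreal R \<partial>lborel)"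
    using exp_total_rate_interval[OF Suc.prems(1), of x] by (simp add: R_def)
  also have "\<dots> \<le> ennreal (exp (- R * t)) + (\<integral>\<^sup>+ s\<in>{0..t}. ennreal (exp (- R * s)) *
     ((\<integral>\<^sup>+ y. (\<Sum>k<n. jump_int k (\<lambda>_. 1) (t - s) y) \<partial>q x)
      + ennreal (R * (exp (t - s) * b n (Suc (\<kappa> x))))) \<partial>lborel)"
    using inner by (intro add_mono order.refl nn_integral_mono) (auto simp: indicator_def intro!: mult_left_mono)
  also have "\<dots> = (\<Sum>k<Suc n. jump_int k (\<lambda>_. 1) t x) +
      (\<integral>\<^sup>+ s \<in> {0..t}. ennreal (exp (- R * s)) * ennreal (R * (exp (t - s) * b n (Suc (\<kappa> x)))) \<partial>lborel)"
    using \<open>x \<in> space S\<close>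
    by (subst sum_jump_int_Suc, simp, simp, subst add.assoc, subst nn_integral_add[symmetric])
       (auto simp: R_def distrib_left distrib_right indicator_def[of "{_.._}"])
  also have "\<dots> \<le> (\<Sum>k<Suc n. jump_int k (\<lambda>_. 1) t x) + ennreal (exp t * b (Suc n) (\<kappa> x))"
    by (intro add_mono order.refl tail)
  finally show ?case by (simp add: b_def r_def)
qed simp

lemma measurable_transition_prob [measurable]:
  assumes [measurable]: "A \<in> sets S"
  shows "(\<lambda>x. transition_prob q t x A) \<in> borel_measurable S"
  unfolding transition_prob_def jump_prob_eq_jump_int by measurable

lemma transition_prob_union:
  assumes [measurable]: "A \<in> sets S" "B \<in> sets S" and AB: "A \<inter> B = {}" and x: "x \<in> space S"
  shows "transition_prob q t x (A \<union> B) = transition_prob q t x A + transition_prob q t x B"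
proof -
  have "jump_int n (indicator (A \<union> B)) t x = jump_int n (indicator A) t x + jump_int n (indicator B) t x" for n
    using x
  proof (induction n arbitrary: t x)
    case 0
    then show ?case using AB by (auto simp: indicator_def)
  next
    case (Suc n)
    note [measurable] = \<open>x \<in> space S\<close>
    have "(\<integral>\<^sup>+ y. jump_int n (indicator (A \<union> B)) s y \<partial>q x) =
        (\<integral>\<^sup>+ y. jump_int n (indicator A) s y \<partial>q x) + (\<integral>\<^sup>+ y. jump_int n (indicator B) s y \<partial>q x)" for s
      using Suc by (subst nn_integral_add[symmetric]) (auto intro!: nn_integral_cong simp: space_q)
    then show ?case
      by (simp add: nn_integral_add distrib_left distrib_right)
  qed
  then show ?thesis
    by (simp add: transition_prob_def jump_prob_eq_jump_int suminf_add)
qed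

lemma jump_int_cong:
  assumes "\<And>x. x \<in> space S \<Longrightarrow> f x = g x" "x \<in> space S"
  shows "jump_int n f t x = jump_int n g t x"
  using assms(2)
proof (induction n arbitrary: t x)
  case (Suc n)
  then have "(\<integral>\<^sup>+ y. jump_int n f s y \<partial>q x) = (\<integral>\<^sup>+ y. jump_int n g s y \<partial>q x)" for s
    by (auto intro!: nn_integral_cong simp: space_q)
  then show ?case by simp
qed (use assms in auto)

lemma transition_prob_space:
  "x \<in> space S \<Longrightarrow> transition_prob q t x (space S) = (\<Sum>n. jump_int n (\<lambda>_. 1) t x)"
  unfolding transition_prob_def jump_prob_eq_jump_int
  by (intro suminf_cong jump_int_cong) auto

lemma transition_prob_space_le_1:
  assumes "0 \<le> t" "x \<in> space S"
  shows "transition_prob q t x (space S) \<le> 1"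
  unfolding transition_prob_space[OF assms(2)]
  using sum_jump_int_le_1[OF assms] by (intro suminf_le_const) auto

lemma transition_prob_space_eq_1:
  assumes c: "0 \<le> c" "0 \<le> m"
    and "\<And>x. x \<in> space S \<Longrightarrow> total_rate q x \<le> c + m * real (\<kappa> x)"
    and "\<And>x. x \<in> space S \<Longrightarrow> AE y in q x. \<kappa> y \<le> Suc (\<kappa> x)"
    and "0 \<le> t" "x \<in> space S"
  shows "transition_prob q t x (space S) = 1"
proof (rule antisym)
  let ?b = "\<lambda>n. exp t * (\<Prod>j<n. (c + m * real (\<kappa> x + j)) / (c + m * real (\<kappa> x + j) + 1))"
  have "(\<lambda>n. ennreal (?b n)) \<longlonglongrightarrow> ennreal (exp t * 0)"
    by (intro tendsto_ennrealI tendsto_mult tendsto_const prod_frac_tendsto_0 c)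
  moreover have "(\<lambda>n. \<Sum>k<n. jump_int k (\<lambda>_. 1) t x) \<longlonglongrightarrow> transition_prob q t x (space S)"
    unfolding transition_prob_space[OF assms(6)] by (intro summable_LIMSEQ) auto
  ultimately have "(\<lambda>n. (\<Sum>k<n. jump_int k (\<lambda>_. 1) t x) + ennreal (?b n))
      \<longlonglongrightarrow> transition_prob q t x (space S) + ennreal (exp t * 0)"
    by (intro tendsto_add)
  then show "1 \<le> transition_prob q t x (space S)"
    using one_le_sum_jump_int[of c m \<kappa>, OF assms] by (auto intro: LIMSEQ_le_const)
qed (rule transition_prob_space_le_1[OF assms(5,6)])

section \<open>Invariance from the balance equation\<close>

lemma balance_nn_integral:
  assumes sets_\<pi> [measurable_cong]: "sets \<pi> = sets S"
    and balance: "\<And>A. A \<in> sets S \<Longrightarrow> (\<integral>\<^sup>+ x. emeasure (q x) A \<partial>\<pi>) = (\<integral>\<^sup>+ x\<in>A. ennreal (total_rate q x) \<partial>\<pi>)"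
    and f: "f \<in> borel_measurable S"
  shows "(\<integral>\<^sup>+ x. (\<integral>\<^sup>+ y. f y \<partial>q x) \<partial>\<pi>) = (\<integral>\<^sup>+ x. ennreal (total_rate q x) * f x \<partial>\<pi>)"
  using f
proof (induction rule: borel_measurable_induct)
  case (cong f g)
  have "(\<integral>\<^sup>+ y. f y \<partial>q x) = (\<integral>\<^sup>+ y. g y \<partial>q x)" for x
    using cong by (auto intro!: nn_integral_cong simp: space_q)
  moreover have "(\<integral>\<^sup>+ x. ennreal (total_rate q x) * f x \<partial>\<pi>) = (\<integral>\<^sup>+ x. ennreal (total_rate q x) * g x \<partial>\<pi>)"
    using cong by (auto intro!: nn_integral_cong simp: sets_eq_imp_space_eq[OF sets_\<pi>])
  ultimately show ?case using cong by simp
next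
  case (set A)
  then show ?case using balance[of A] by (simp add: sets_q)
next
  case (mult u c)
  then show ?case by (simp add: nn_integral_cmult mult.left_commute)
next
  case (add u v)
  then show ?case by (simp add: nn_integral_add distrib_left)
next
  case (seq U)
  have "(\<integral>\<^sup>+ x. (\<integral>\<^sup>+ y. (SUP i. U i) y \<partial>q x) \<partial>\<pi>) = (\<integral>\<^sup>+ x. (SUP i. \<integral>\<^sup>+ y. U i y \<partial>q x) \<partial>\<pi>)"
    using seq by (auto intro!: nn_integral_cong nn_integral_monotone_convergence_SUP simp: image_comp)
  also have "\<dots> = (SUP i. \<integral>\<^sup>+ x. (\<integral>\<^sup>+ y. U i y \<partial>q x) \<partial>\<pi>)"
    using seq by (intro nn_integral_monotone_convergence_SUP)
      (auto simp: incseq_def le_fun_def intro!: nn_integral_mono)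
  also have "\<dots> = (SUP i. \<integral>\<^sup>+ x. ennreal (total_rate q x) * U i x \<partial>\<pi>)"
    using seq by simp
  also have "\<dots> = (\<integral>\<^sup>+ x. (SUP i. ennreal (total_rate q x) * U i x) \<partial>\<pi>)"
    using seq by (intro nn_integral_monotone_convergence_SUP[symmetric])
      (auto simp: incseq_def le_fun_def intro!: mult_left_mono)
  finally show ?case
    by (simp add: SUP_mult_left_ennreal image_comp)
qed

text \<open>Only an inequality is possible for finitely many jumps. It has to be proved for all
  functions and all times at once, since the hypothesis is applied to the function that performs the
  last jump and the final wait. The balance equation removes that last jump, and the density of the
  final wait adds up with the no-jump term to 1.\<close>

lemma nn_integral_sum_jump_int_le:
  assumes sets_\<pi> [measurable_cong]: "sets \<pi> = sets S" and "sigma_finite_measure \<pi>"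
    and balance: "\<And>A. A \<in> sets S \<Longrightarrow> (\<integral>\<^sup>+ x. emeasure (q x) A \<partial>\<pi>) = (\<integral>\<^sup>+ x\<in>A. ennreal (total_rate q x) \<partial>\<pi>)"
    and "f \<in> borel_measurable S" and t: "0 \<le> t"
  shows "(\<integral>\<^sup>+ x. (\<Sum>k<n. jump_int k f t x) \<partial>\<pi>) \<le> (\<integral>\<^sup>+ x. f x \<partial>\<pi>)"
  using assms(4,5)
proof (induction n arbitrary: t f)
  case (Suc n)
  interpret sigma_finite_measure \<pi> by fact
  interpret pair_sigma_finite \<pi> lborel
    by (simp add: pair_sigma_finite_def sigma_finite_lborel sigma_finite_measure_axioms)
  note [measurable] = \<open>f \<in> borel_measurable S\<close>
  let ?e = "\<lambda>v z. ennreal (exp (- total_rate q z * v))"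
  let ?g = "\<lambda>v y. \<integral>\<^sup>+ z. ?e v z * f z \<partial>q y"
  have sp: "space \<pi> = space S" using sets_\<pi> by (rule sets_eq_imp_space_eq)
  have "(\<integral>\<^sup>+ x. (\<Sum>k<Suc n. jump_int k f t x) \<partial>\<pi>) =
      (\<integral>\<^sup>+ x. ?e t x * f x \<partial>\<pi>) + (\<integral>\<^sup>+ x. (\<Sum>k<n. jump_int (Suc k) f t x) \<partial>\<pi>)"
    by (subst sum.lessThan_Suc_shift) (simp add: nn_integral_add del: jump_int.simps(2))
  also have "(\<integral>\<^sup>+ x. (\<Sum>k<n. jump_int (Suc k) f t x) \<partial>\<pi>) =
      (\<integral>\<^sup>+ x. (\<integral>\<^sup>+ s\<in>{0..t}. (\<Sum>k<n. jump_int k (?g (t - s)) s x) \<partial>lborel) \<partial>\<pi>)"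
  proof (rule nn_integral_cong)
    fix x assume "x \<in> space \<pi>"
    then have [measurable]: "x \<in> space S" by (simp add: sp)
    have "(\<Sum>k<n. jump_int (Suc k) f t x) =
        (\<Sum>k<n. \<integral>\<^sup>+ s\<in>{0..t}. jump_int k (?g (t - s)) s x \<partial>lborel)"
      by (intro sum.cong refl jump_int_forward) measurable
    also have "\<dots> = (\<integral>\<^sup>+ s\<in>{0..t}. (\<Sum>k<n. jump_int k (?g (t - s)) s x) \<partial>lborel)"
      by (subst nn_integral_sum[symmetric], measurable)
        (rule nn_integral_cong, simp only: sum_distrib_right)
    finally show "(\<Sum>k<n. jump_int (Suc k) f t x) =
      (\<integral>\<^sup>+ s\<in>{0..t}. (\<Sum>k<n. jump_int k (?g (t - s)) s x) \<partial>lborel)" .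
  qed
  also have "\<dots> = (\<integral>\<^sup>+ s\<in>{0..t}. (\<integral>\<^sup>+ x. (\<Sum>k<n. jump_int k (?g (t - s)) s x) \<partial>\<pi>) \<partial>lborel)"
    by (subst Fubini'[symmetric], measurable) (rule nn_integral_cong, rule nn_integral_multc, measurable)
  \<comment> \<open>The induction hypothesis at time s, for the function
    \<open>?g (t - s)\<close>.\<close>
  also have "\<dots> \<le> (\<integral>\<^sup>+ s\<in>{0..t}. (\<integral>\<^sup>+ x. ?g (t - s) x \<partial>\<pi>) \<partial>lborel)"
    using Suc.IH by (intro nn_integral_mono) (auto simp: indicator_def)
  also have "\<dots> = (\<integral>\<^sup>+ s\<in>{0..t}. (\<integral>\<^sup>+ x. ennreal (total_rate q x) * (?e (t - s) x * f x) \<partial>\<pi>) \<partial>lborel)"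
    by (rule nn_integral_cong, rule arg_cong2[where f="(*)", OF _ refl], rule balance_nn_integral[OF sets_\<pi> balance]) simp_all
  also have "\<dots> = (\<integral>\<^sup>+ x. (\<integral>\<^sup>+ s\<in>{0..t}. ennreal (total_rate q x) * (?e (t - s) x * f x) \<partial>lborel) \<partial>\<pi>)"
    by (subst Fubini'[symmetric], measurable) (rule nn_integral_cong, rule nn_integral_multc[symmetric], measurable)
  also have "\<dots> = (\<integral>\<^sup>+ x. f x * (\<integral>\<^sup>+ s\<in>{0..t}. ?e s x * ennreal (total_rate q x) \<partial>lborel) \<partial>\<pi>)"
  proof (rule nn_integral_cong)
    fix x
    have "(\<integral>\<^sup>+ s\<in>{0..t}. ennreal (total_rate q x) * (?e (t - s) x * f x) \<partial>lborel)
       = (\<integral>\<^sup>+ s\<in>{0..t}. ennreal (total_rate q x) * (?e s x * f x) \<partial>lborel)"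
      by (subst nn_integral_real_affine[where c="-1" and t=t])
        (auto intro!: nn_integral_cong simp: indicator_def)
    also have "\<dots> = (\<integral>\<^sup>+ s. f x * (?e s x * ennreal (total_rate q x) * indicator {0..t} s) \<partial>lborel)"
      by (intro nn_integral_cong) (simp add: ac_simps)
    also have "\<dots> = f x * (\<integral>\<^sup>+ s\<in>{0..t}. ?e s x * ennreal (total_rate q x) \<partial>lborel)"
      by (rule nn_integral_cmult) measurable
    finally show "(\<integral>\<^sup>+ s\<in>{0..t}. ennreal (total_rate q x) * (?e (t - s) x * f x) \<partial>lborel) = \<dots>" .
  qed
  also have "(\<integral>\<^sup>+ x. ?e t x * f x \<partial>\<pi>) + \<dots> = (\<integral>\<^sup>+ x. f x * (?e t x + (\<integral>\<^sup>+ s\<in>{0..t}. ?e s x * ennreal (total_rate q x) \<partial>lborel)) \<partial>\<pi>)"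
    by (subst nn_integral_add[symmetric], measurable) (simp add: distrib_left mult.commute)
  also have "\<dots> = (\<integral>\<^sup>+ x. f x \<partial>\<pi>)"
    by (simp only: exp_total_rate_interval[OF Suc.prems(2)] mult_1_right)
  finally show ?case by (simp add: add_left_mono)
qed simp

lemma stationary_distribution_if_balance:
  assumes "prob_space \<pi>" and sets_\<pi> [measurable_cong]: "sets \<pi> = sets S"
    and balance: "\<And>A. A \<in> sets S \<Longrightarrow> (\<integral>\<^sup>+ x. emeasure (q x) A \<partial>\<pi>) = (\<integral>\<^sup>+ x\<in>A. ennreal (total_rate q x) \<partial>\<pi>)"
    and honest: "\<And>t x. 0 \<le> t \<Longrightarrow> x \<in> space S \<Longrightarrow> transition_prob q t x (space S) = 1"
  shows "stationary_distribution S q \<pi>"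
  unfolding stationary_distribution_def
proof (intro conjI allI impI ballI)
  fix t :: real and A assume t: "0 \<le> t" and A [measurable]: "A \<in> sets S"
  interpret prob_space \<pi> by fact
  have sp: "space \<pi> = space S" using sets_\<pi> by (rule sets_eq_imp_space_eq)
  have le: "(\<integral>\<^sup>+ x. transition_prob q t x A \<partial>\<pi>) \<le> emeasure \<pi> A" if [measurable]: "A \<in> sets S" for A
  proof -
    have "(\<integral>\<^sup>+ x. transition_prob q t x A \<partial>\<pi>) = (\<Sum>n. \<integral>\<^sup>+ x. jump_int n (indicator A) t x \<partial>\<pi>)"
      unfolding transition_prob_def jump_prob_eq_jump_int by (rule nn_integral_suminf) measurable
    also have "\<dots> \<le> (\<integral>\<^sup>+ x. indicator A x \<partial>\<pi>)"
    proof (rule suminf_le_const)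
      fix n
      show "(\<Sum>k<n. \<integral>\<^sup>+ x. jump_int k (indicator A) t x \<partial>\<pi>) \<le> (\<integral>\<^sup>+ x. indicator A x \<partial>\<pi>)"
        using nn_integral_sum_jump_int_le[OF sets_\<pi> sigma_finite_measure_axioms balance _ t, of "indicator A" n]
        by (simp add: nn_integral_sum)
    qed simp
    finally show ?thesis by simp
  qed
  show "(\<integral>\<^sup>+ x. transition_prob q t x A \<partial>\<pi>) = emeasure \<pi> A"
  \<comment> \<open>Sub-invariance is applied to \<open>A\<close> and to its complement. Both sides
    have total 1, so neither inequality can be strict.\<close>
  proof (rule ennreal_add_eq_imp_eq[OF le le])
    have "(\<integral>\<^sup>+ x. transition_prob q t x A \<partial>\<pi>) + (\<integral>\<^sup>+ x. transition_prob q t x (space S - A) \<partial>\<pi>) =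
       (\<integral>\<^sup>+ x. transition_prob q t x (space S) \<partial>\<pi>)"
      using transition_prob_union[of A "space S - A"] sets.sets_into_space[OF A]
      by (subst nn_integral_add[symmetric]) (auto intro!: nn_integral_cong simp: sp Un_absorb1)
    also have "\<dots> = 1"
      using honest[OF t] by (simp add: sp[symmetric] emeasure_space_1 cong: nn_integral_cong)
    also have compl: "1 = emeasure \<pi> A + emeasure \<pi> (space S - A)"
      using sets.sets_into_space[OF A]
      by (subst plus_emeasure) (auto simp: sp[symmetric] Un_absorb1 emeasure_space_1)
    finally show "(\<integral>\<^sup>+ x. transition_prob q t x A \<partial>\<pi>) + (\<integral>\<^sup>+ x. transition_prob q t x (space S - A) \<partial>\<pi>)
      = emeasure \<pi> A + emeasure \<pi> (space S - A)" .
    show "emeasure \<pi> A + emeasure \<pi> (space S - A) \<noteq> top"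
      by (simp flip: compl)
  qed measurable
qed fact+

section \<open>Uniqueness by comparing flows\<close>

text \<open>Under a stationary law the flow from the complement \<open>Z\<close> into
  \<open>Y\<close> equals the flow from \<open>Y\<close> to \<open>Z\<close>. Passing from \<pi> to
  \<nu> does not increase the flow out of \<open>Y\<close> and does not decrease the flow out of
  \<open>Z\<close>, so these flows agree. Almost every state reaches \<open>e\<close> in
  \<open>Y\<close> with positive probability, which makes the two laws equal on \<open>Z\<close>.
  Then \<nu> is below \<pi> everywhere, and equal total mass finishes the proof.\<close>

lemma stationary_distribution_le:
  assumes \<nu>: "stationary_distribution S q \<nu>" and \<pi>: "stationary_distribution S q \<pi>"
    and t: "0 \<le> t" and honest: "\<And>x. x \<in> space S \<Longrightarrow> transition_prob q t x (space S) = 1"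
    and Y [measurable]: "Y \<in> sets S" and e: "e \<in> Y" "{e} \<in> sets S"
    and le: "\<And>X. X \<in> sets S \<Longrightarrow> X \<subseteq> Y \<Longrightarrow> emeasure \<nu> X \<le> emeasure \<pi> X"
    and ge: "\<And>X. X \<in> sets S \<Longrightarrow> X \<inter> Y = {} \<Longrightarrow> emeasure \<pi> X \<le> emeasure \<nu> X"
    and pos: "AE x in \<nu>. 0 < transition_prob q t x {e}" "AE x in \<pi>. 0 < transition_prob q t x {e}"
  shows "\<nu> = \<pi>"
proof -
  interpret N: prob_space \<nu> using \<nu> by (simp add: stationary_distribution_def)
  interpret P: prob_space \<pi> using \<pi> by (simp add: stationary_distribution_def)
  have sets [measurable_cong]: "sets \<nu> = sets S" "sets \<pi> = sets S"
    using \<nu> \<pi> by (auto simp: stationary_distribution_def)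
  have sp: "space \<nu> = space S" "space \<pi> = space S" using sets by (auto dest: sets_eq_imp_space_eq)
  define Z where "Z = space S - Y"
  have Z [measurable]: "Z \<in> sets S" by (simp add: Z_def)
  define p where "p A x = transition_prob q t x A" for A x
  have [measurable]: "A \<in> sets S \<Longrightarrow> p A \<in> borel_measurable S" for A unfolding p_def by measurable
  have YZ: "Y \<union> Z = space S" "Y \<inter> Z = {}" using sets.sets_into_space[OF Y] by (auto simp: Z_def)
  have pYZ: "p Y x + p Z x = 1" if "x \<in> space S" for x
    using transition_prob_union[OF Y Z YZ(2) that, of t] honest[OF that] by (simp add: p_def YZ)
  \<comment> \<open>Invariance of the mass of \<open>Y\<close>, after cancelling the finite mass
    that starts and ends in \<open>Y\<close>.\<close>
  have flow: "(\<integral>\<^sup>+ x\<in>Z. p Y x \<partial>\<rho>) = (\<integral>\<^sup>+ x\<in>Y. p Z x \<partial>\<rho>)" if \<rho>: "stationary_distribution S q \<rho>" for \<rho>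
  proof -
    interpret prob_space \<rho> using \<rho> by (simp add: stationary_distribution_def)
    have sets_\<rho> [measurable_cong]: "sets \<rho> = sets S" and inv: "(\<integral>\<^sup>+ x. p Y x \<partial>\<rho>) = emeasure \<rho> Y"
      using \<rho> t Y by (auto simp: stationary_distribution_def p_def)
    have sp\<rho>: "space \<rho> = space S" using sets_\<rho> by (rule sets_eq_imp_space_eq)
    have "(\<integral>\<^sup>+ x\<in>Y. p Y x \<partial>\<rho>) + (\<integral>\<^sup>+ x\<in>Z. p Y x \<partial>\<rho>) = (\<integral>\<^sup>+ x. p Y x \<partial>\<rho>)"
      using YZ by (subst nn_integral_add[symmetric]) (auto intro!: nn_integral_cong simp: sp\<rho> indicator_def)
    also have "\<dots> = (\<integral>\<^sup>+ x. indicator Y x \<partial>\<rho>)" by (simp add: inv)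
    also have "\<dots> = (\<integral>\<^sup>+ x\<in>Y. p Y x \<partial>\<rho>) + (\<integral>\<^sup>+ x\<in>Y. p Z x \<partial>\<rho>)"
      by (subst nn_integral_add[symmetric], measurable)
        (rule nn_integral_cong, simp add: pYZ sp\<rho> flip: distrib_right)
    finally have "(\<integral>\<^sup>+ x\<in>Y. p Y x \<partial>\<rho>) + (\<integral>\<^sup>+ x\<in>Z. p Y x \<partial>\<rho>) = (\<integral>\<^sup>+ x\<in>Y. p Y x \<partial>\<rho>) + (\<integral>\<^sup>+ x\<in>Y. p Z x \<partial>\<rho>)" .
    moreover have "(\<integral>\<^sup>+ x\<in>Y. p Y x \<partial>\<rho>) \<noteq> top"
    proof -
      have "(\<integral>\<^sup>+ x\<in>Y. p Y x \<partial>\<rho>) \<le> (\<integral>\<^sup>+ x. p Y x \<partial>\<rho>)"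
        by (intro nn_integral_mono) (simp add: indicator_def)
      then show ?thesis using inv emeasure_finite[of Y] by (auto simp: top_unique)
    qed
    ultimately show ?thesis by (simp add: ennreal_add_left_cancel)
  qed
  have mono: "(\<integral>\<^sup>+ x\<in>B. f x \<partial>\<rho>) \<le> (\<integral>\<^sup>+ x\<in>B. f x \<partial>\<sigma>)"
    if [measurable_cong]: "sets \<rho> = sets S" "sets \<sigma> = sets S" and [measurable]: "B \<in> sets S" "f \<in> borel_measurable S"
      and le: "\<And>X. X \<in> sets S \<Longrightarrow> X \<subseteq> B \<Longrightarrow> emeasure \<rho> X \<le> emeasure \<sigma> X" for \<rho> \<sigma> B f
  proof -
    have "(\<integral>\<^sup>+ x. f x \<partial>density \<rho> (indicator B)) \<le> (\<integral>\<^sup>+ x. f x \<partial>density \<sigma> (indicator B))"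
      using le by (intro nn_integral_mono_measure)
        (auto simp: le_measure that emeasure_density indicator_inter_arith[symmetric])
    then show ?thesis by (simp add: nn_integral_density mult.commute)
  qed
  have mono_Z: "(\<integral>\<^sup>+ x\<in>Z. f x \<partial>\<pi>) \<le> (\<integral>\<^sup>+ x\<in>Z. f x \<partial>\<nu>)" if "f \<in> borel_measurable S" for f
    using that ge by (intro mono sets Z) (auto simp: Z_def)
  have "(\<integral>\<^sup>+ x\<in>Z. p Y x \<partial>\<nu>) \<le> (\<integral>\<^sup>+ x\<in>Z. p Y x \<partial>\<pi>)"
    unfolding flow[OF \<nu>] flow[OF \<pi>] using le by (intro mono sets Y) auto
  then have eq: "(\<integral>\<^sup>+ x\<in>Z. p Y x \<partial>\<nu>) = (\<integral>\<^sup>+ x\<in>Z. p Y x \<partial>\<pi>)"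
    by (intro antisym mono_Z) auto
  have pY_le: "p Y x \<le> 1" if "x \<in> space S" for x
    using pYZ[OF that] by (metis le_iff_add)
  have fin: "(\<integral>\<^sup>+ x\<in>Z. p Y x \<partial>\<nu>) \<noteq> top"
  proof -
    have "(\<integral>\<^sup>+ x\<in>Z. p Y x \<partial>\<nu>) \<le> (\<integral>\<^sup>+ x. 1 \<partial>\<nu>)"
      using pY_le by (intro nn_integral_mono) (auto simp: sp indicator_def)
    then show ?thesis by (auto simp: N.emeasure_space_1 top_unique)
  qed
  \<comment> \<open>Weighting a law on \<open>Z\<close> by its probability of moving to
    \<open>Y\<close>. The two weighted laws are ordered on every set and have the same finite total,
    hence coincide; the weight is divided out below, where it is nonzero almost everywhere.\<close>
  let ?w = "\<lambda>x. p Y x * indicator Z x"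
  have "density \<nu> ?w = density \<pi> ?w"
  proof (rule measure_eqI)
    fix A assume "A \<in> sets (density \<nu> ?w)"
    then have A [measurable]: "A \<in> sets S" by (simp add: sets)
    have split: "emeasure (density \<rho> ?w) A + emeasure (density \<rho> ?w) (space S - A) = (\<integral>\<^sup>+ x\<in>Z. p Y x \<partial>\<rho>)"
      if "sets \<rho> = sets S" for \<rho>
      using that sets.sets_into_space[OF A] sets_eq_imp_space_eq[OF that]
      by (subst plus_emeasure) (auto simp: Un_absorb1 emeasure_density intro!: nn_integral_cong)
    have le: "emeasure (density \<pi> ?w) A \<le> emeasure (density \<nu> ?w) A" if [measurable]: "A \<in> sets S" for A
      using mono_Z[of "\<lambda>x. p Y x * indicator A x"]
      by (simp add: emeasure_density ac_simps)
    show "emeasure (density \<nu> ?w) A = emeasure (density \<pi> ?w) A"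
    proof (rule ennreal_add_eq_imp_eq[OF le le, symmetric])
      show "emeasure (density \<pi> ?w) A + emeasure (density \<pi> ?w) (space S - A) =
          emeasure (density \<nu> ?w) A + emeasure (density \<nu> ?w) (space S - A)"
        using split[of \<nu>] split[of \<pi>] eq sets by simp
      show "emeasure (density \<nu> ?w) A + emeasure (density \<nu> ?w) (space S - A) \<noteq> top"
        using split[of \<nu>] fin sets by simp
    qed measurable
  qed (simp add: sets)
  then have eqw: "(\<integral>\<^sup>+ x. f x \<partial>density \<nu> ?w) = (\<integral>\<^sup>+ x. f x \<partial>density \<pi> ?w)" for f by simp
  have posY: "AE x in \<rho>. p Y x \<noteq> 0" if "AE x in \<rho>. 0 < transition_prob q t x {e}" "sets \<rho> = sets S" for \<rho>
    using that(1) AE_space[of \<rho>]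
  proof eventually_elim
    case (elim x)
    have "{e} \<union> (Y - {e}) = Y" using e by auto
    moreover have "Y - {e} \<in> sets S" using Y e by (intro sets.Diff)
    moreover have "x \<in> space S" using elim sets_eq_imp_space_eq[OF that(2)] by simp
    ultimately have eq: "p Y x = p {e} x + p (Y - {e}) x"
      using transition_prob_union[of "{e}" "Y - {e}" x t] e(2) by (simp add: p_def)
    have "0 < p {e} x" using elim(1) by (simp only: p_def)
    then show "p Y x \<noteq> 0" unfolding eq by auto
  qed
  have Zeq: "emeasure \<nu> X = emeasure \<pi> X" if X [measurable]: "X \<in> sets S" "X \<subseteq> Z" for X
  proof -
    have *: "emeasure \<rho> X = (\<integral>\<^sup>+ x. inverse (p Y x) * indicator X x \<partial>density \<rho> ?w)"
      if "AE x in \<rho>. 0 < transition_prob q t x {e}" and [measurable_cong]: "sets \<rho> = sets S" for \<rho>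
    proof -
      have "(\<integral>\<^sup>+ x. inverse (p Y x) * indicator X x \<partial>density \<rho> ?w) = (\<integral>\<^sup>+ x. ?w x * (inverse (p Y x) * indicator X x) \<partial>\<rho>)"
        by (rule nn_integral_density) measurable
      also have "\<dots> = (\<integral>\<^sup>+ x. indicator X x \<partial>\<rho>)"
        using posY[OF that] AE_space[of \<rho>]
      proof (intro nn_integral_cong_AE, eventually_elim)
        case (elim x)
        then have "p Y x \<noteq> top" using pY_le[of x] sets_eq_imp_space_eq[OF that(2)] by (auto simp: top_unique)
        then have "p Y x * inverse (p Y x) = 1"
          using elim by (simp add: ennreal_divide_self less_top flip: divide_ennreal_def)
        then show ?case using \<open>X \<subseteq> Z\<close> by (auto simp: indicator_def)
      qed
      finally show ?thesis using that by simp
    qed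
    show ?thesis using *[OF pos(1) sets(1)] *[OF pos(2) sets(2)] eqw by simp
  qed
  have all_le: "emeasure \<nu> A \<le> emeasure \<pi> A" if A [measurable]: "A \<in> sets S" for A
  proof -
    have "emeasure \<rho> A = emeasure \<rho> (A \<inter> Y) + emeasure \<rho> (A \<inter> Z)" if "sets \<rho> = sets S" for \<rho>
      using that YZ sets.sets_into_space[OF A] by (subst plus_emeasure) (auto intro!: arg_cong[where f="emeasure \<rho>"])
    then show ?thesis
      using le[of "A \<inter> Y"] Zeq[of "A \<inter> Z"] sets by (simp add: add_right_mono)
  qed
  show ?thesis
  proof (rule measure_eqI)
    fix A assume "A \<in> sets \<nu>"
    then have [measurable]: "A \<in> sets S" by (simp add: sets)
    have "N.prob A \<le> P.prob A" "N.prob (space S - A) \<le> P.prob (space S - A)"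
      using all_le[of A] all_le[of "space S - A"] by (auto simp: N.emeasure_eq_measure P.emeasure_eq_measure)
    then have "N.prob A = P.prob A"
      using N.prob_compl[of A] P.prob_compl[of A] by (simp add: sp sets)
    then show "emeasure \<nu> A = emeasure \<pi> A" by (simp add: N.emeasure_eq_measure P.emeasure_eq_measure)
  qed (simp add: sets)
qed

text \<open>The comparison needs \<open>e\<close> in the part of the Hahn decomposition where the
  first law is the smaller one. If \<open>e\<close> lies in the other part, the two laws exchange
  their roles.\<close>

lemma stationary_distribution_unique:
  assumes \<nu>: "stationary_distribution S q \<nu>" and \<pi>: "stationary_distribution S q \<pi>"
    and t: "0 \<le> t" and honest: "\<And>x. x \<in> space S \<Longrightarrow> transition_prob q t x (space S) = 1"
    and e: "{e} \<in> sets S"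
    and pos: "AE x in \<nu>. 0 < transition_prob q t x {e}" "AE x in \<pi>. 0 < transition_prob q t x {e}"
  shows "\<nu> = \<pi>"
proof -
  have fin: "finite_measure \<nu>" "finite_measure \<pi>"
    and sets: "sets \<nu> = sets S" "sets \<pi> = sets S"
    using \<nu> \<pi> by (auto simp: stationary_distribution_def prob_space_def)
  obtain Y where Y: "Y \<in> sets S" and le: "\<And>X. X \<in> sets S \<Longrightarrow> X \<subseteq> Y \<Longrightarrow> emeasure \<nu> X \<le> emeasure \<pi> X"
    and ge: "\<And>X. X \<in> sets S \<Longrightarrow> X \<inter> Y = {} \<Longrightarrow> emeasure \<pi> X \<le> emeasure \<nu> X"
    using finite_unsigned_Hahn_decomposition[OF fin(2,1)] sets by auto
  show ?thesis
  proof (cases "e \<in> Y")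
    case True
    then show ?thesis using stationary_distribution_le[OF \<nu> \<pi> t honest Y _ e le ge pos] by blast
  next
    case False
    then have "e \<in> space S - Y" using sets.sets_into_space[OF e] by auto
    show ?thesis
    proof (rule stationary_distribution_le[OF \<pi> \<nu> t honest _ \<open>e \<in> space S - Y\<close> e _ _ pos(2,1), symmetric])
      show "space S - Y \<in> sets S" using Y by auto
      show "emeasure \<pi> X \<le> emeasure \<nu> X" if "X \<in> sets S" "X \<subseteq> space S - Y" for X
        using that by (intro ge) auto
      show "emeasure \<nu> X \<le> emeasure \<pi> X" if "X \<in> sets S" "X \<inter> (space S - Y) = {}" for X
        using that sets.sets_into_space[of X S] by (intro le) auto
    qed
  qed
qed

end

section \<open>Lists over a finite measure space\<close>

text \<open>With the whole type as space, every list is a point of the list space, and the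
  unspecified value \<open>hd []\<close> causes no trouble for measurability.\<close>

locale finite_list_measure = finite_measure M for M :: "'a measure" +
  assumes space_UNIV [simp]: "space M = UNIV"
begin

section \<open>Measurability of list operations\<close>

lemma space_list_space [simp]: "space (list_space M) = UNIV"
  by (simp add: list_space_def space_UNIV)

lemma listset_subset: "{listset As | As. set As \<subseteq> sets M} \<subseteq> Pow (lists (space M))"
  by (auto simp: space_UNIV)

lemma sets_list_space: "sets (list_space M) = sigma_sets UNIV {listset As | As. set As \<subseteq> sets M}"
  unfolding list_space_def using listset_subset by (simp add: space_UNIV)

lemma listset_in_sets: "set As \<subseteq> sets M \<Longrightarrow> listset As \<in> sets (list_space M)"
  unfolding sets_list_space by (intro sigma_sets.Basic) auto

lemma measurable_list_spaceI:
  assumes "f \<in> space N \<rightarrow> UNIV" "\<And>As. set As \<subseteq> sets M \<Longrightarrow> f -` listset As \<inter> space N \<in> sets N"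
  shows "f \<in> N \<rightarrow>\<^sub>M list_space M"
  by (rule measurable_sigma_sets[OF sets_list_space]) (use assms in auto)

lemma Nil_in_sets [measurable]: "{[]} \<in> sets (list_space M)"
  using listset_in_sets[of "[]"] by simp

lemma UNIV_in_sets [simp, intro]: "UNIV \<in> sets M"
  using sets.top[of M] by (simp add: space_UNIV)

lemma listset_replicate_UNIV: "listset (replicate n UNIV) = {xs. length xs = n}"
  by (induction n) (auto simp: set_Cons_def length_Suc_conv)

lemma measurable_length [measurable]: "length \<in> list_space M \<rightarrow>\<^sub>M count_space UNIV"
proof (rule measurable_count_space_eq2_countable[THEN iffD2]; safe?)
  fix n
  have "listset (replicate n UNIV) \<in> sets (list_space M)"
    by (rule listset_in_sets) auto
  then show "length -` {n} \<inter> space (list_space M) \<in> sets (list_space M)"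
    by (simp add: listset_replicate_UNIV vimage_def)
qed auto

lemma measurable_tl [measurable]: "tl \<in> list_space M \<rightarrow>\<^sub>M list_space M"
proof (rule measurable_list_spaceI)
  fix As assume "set As \<subseteq> sets M"
  then have "listset (UNIV # As) \<in> sets (list_space M)" by (intro listset_in_sets) auto
  \<comment> \<open>Since \<open>tl [] = []\<close>, the empty list belongs to the preimage exactly
    when \<open>As\<close> is empty.\<close>
  moreover have "tl -` listset As = listset (UNIV # As) \<union> (if As = [] then {[]} else {})"
  proof (intro set_eqI)
    fix xs show "xs \<in> tl -` listset As \<longleftrightarrow> xs \<in> listset (UNIV # As) \<union> (if As = [] then {[]} else {})"
      by (cases xs; cases As) (auto simp: set_Cons_def)
  qed
  moreover have "(if As = [] then {[]} else {}) \<in> sets (list_space M)" by simp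
  ultimately show "tl -` listset As \<inter> space (list_space M) \<in> sets (list_space M)"
    by (simp only: space_list_space Int_UNIV_right sets.Un)
qed auto

lemma measurable_hd [measurable]: "hd \<in> list_space M \<rightarrow>\<^sub>M M"
proof (rule measurableI)
  fix A assume A: "A \<in> sets M"
  \<comment> \<open>\<open>hd []\<close> is some fixed element, so the empty list belongs to the
    preimage or not according to whether that element lies in \<open>A\<close>.\<close>
  have "hd -` A = (\<Union>n. listset (A # replicate n UNIV)) \<union> (if hd [] \<in> A then {[]} else {})"
  proof (intro set_eqI)
    fix xs show "xs \<in> hd -` A \<longleftrightarrow> xs \<in> (\<Union>n. listset (A # replicate n UNIV)) \<union> (if hd [] \<in> A then {[]} else {})"
      by (cases xs) (auto simp: set_Cons_def listset_replicate_UNIV)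
  qed
  moreover have "listset (A # replicate n UNIV) \<in> sets (list_space M)" for n
    using A by (intro listset_in_sets) auto
  then have "(\<Union>n. listset (A # replicate n UNIV)) \<in> sets (list_space M)"
    by (intro sets.countable_nat_UN) blast
  moreover have "(if hd [] \<in> A then {[]} else {}) \<in> sets (list_space M)" by simp
  ultimately show "hd -` A \<inter> space (list_space M) \<in> sets (list_space M)"
    by (simp only: space_list_space Int_UNIV_right sets.Un)
qed (simp add: space_UNIV)

lemma measurable_Cons [measurable (raw)]:
  assumes [measurable]: "f \<in> N \<rightarrow>\<^sub>M M" "g \<in> N \<rightarrow>\<^sub>M list_space M"
  shows "(\<lambda>x. f x # g x) \<in> N \<rightarrow>\<^sub>M list_space M"
proof (rule measurable_list_spaceI)
  fix As assume As: "set As \<subseteq> sets M"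
  show "(\<lambda>x. f x # g x) -` listset As \<inter> space N \<in> sets N"
  proof (cases As)
    case (Cons A Bs)
    then have [measurable]: "A \<in> sets M" "listset Bs \<in> sets (list_space M)"
      using As by (auto intro: listset_in_sets)
    have "(\<lambda>x. f x # g x) -` listset As \<inter> space N = (f -` A \<inter> space N) \<inter> (g -` listset Bs \<inter> space N)"
      using Cons by (auto simp: set_Cons_def)
    then show ?thesis by simp
  qed (simp add: vimage_def)
qed auto

lemma measurable_drop [measurable]: "drop i \<in> list_space M \<rightarrow>\<^sub>M list_space M"
proof (induction i)
  case (Suc i)
  have "(\<lambda>xs. drop i (tl xs)) \<in> list_space M \<rightarrow>\<^sub>M list_space M"
    by (rule measurable_compose[OF measurable_tl Suc])
  then show ?case by (simp add: drop_Suc[abs_def])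
qed (simp add: drop_0[abs_def])

text \<open>Concatenation with a first list of variable length is reached in two stages: here by
  induction on a fixed number i of entries taken, later by distinguishing the countably many values
  of the length.\<close>

lemma measurable_take_append:
  assumes [measurable]: "g \<in> N \<rightarrow>\<^sub>M list_space M" and "f \<in> N \<rightarrow>\<^sub>M list_space M"
  shows "(\<lambda>x. take i (f x) @ g x) \<in> N \<rightarrow>\<^sub>M list_space M"
  using assms(2)
proof (induction i arbitrary: f)
  case (Suc i)
  note [measurable] = Suc.prems
  have [measurable]: "(\<lambda>x. take i (tl (f x)) @ g x) \<in> N \<rightarrow>\<^sub>M list_space M"
    by (rule Suc.IH) measurable
  have eq: "(\<lambda>x. take (Suc i) (f x) @ g x) = (\<lambda>x. if f x \<in> {[]} then g x else hd (f x) # (take i (tl (f x)) @ g x))"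
    by (rule ext) (simp add: take_Suc)
  show ?case unfolding eq
  proof (rule measurable_If)
    show "(\<lambda>x. hd (f x) # (take i (tl (f x)) @ g x)) \<in> N \<rightarrow>\<^sub>M list_space M" by simp
    have "f -` {[]} \<inter> space N \<in> sets N" by (rule measurable_sets[OF Suc.prems Nil_in_sets])
    then show "{x \<in> space N. f x \<in> {[]}} \<in> sets N" by (simp add: vimage_def Int_def conj_commute)
  qed fact
qed simp

lemma measurable_take [measurable]: "take i \<in> list_space M \<rightarrow>\<^sub>M list_space M"
proof -
  have "(\<lambda>_. []) \<in> list_space M \<rightarrow>\<^sub>M list_space M" by (rule measurable_const) simp
  from measurable_take_append[OF this measurable_ident, of i] show ?thesis
    by (simp only: append_Nil2 id_def)
qed

lemma measurable_append [measurable (raw)]: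
  assumes [measurable]: "f \<in> N \<rightarrow>\<^sub>M list_space M" "g \<in> N \<rightarrow>\<^sub>M list_space M"
  shows "(\<lambda>x. f x @ g x) \<in> N \<rightarrow>\<^sub>M list_space M"
proof -
  have "(\<lambda>x. take (length (f x)) (f x) @ g x) \<in> N \<rightarrow>\<^sub>M list_space M"
    by (rule measurable_compose_countable[where f="\<lambda>i x. take i (f x) @ g x" and g="\<lambda>x. length (f x)"])
      (auto intro: measurable_take_append assms)
  then show ?thesis by simp
qed

lemma measurable_dropWhile [measurable (raw)]:
  assumes [measurable]: "Measurable.pred M P"
  shows "dropWhile P \<in> list_space M \<rightarrow>\<^sub>M list_space M"
proof -
  \<comment> \<open>The length of the run that is dropped, written as a least number so that its
    measurability is visible. The first disjunct stops the search at the end of a list all of whose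
    entries satisfy \<open>P\<close>.\<close>
  define k where "k xs = (LEAST k. length xs \<le> k \<or> \<not> P (hd (drop k xs)))" for xs
  have [measurable]: "k \<in> list_space M \<rightarrow>\<^sub>M count_space UNIV"
    unfolding k_def by measurable
  have "dropWhile P xs = drop (k xs) xs" for xs
  proof -
    have "k xs = length (takeWhile P xs)"
      unfolding k_def
    proof (rule Least_equality)
      show "length xs \<le> length (takeWhile P xs) \<or> \<not> P (hd (drop (length (takeWhile P xs)) xs))"
        using nth_length_takeWhile[of P xs] by (auto simp: hd_drop_conv_nth not_le)
      fix y assume y: "length xs \<le> y \<or> \<not> P (hd (drop y xs))"
      show "length (takeWhile P xs) \<le> y"
      proof (rule ccontr)
        assume "\<not> length (takeWhile P xs) \<le> y"
        then have "y < length (takeWhile P xs)" by simp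
        moreover from this have "y < length xs" using length_takeWhile_le[of P xs] by linarith
        ultimately show False using y nth_mem[of y "takeWhile P xs"] takeWhile_nth[of y P xs]
          by (auto simp: hd_drop_conv_nth dest: set_takeWhileD)
      qed
    qed
    then show ?thesis by (simp add: dropWhile_eq_drop)
  qed
  then have eq: "dropWhile P = (\<lambda>xs. drop (k xs) xs)" by auto
  show ?thesis unfolding eq
    by (rule measurable_compose_countable[where f="\<lambda>i. drop i" and g=k]) auto
qed

lemma measurable_map_list:
  assumes "\<And>i. i \<in> set is \<Longrightarrow> f i \<in> N \<rightarrow>\<^sub>M M"
  shows "(\<lambda>x. map (\<lambda>i. f i x) is) \<in> N \<rightarrow>\<^sub>M list_space M"
  using assms
proof (induction "is")
  case (Cons i "is")
  then have [measurable]: "f i \<in> N \<rightarrow>\<^sub>M M" "(\<lambda>x. map (\<lambda>i. f i x) is) \<in> N \<rightarrow>\<^sub>M list_space M"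
    by auto
  show ?case by simp
qed simp

lemma measurable_map_upt [measurable]: "(\<lambda>\<omega>. map \<omega> [0..<n]) \<in> Pi\<^sub>M {..<n} (\<lambda>_. M) \<rightarrow>\<^sub>M list_space M"
  by (rule measurable_map_list) (auto intro: measurable_component_singleton)

section \<open>Integration over the list measure\<close>

sublocale P: product_sigma_finite "\<lambda>_::nat. M"
  by unfold_locales

definition nn_integral_length :: "nat \<Rightarrow> ('a list \<Rightarrow> ennreal) \<Rightarrow> ennreal" where
  "nn_integral_length n f = (\<integral>\<^sup>+ \<omega>. f (map \<omega> [0..<n]) \<partial>Pi\<^sub>M {..<n} (\<lambda>_. M))"

lemma sets_list_measure [measurable_cong, simp]: "sets (list_measure M) = sets (list_space M)"
  using sets.sigma_sets_eq[of "list_space M"] sets.space_closed[of "list_space M"]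
  by (simp add: list_measure_def space_UNIV)

lemma space_list_measure [simp]: "space (list_measure M) = UNIV"
  using sets_eq_imp_space_eq[OF sets_list_measure] by simp

lemma emeasure_list_measure:
  assumes "A \<in> sets (list_space M)"
  shows "emeasure (list_measure M) A =
    (\<Sum>n. emeasure (distr (Pi\<^sub>M {..<n} (\<lambda>_. M)) (list_space M) (\<lambda>\<omega>. map \<omega> [0..<n])) A)"
proof (rule emeasure_measure_of[OF list_measure_def])
  let ?D = "\<lambda>n. distr (Pi\<^sub>M {..<n} (\<lambda>_. M)) (list_space M) (\<lambda>\<omega>. map \<omega> [0..<n])"
  show "sets (list_space M) \<subseteq> Pow (lists (space M))" by (simp add: space_UNIV)
  show "A \<in> sets (list_measure M)" using assms by simp
  show "positive (sets (list_measure M)) (\<lambda>A. \<Sum>n. emeasure (?D n) A)"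
    by (simp add: positive_def)
  show "countably_additive (sets (list_measure M)) (\<lambda>A. \<Sum>n. emeasure (?D n) A)"
  proof (rule countably_additiveI)
    fix A :: "nat \<Rightarrow> 'a list set" assume A: "range A \<subseteq> sets (list_measure M)" "disjoint_family A"
    have "(\<Sum>i. \<Sum>n. emeasure (?D n) (A i)) = (\<Sum>n. \<Sum>i. emeasure (?D n) (A i))"
      unfolding nn_integral_count_space_nat[symmetric]
      by (intro pair_sigma_finite.Fubini') (auto simp: pair_sigma_finite_def sigma_finite_measure_count_space pair_measure_countable)
    also have "\<dots> = (\<Sum>n. emeasure (?D n) (\<Union>i. A i))"
      using A by (intro suminf_cong suminf_emeasure) auto
    finally show "(\<Sum>i. \<Sum>n. emeasure (?D n) (A i)) = (\<Sum>n. emeasure (?D n) (\<Union>i. A i))" .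
  qed
qed

lemma nn_integral_list_measure:
  assumes "f \<in> borel_measurable (list_space M)"
  shows "(\<integral>\<^sup>+ xs. f xs \<partial>list_measure M) = (\<Sum>n. nn_integral_length n f)"
  using assms
proof (induction rule: borel_measurable_induct)
  case (cong f g)
  then have "f = g" by auto
  then show ?case using cong by simp
next
  case (set A)
  have "emeasure (distr (Pi\<^sub>M {..<n} (\<lambda>_. M)) (list_space M) (\<lambda>\<omega>. map \<omega> [0..<n])) A
      = nn_integral_length n (indicator A)" for n
  proof -
    let ?D = "distr (Pi\<^sub>M {..<n} (\<lambda>_. M)) (list_space M) (\<lambda>\<omega>. map \<omega> [0..<n])"
    have "emeasure ?D A = (\<integral>\<^sup>+ xs. indicator A xs \<partial>?D)" using set by simp
    also have "\<dots> = nn_integral_length n (indicator A)"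
      unfolding nn_integral_length_def using set by (intro nn_integral_distr) auto
    finally show ?thesis .
  qed
  then show ?case
    using set by (simp add: emeasure_list_measure)
next
  case (mult u c)
  then show ?case by (simp add: nn_integral_length_def nn_integral_cmult)
next
  case (add u v)
  then show ?case by (simp add: nn_integral_length_def nn_integral_add suminf_add)
next
  case (seq U)
  have "(\<integral>\<^sup>+ xs. (SUP i. U i) xs \<partial>list_measure M) = (SUP i. \<integral>\<^sup>+ xs. U i xs \<partial>list_measure M)"
    using seq by (simp add: nn_integral_monotone_convergence_SUP image_comp)
  also have "\<dots> = (SUP i. \<Sum>n. nn_integral_length n (U i))"
    using seq by simp
  also have "\<dots> = (\<Sum>n. SUP i. nn_integral_length n (U i))"
    using seq unfolding nn_integral_length_def
    by (intro ennreal_suminf_SUP_eq[symmetric]) (auto simp: incseq_def le_fun_def intro!: nn_integral_mono)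
  also have "\<dots> = (\<Sum>n. nn_integral_length n (SUP i. U i))"
    using seq unfolding nn_integral_length_def
    by (intro suminf_cong)
      (auto intro!: nn_integral_monotone_convergence_SUP[symmetric, THEN trans] simp: incseq_def le_fun_def image_comp)
  finally show ?case .
qed

lemma nn_integral_length_0: "nn_integral_length 0 f = f []"
  by (simp add: nn_integral_length_def PiM_empty nn_integral_count_space_finite)

lemma nn_integral_length_snoc:
  assumes [measurable]: "f \<in> borel_measurable (list_space M)"
  shows "nn_integral_length (Suc n) f = nn_integral_length n (\<lambda>xs. \<integral>\<^sup>+ x. f (xs @ [x]) \<partial>M)"
proof -
  have "nn_integral_length (Suc n) f = (\<integral>\<^sup>+ \<omega>. f (map \<omega> [0..<Suc n]) \<partial>Pi\<^sub>M (insert n {..<n}) (\<lambda>_. M))"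
    by (simp add: nn_integral_length_def lessThan_Suc)
  also have "\<dots> = (\<integral>\<^sup>+ \<omega>. (\<integral>\<^sup>+ x. f (map (fun_upd \<omega> n x) [0..<Suc n]) \<partial>M) \<partial>Pi\<^sub>M {..<n} (\<lambda>_. M))"
  proof (rule P.product_nn_integral_insert)
    show "(\<lambda>\<omega>. f (map \<omega> [0..<Suc n])) \<in> borel_measurable (Pi\<^sub>M (insert n {..<n}) (\<lambda>_. M))"
      using measurable_compose[OF measurable_map_upt[of "Suc n"] assms] by (simp add: lessThan_Suc)
  qed auto
  also have "\<dots> = nn_integral_length n (\<lambda>xs. \<integral>\<^sup>+ x. f (xs @ [x]) \<partial>M)"
    unfolding nn_integral_length_def by (intro nn_integral_cong) (auto intro!: arg_cong[where f=f])
  finally show ?thesis .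
qed

lemma nn_integral_length_append:
  assumes [measurable]: "f \<in> borel_measurable (list_space M)"
  shows "nn_integral_length (i + j) f = nn_integral_length i (\<lambda>p. nn_integral_length j (\<lambda>r. f (p @ r)))"
  using assms
proof (induction j arbitrary: f)
  case 0
  then show ?case by (simp add: nn_integral_length_0)
next
  case (Suc j)
  note [measurable] = Suc.prems
  show ?case
    by (simp add: nn_integral_length_snoc Suc.IH)
qed

lemma emeasure_PiM_UNIV: "emeasure (Pi\<^sub>M {..<n} (\<lambda>_. M)) (space (Pi\<^sub>M {..<n} (\<lambda>_. M))) = emeasure M UNIV ^ n"
  using P.emeasure_PiM[of "{..<n}" "\<lambda>_. UNIV"] by (simp add: space_PiM space_UNIV)

lemma sigma_finite_list_measure: "sigma_finite_measure (list_measure M)"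
proof
  let ?A = "range (\<lambda>n::nat. {xs :: 'a list. length xs = n})"
  have "emeasure (list_measure M) {xs. length xs = n} \<noteq> \<infinity>" for n
  proof -
    have [measurable]: "{xs. length xs = n} \<in> sets (list_space M)"
      using measurable_sets[OF measurable_length, of "{n}"] by (simp add: vimage_def)
    have "emeasure (list_measure M) {xs. length xs = n} = (\<Sum>k. nn_integral_length k (indicator {xs. length xs = n}))"
      by (subst nn_integral_list_measure[symmetric]) simp_all
    also have "\<dots> = (\<Sum>k\<in>{n}. nn_integral_length k (indicator {xs. length xs = n}))"
      by (rule suminf_finite) (auto simp: nn_integral_length_def)
    also have "\<dots> = emeasure M UNIV ^ n"
      by (simp add: nn_integral_length_def emeasure_PiM_UNIV)
    also have "\<dots> \<noteq> \<infinity>"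
      using emeasure_finite[of UNIV] by (simp add: power_eq_top_ennreal)
    finally show ?thesis .
  qed
  moreover have "?A \<subseteq> sets (list_measure M)"
    using measurable_sets[OF measurable_length, of "{_}"] by (auto simp: vimage_def)
  ultimately show "\<exists>A. countable A \<and> A \<subseteq> sets (list_measure M) \<and> \<Union> A = space (list_measure M) \<and>
      (\<forall>a\<in>A. emeasure (list_measure M) a \<noteq> \<infinity>)"
    by (intro exI[of _ ?A]) auto
qed

sublocale L: sigma_finite_measure "list_measure M"
  by (rule sigma_finite_list_measure)

lemma nn_integral_length_cong: "(\<And>xs. length xs = n \<Longrightarrow> f xs = g xs) \<Longrightarrow> nn_integral_length n f = nn_integral_length n g"
  unfolding nn_integral_length_def by (intro nn_integral_cong) auto

lemma measurable_nn_integral_length [measurable (raw)]: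
  assumes [measurable]: "(\<lambda>z. f (fst z) (snd z)) \<in> borel_measurable (N \<Otimes>\<^sub>M list_space M)"
  shows "(\<lambda>x. nn_integral_length n (f x)) \<in> borel_measurable N"
proof -
  interpret sigma_finite_measure "Pi\<^sub>M {..<n} (\<lambda>_. M)" by (rule P.sigma_finite) simp
  show ?thesis
    unfolding nn_integral_length_def
    by (rule borel_measurable_nn_integral)
      (use measurable_compose[OF _ assms, of "\<lambda>z. (fst z, map (snd z) [0..<n])"] in \<open>simp add: split_beta'\<close>)
qed

lemma nn_integral_length_suminf:
  assumes [measurable]: "\<And>j. f j \<in> borel_measurable (list_space M)"
  shows "nn_integral_length n (\<lambda>xs. \<Sum>j. f j xs) = (\<Sum>j. nn_integral_length n (f j))"
  unfolding nn_integral_length_def by (rule nn_integral_suminf) measurable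

lemma suminf_triangle:
  fixes a :: "nat \<Rightarrow> nat \<Rightarrow> ennreal"
  shows "(\<Sum>i. \<Sum>j. a i j) = (\<Sum>n. \<Sum>i\<le>n. a i (n - i))"
proof -
  have "(\<Sum>j. a i j) = (\<Sum>n. a i (n - i) * of_bool (i \<le> n))" for i
    using suminf_offset[of "\<lambda>n. a i (n - i) * of_bool (i \<le> n)" i] by simp
  then have "(\<Sum>i. \<Sum>j. a i j) = (\<Sum>i. \<Sum>n. a i (n - i) * of_bool (i \<le> n))" by simp
  also have "\<dots> = (\<Sum>n. \<Sum>i. a i (n - i) * of_bool (i \<le> n))"
    unfolding nn_integral_count_space_nat[symmetric]
    by (intro pair_sigma_finite.Fubini') (auto simp: pair_sigma_finite_def sigma_finite_measure_count_space pair_measure_countable)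
  also have "\<dots> = (\<Sum>n. \<Sum>i\<le>n. a i (n - i))"
    by (rule suminf_cong, subst suminf_finite[of "{..n}" for n]) (auto intro!: sum.cong)
  finally show ?thesis .
qed

lemma measurable_sum_length [measurable (raw)]:
  fixes g :: "_ \<Rightarrow> nat \<Rightarrow> _ \<Rightarrow> ennreal"
  assumes [measurable]: "f \<in> N \<rightarrow>\<^sub>M list_space M" and g: "\<And>i. (\<lambda>x. g (f x) i x) \<in> borel_measurable N"
  shows "(\<lambda>x. \<Sum>i<length (f x). g (f x) i x) \<in> borel_measurable N"
    "(\<lambda>x. \<Sum>i\<le>length (f x). g (f x) i x) \<in> borel_measurable N"
  using g
  by (auto intro!: measurable_compose_countable[where f="\<lambda>n x. \<Sum>i<n. g (f x) i x" and g="\<lambda>x. length (f x)"]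
      measurable_compose_countable[where f="\<lambda>n x. \<Sum>i\<le>n. g (f x) i x" and g="\<lambda>x. length (f x)"])

text \<open>The Cauchy product of the length decompositions of the two factors. It converts
  integration over a pair of lists into integration over their concatenation, summed over all
  cutting positions, and later serves to re-index jumps by their target list.\<close>

lemma nn_integral_list_measure_split:
  assumes g [measurable]: "(\<lambda>z. g (fst z) (snd z)) \<in> borel_measurable (list_space M \<Otimes>\<^sub>M list_space M)"
  shows "(\<integral>\<^sup>+ xs. (\<Sum>i\<le>length xs. g (take i xs) (drop i xs)) \<partial>list_measure M)
    = (\<integral>\<^sup>+ p. (\<integral>\<^sup>+ r. g p r \<partial>list_measure M) \<partial>list_measure M)"
proof -
  have [measurable]: "(\<lambda>x. g (a x) (b x)) \<in> borel_measurable N"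
    if "a \<in> N \<rightarrow>\<^sub>M list_space M" "b \<in> N \<rightarrow>\<^sub>M list_space M" for a b and N :: "'b measure"
    using measurable_compose[OF measurable_Pair[OF that] g] by simp
  have "(\<integral>\<^sup>+ p. (\<integral>\<^sup>+ r. g p r \<partial>list_measure M) \<partial>list_measure M) = (\<Sum>i. \<Sum>j. nn_integral_length i (\<lambda>p. nn_integral_length j (g p)))"
    by (simp add: nn_integral_list_measure nn_integral_length_suminf)
  also have "\<dots> = (\<Sum>n. \<Sum>i\<le>n. nn_integral_length i (\<lambda>p. nn_integral_length (n - i) (g p)))"
    by (rule suminf_triangle)
  also have "\<dots> = (\<Sum>n. \<Sum>i\<le>n. nn_integral_length n (\<lambda>xs. g (take i xs) (drop i xs)))"
  proof (intro suminf_cong sum.cong refl)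
    fix n i :: nat assume "i \<in> {..n}"
    then have "nn_integral_length n (\<lambda>xs. g (take i xs) (drop i xs)) =
        nn_integral_length (i + (n - i)) (\<lambda>xs. g (take i xs) (drop i xs))" by simp
    also have "\<dots> = nn_integral_length i (\<lambda>p. nn_integral_length (n - i) (\<lambda>r. g (take i (p @ r)) (drop i (p @ r))))"
      by (rule nn_integral_length_append) measurable
    also have "\<dots> = nn_integral_length i (\<lambda>p. nn_integral_length (n - i) (g p))"
      by (rule nn_integral_length_cong) simp
    finally show "nn_integral_length i (\<lambda>p. nn_integral_length (n - i) (g p)) =
      nn_integral_length n (\<lambda>xs. g (take i xs) (drop i xs))" ..
  qed
  also have "(\<Sum>n. \<Sum>i\<le>n. nn_integral_length n (\<lambda>xs. g (take i xs) (drop i xs))) = (\<Sum>n. nn_integral_length n (\<lambda>xs. \<Sum>i\<le>length xs. g (take i xs) (drop i xs)))"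
    by (simp add: nn_integral_length_def nn_integral_sum)
  also have "\<dots> = (\<integral>\<^sup>+ xs. (\<Sum>i\<le>length xs. g (take i xs) (drop i xs)) \<partial>list_measure M)"
    by (rule nn_integral_list_measure[symmetric]) measurable
  finally show ?thesis ..
qed

lemma nn_integral_length_Cons:
  assumes [measurable]: "f \<in> borel_measurable (list_space M)"
  shows "nn_integral_length (Suc n) f = (\<integral>\<^sup>+ x. nn_integral_length n (\<lambda>xs. f (x # xs)) \<partial>M)"
proof -
  have 1: "nn_integral_length (Suc 0) h = (\<integral>\<^sup>+ x. h [x] \<partial>M)" if "h \<in> borel_measurable (list_space M)" for h
    using nn_integral_length_snoc[OF that, of 0] by (simp add: nn_integral_length_0)
  have "nn_integral_length (Suc n) f = nn_integral_length (Suc 0 + n) f" by simp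
  also have "\<dots> = nn_integral_length (Suc 0) (\<lambda>p. nn_integral_length n (\<lambda>r. f (p @ r)))"
    by (rule nn_integral_length_append) fact
  also have "\<dots> = (\<integral>\<^sup>+ x. nn_integral_length n (\<lambda>r. f ([x] @ r)) \<partial>M)"
    by (rule 1) measurable
  finally show ?thesis by simp
qed

lemma nn_integral_list_measure_Cons:
  assumes [measurable]: "f \<in> borel_measurable (list_space M)"
  shows "(\<integral>\<^sup>+ xs. f xs \<partial>list_measure M) = f [] + (\<integral>\<^sup>+ x. (\<integral>\<^sup>+ xs. f (x # xs) \<partial>list_measure M) \<partial>M)"
proof -
  have "(\<integral>\<^sup>+ xs. f xs \<partial>list_measure M) = f [] + (\<Sum>n. nn_integral_length (Suc n) f)"
    using suminf_offset[of "\<lambda>n. nn_integral_length n f" 1]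
    by (simp add: nn_integral_list_measure nn_integral_length_0)
  also have "(\<Sum>n. nn_integral_length (Suc n) f) = (\<integral>\<^sup>+ x. (\<Sum>n. nn_integral_length n (\<lambda>xs. f (x # xs))) \<partial>M)"
    by (simp add: nn_integral_length_Cons nn_integral_suminf)
  finally show ?thesis
    by (simp add: nn_integral_list_measure)
qed

lemma nn_integral_list_measure_snoc:
  assumes [measurable]: "f \<in> borel_measurable (list_space M)"
  shows "(\<integral>\<^sup>+ xs. f xs \<partial>list_measure M) = f [] + (\<integral>\<^sup>+ xs. (\<integral>\<^sup>+ x. f (xs @ [x]) \<partial>M) \<partial>list_measure M)"
proof -
  have "(\<integral>\<^sup>+ xs. f xs \<partial>list_measure M) = f [] + (\<Sum>n. nn_integral_length (Suc n) f)"
    using suminf_offset[of "\<lambda>n. nn_integral_length n f" 1]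
    by (simp add: nn_integral_list_measure nn_integral_length_0)
  then show ?thesis
    by (simp add: nn_integral_list_measure nn_integral_length_snoc)
qed

lemma nn_integral_list_measure_marked:
  assumes g [measurable]: "(\<lambda>z. g (fst z) (fst (snd z)) (snd (snd z))) \<in> borel_measurable (list_space M \<Otimes>\<^sub>M M \<Otimes>\<^sub>M list_space M)"
  shows "(\<integral>\<^sup>+ xs. (\<Sum>i<length xs. g (take i xs) (xs ! i) (drop (Suc i) xs)) \<partial>list_measure M)
    = (\<integral>\<^sup>+ p. (\<integral>\<^sup>+ x. (\<integral>\<^sup>+ r. g p x r \<partial>list_measure M) \<partial>M) \<partial>list_measure M)"
proof -
  have [measurable]: "(\<lambda>x. g (a x) (b x) (c x)) \<in> borel_measurable N"
    if "a \<in> N \<rightarrow>\<^sub>M list_space M" "b \<in> N \<rightarrow>\<^sub>M M" "c \<in> N \<rightarrow>\<^sub>M list_space M" for a b c and N :: "'b measure"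
    using measurable_compose[OF measurable_Pair[OF that(1) measurable_Pair[OF that(2,3)]] g] by simp
  \<comment> \<open>The marked entry is the head of the second piece; a cut at the very end leaves
    no entry and gets the value 0.\<close>
  let ?h = "\<lambda>p r. if r \<in> {[]} then 0 else g p (hd r) (tl r)"
  have "(\<Sum>i<length xs. g (take i xs) (xs ! i) (drop (Suc i) xs)) = (\<Sum>i\<le>length xs. ?h (take i xs) (drop i xs))" for xs
  proof -
    have "(\<Sum>i\<le>length xs. ?h (take i xs) (drop i xs)) = (\<Sum>i<length xs. ?h (take i xs) (drop i xs))"
      by (simp add: lessThan_Suc_atMost[symmetric])
    also have "\<dots> = (\<Sum>i<length xs. g (take i xs) (xs ! i) (drop (Suc i) xs))"
      by (intro sum.cong) (auto simp: hd_drop_conv_nth drop_Suc tl_drop)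
    finally show ?thesis ..
  qed
  then have "(\<integral>\<^sup>+ xs. (\<Sum>i<length xs. g (take i xs) (xs ! i) (drop (Suc i) xs)) \<partial>list_measure M) =
      (\<integral>\<^sup>+ p. (\<integral>\<^sup>+ r. ?h p r \<partial>list_measure M) \<partial>list_measure M)"
    using nn_integral_list_measure_split[of ?h] by simp
  also have "\<dots> = (\<integral>\<^sup>+ p. (\<integral>\<^sup>+ x. (\<integral>\<^sup>+ r. g p x r \<partial>list_measure M) \<partial>M) \<partial>list_measure M)"
    by (intro nn_integral_cong) (subst nn_integral_list_measure_Cons, auto)
  finally show ?thesis .
qed

end

section \<open>The backward detailed process\<close>

text \<open>Supersolution of the recursion for the total weight of the lists that extend a prefix with \<open>j\<close>
  unmatched elements.\<close>

lemma ex_supersolution: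
  fixes \<mu> a :: real
  assumes "0 < \<mu>" "0 \<le> a"
  shows "\<exists>h :: nat \<Rightarrow> real. \<forall>j\<ge>1. 0 \<le> h j \<and> 1 + a * h (Suc j) \<le> \<mu> * real j * h j"
proof -
  \<comment> \<open>From \<open>J\<close> on the constant 1 satisfies the inequality. Below
    \<open>J\<close> the values are filled in downwards, one index at a time, by solving the
    recursion with equality.\<close>
  obtain J :: nat where J: "(1 + a) / \<mu> < real J" using reals_Archimedean2 by blast
  have "\<exists>h :: nat \<Rightarrow> real. (\<forall>j. 0 \<le> h j) \<and> (\<forall>j\<ge>1. J \<le> j + k \<longrightarrow> 1 + a * h (Suc j) \<le> \<mu> * real j * h j)" for k
  proof (induction k)
    case 0
    have "1 + a \<le> \<mu> * real j" if "J \<le> j" for j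
    proof -
      have "(1 + a) / \<mu> \<le> real j" using J that by linarith
      then show ?thesis using assms by (simp add: divide_le_eq mult.commute)
    qed
    then show ?case by (intro exI[of _ "\<lambda>_. 1"]) auto
  next
    case (Suc k)
    then obtain h :: "nat \<Rightarrow> real" where h: "\<And>j. 0 \<le> h j" "\<And>j. 1 \<le> j \<Longrightarrow> J \<le> j + k \<Longrightarrow> 1 + a * h (Suc j) \<le> \<mu> * real j * h j"
      by blast
    \<comment> \<open>Once \<open>Suc k\<close> reaches \<open>J\<close> this is 0, where division
      by zero gives the harmless value 0; the inequality is claimed only from index 1 on.\<close>
    define i where "i = J - Suc k"
    define h' where "h' j = (if j = i then (1 + a * h (Suc i)) / (\<mu> * real i) else h j)" for j
    have "0 \<le> h' j" for j using h(1) assms by (simp add: h'_def)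
    moreover have "1 + a * h' (Suc j) \<le> \<mu> * real j * h' j" if j: "1 \<le> j" "J \<le> j + Suc k" for j
    proof (cases "j = i")
      case True
      then show ?thesis using j assms by (simp add: h'_def)
    next
      case False
      then have "J \<le> j + k" "Suc j \<noteq> i" using j by (auto simp: i_def)
      then show ?thesis using h(2)[of j] j False by (simp add: h'_def)
    qed
    ultimately show ?case by (intro exI[of _ h']) blast
  qed
  from this[of J] show ?thesis by (meson le_add2)
qed

section \<open>Compatibility, validity and pruning\<close>

definition loc :: "'a particle \<Rightarrow> 'a \<times> color" where "loc z = (pos z, col z)"
definition as_u :: "'a \<times> color \<Rightarrow> 'a particle" where "as_u y = (fst y, snd y, Unmatched)"
definition as_m :: "'a \<times> color \<Rightarrow> 'a particle" where "as_m y = (fst y, snd y, Matched)"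

definition compatible :: "'a::metric_space particle \<Rightarrow> 'a \<times> color \<Rightarrow> bool" where
  "compatible x y \<longleftrightarrow> (is_u x \<longrightarrow> y \<notin> nbhd x)"

definition head_ok :: "'a particle list \<Rightarrow> bool" where
  "head_ok xs \<longleftrightarrow> (xs \<noteq> [] \<longrightarrow> is_u (hd xs))"

abbreviation ordered :: "'a::metric_space particle list \<Rightarrow> bool" where
  "ordered \<equiv> sorted_wrt (\<lambda>x z. compatible x (loc z))"

definition count_u :: "'a particle list \<Rightarrow> nat" where
  "count_u xs = length (filter is_u xs)"

lemma loc_as_u [simp]: "loc (as_u y) = y" and loc_as_m [simp]: "loc (as_m y) = y"
  and is_u_as_u [simp]: "is_u (as_u y)" and is_u_as_m [simp]: "\<not> is_u (as_m y)"
  by (simp_all add: loc_def as_u_def as_m_def pos_def col_def is_u_def)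

lemma is_m_iff [simp]: "is_m x \<longleftrightarrow> \<not> is_u x"
  by (cases "snd (snd x)") (auto simp: is_m_def is_u_def)

lemma opp_eq_iff: "d = opp c \<longleftrightarrow> c \<noteq> d"
  by (cases c; cases d) auto

lemma compatible_iff: "compatible x (loc z) \<longleftrightarrow> (is_u x \<and> dist (pos x) (pos z) < 1 \<longrightarrow> col x = col z)"
  by (auto simp: compatible_def nbhd_def loc_def opp_eq_iff)

lemma compatible_sym: "is_u x \<Longrightarrow> is_u z \<Longrightarrow> compatible x (loc z) \<longleftrightarrow> compatible z (loc x)"
  by (auto simp: compatible_iff dist_commute)

lemma compatible_matched [simp]: "\<not> is_u x \<Longrightarrow> compatible x y"
  by (simp add: compatible_def)

text \<open>The condition on two unmatched entries is symmetric, so it may be restricted to i < j.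
  It then merges with the condition on an unmatched entry before a matched one into a single
  condition on ordered pairs, whatever the mark of the later entry.\<close>

lemma valid_iff: "valid xs \<longleftrightarrow> head_ok xs \<and> ordered xs"
proof -
  have "ordered xs \<longleftrightarrow> (\<forall>i<length xs. \<forall>j<length xs.
        is_u (xs ! i) \<and> is_u (xs ! j) \<and> dist (pos (xs ! i)) (pos (xs ! j)) < 1
          \<longrightarrow> col (xs ! i) = col (xs ! j)) \<and>
     (\<forall>j<length xs. \<forall>i<j.
        is_u (xs ! i) \<and> is_m (xs ! j) \<and> dist (pos (xs ! i)) (pos (xs ! j)) < 1
          \<longrightarrow> col (xs ! i) = col (xs ! j))" (is "_ \<longleftrightarrow> ?U \<and> ?M")
  proof
    assume "ordered xs"
    then have *: "is_u (xs ! i) \<Longrightarrow> dist (pos (xs ! i)) (pos (xs ! j)) < 1 \<Longrightarrow> col (xs ! i) = col (xs ! j)"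
      if "i < j" "j < length xs" for i j
      using that by (auto simp: sorted_wrt_iff_nth_less compatible_iff)
    show "?U \<and> ?M"
    proof (intro conjI allI impI)
      fix i j assume ij: "i < length xs" "j < length xs"
        and "is_u (xs ! i) \<and> is_u (xs ! j) \<and> dist (pos (xs ! i)) (pos (xs ! j)) < 1"
      then have "is_u (xs ! i)" "is_u (xs ! j)" "dist (pos (xs ! i)) (pos (xs ! j)) < 1"
        "dist (pos (xs ! j)) (pos (xs ! i)) < 1"
        by (simp_all add: dist_commute)
      then show "col (xs ! i) = col (xs ! j)"
        using *[OF _ ij(2)] *[OF _ ij(1)] by (metis linorder_less_linear)
    next
      fix i j assume "i < j" "j < length xs" "is_u (xs ! i) \<and> is_m (xs ! j) \<and> dist (pos (xs ! i)) (pos (xs ! j)) < 1"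
      then show "col (xs ! i) = col (xs ! j)" using * by blast
    qed
  next
    assume UM: "?U \<and> ?M"
    show "ordered xs"
      unfolding sorted_wrt_iff_nth_less compatible_iff
    proof (intro allI impI)
      fix i j assume "i < j" "j < length xs" "is_u (xs ! i) \<and> dist (pos (xs ! i)) (pos (xs ! j)) < 1"
      then show "col (xs ! i) = col (xs ! j)"
        using UM by (cases "is_u (xs ! j)") (meson is_m_iff less_trans)+
    qed
  qed
  then show ?thesis by (simp add: valid_def head_ok_def hd_conv_nth)
qed

lemma ordered_append:
  "ordered (xs @ ys) \<longleftrightarrow> ordered xs \<and> ordered ys \<and> (\<forall>x\<in>set xs. \<forall>y\<in>set ys. compatible x (loc y))"
  by (rule sorted_wrt_append)

text \<open>Against unmatched entries the position of \<open>b\<close> is irrelevant by symmetry,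
  and a matched entry in front of \<open>b\<close> imposes nothing. Hence only the matched entries
  behind \<open>b\<close> feel where it is inserted.\<close>

lemma ordered_insert_as_u:
  "ordered (p @ as_u b # r) \<longleftrightarrow> ordered (p @ r) \<and> (\<forall>x\<in>set (p @ r). compatible x b) \<and>
     (\<forall>y\<in>set r. \<not> is_u y \<longrightarrow> compatible (as_u b) (loc y))"
proof -
  have "compatible (as_u b) (loc y) \<longleftrightarrow> compatible y b" if "is_u y" for y
    using compatible_sym[of "as_u b" y] that by simp
  then have "(\<forall>y\<in>set r. compatible (as_u b) (loc y)) \<longleftrightarrow>
      (\<forall>y\<in>set r. compatible y b) \<and> (\<forall>y\<in>set r. \<not> is_u y \<longrightarrow> compatible (as_u b) (loc y))"
    using compatible_matched by metis
  then show ?thesis by (simp add: ordered_append ball_Un) blast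
qed

text \<open>On the left is the list before an exchange, together with the requirement that no
  earlier unmatched entry claims \<open>y\<close>. On the right this becomes a condition on the list
  with \<open>y\<close> in place, of the same shape as for an insertion of \<open>b\<close> just
  behind \<open>y\<close>.\<close>

lemma ordered_replace_as_m:
  assumes "\<not> is_u y"
  shows "ordered (p @ as_u b # r) \<and> (\<forall>x\<in>set p. compatible x (loc y)) \<longleftrightarrow>
    ordered (p @ y # r) \<and> (\<forall>x\<in>set (p @ y # r). compatible x b) \<and>
     (\<forall>y\<in>set r. \<not> is_u y \<longrightarrow> compatible (as_u b) (loc y))"
  unfolding ordered_insert_as_u using assms by (auto simp: ordered_append)

lemma count_u_simps [simp]: "count_u [] = 0" "count_u (x # xs) = (if is_u x then Suc (count_u xs) else count_u xs)"
  "count_u (xs @ ys) = count_u xs + count_u ys"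
  by (simp_all add: count_u_def)

lemma prune_head_ok: "xs \<noteq> [] \<Longrightarrow> head_ok xs \<Longrightarrow> prune (xs @ ys) = xs @ ys"
  by (cases xs) (auto simp: prune_def head_ok_def)

lemma head_ok_prune [simp]: "head_ok (prune xs)"
  using hd_dropWhile[of is_m xs] by (auto simp: head_ok_def prune_def)

lemma prune_Cons_matched [simp]: "\<not> is_u x \<Longrightarrow> prune (x # xs) = prune xs"
  by (simp add: prune_def)

lemma prune_Nil [simp]: "prune [] = []"
  by (simp add: prune_def)

lemma count_u_prune [simp]: "count_u (prune xs) = count_u xs"
  by (induction xs) (auto simp: prune_def)

lemma UNIV_color: "UNIV = {Red, Blue}"
  using color.exhaust by auto

lemma UNIV_mark: "UNIV = {Unmatched, Matched}"
  using mark.exhaust by auto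

text \<open>A compact space has a countable dense subset, which replaces the second countability that the
  type class does not provide.\<close>

lemma dist_less_measurable:
  assumes "compact (UNIV :: 'a::metric_space set)"
  shows "{z. dist (fst z) (snd z) < e} \<in> sets (borel \<Otimes>\<^sub>M (borel :: 'a measure))"
proof -
  have "\<exists>k. finite k \<and> UNIV \<subseteq> (\<Union>x\<in>k. ball (x::'a) (1 / real (Suc n)))" for n
    using compact_eq_totally_bounded[THEN iffD1, OF assms] by (auto dest!: spec[of _ "1 / real (Suc n)"])
  then obtain k where k: "\<And>n. finite (k n)" "\<And>n. UNIV \<subseteq> (\<Union>x\<in>k n. ball (x::'a) (1 / real (Suc n)))"
    by metis
  define Q where "Q = (\<Union>n. k n)"
  have Q: "countable Q" unfolding Q_def using k(1) by (auto intro: countable_finite)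
  have eq: "{z. dist (fst z) (snd z) < e} = (\<Union>c\<in>Q. \<Union>r\<in>\<rat>. ball c r \<times> ball c (e - r))"
  proof (intro set_eqI iffI)
    fix z :: "'a \<times> 'a" assume "z \<in> {z. dist (fst z) (snd z) < e}"
    then have z: "dist (fst z) (snd z) < e" by simp
    \<comment> \<open>The slack in the strict inequality. A centre within r < d / 3 of the first
      point has distance less than (e - d) + r from the second one, which is below e - r.\<close>
    define d where "d = e - dist (fst z) (snd z)"
    obtain n where n: "1 / real (Suc n) < d / 3" using z nat_approx_posE[of "d / 3"] by (auto simp: d_def)
    obtain c where c: "c \<in> k n" "dist c (fst z) < 1 / real (Suc n)" using k(2)[of n] by (auto simp: subset_eq)
    obtain r where r: "r \<in> \<rat>" "1 / real (Suc n) < r" "r < d / 3" using Rats_dense_in_real[OF n] by auto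
    have "dist c (snd z) \<le> dist c (fst z) + dist (fst z) (snd z)" by (rule dist_triangle)
    moreover have "dist c (fst z) < r" using c(2) r(2) by (rule less_trans)
    moreover have "0 < r" using r(2) by (rule less_trans[rotated]) simp
    ultimately have "dist c (snd z) < e - r" "dist c (fst z) < r" using r(3) unfolding d_def by simp_all
    then show "z \<in> (\<Union>c\<in>Q. \<Union>r\<in>\<rat>. ball c r \<times> ball c (e - r))"
      using c(1) r(1) by (cases z) (auto simp: Q_def)
  next
    fix z :: "'a \<times> 'a" assume "z \<in> (\<Union>c\<in>Q. \<Union>r\<in>\<rat>. ball c r \<times> ball c (e - r))"
    then obtain c r where "dist c (fst z) < r" "dist c (snd z) < e - r" by auto
    then show "z \<in> {z. dist (fst z) (snd z) < e}"
      using dist_triangle3[of "fst z" "snd z" c] by simp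
  qed
  show ?thesis unfolding eq
    by (intro sets.countable_UN'' Q countable_rat pair_measureI) auto
qed

section \<open>The model and its measurability\<close>

locale fifm =
  fixes L :: "'a::metric_space measure" and \<mu> :: real
  assumes compact_UNIV: "compact (UNIV :: 'a set)"
    and radon: "radon_measure L"
    and \<mu>_pos: "\<mu> > 0"
begin

lemma sets_L [measurable_cong]: "sets L = sets borel"
  using radon by (simp add: radon_measure_def)

lemma space_L: "space L = UNIV"
  using sets_eq_imp_space_eq[OF sets_L] by simp

sublocale L: finite_measure L
proof (rule finite_measureI)
  have "emeasure L UNIV < \<infinity>" using radon compact_UNIV unfolding radon_measure_def by blast
  then show "emeasure L (space L) \<noteq> \<infinity>" by (simp add: space_L)
qed

abbreviation "a \<equiv> 2 * measure L (space L)"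
abbreviation "M \<equiv> marked L"
abbreviation "B \<equiv> colored L"

lemma space_B [simp]: "space B = UNIV"
  by (simp add: colored_def space_pair_measure space_L)

lemma finite_C: "finite_measure (count_space (UNIV :: color set))"
  and finite_U: "finite_measure (count_space (UNIV :: mark set))"
  by (auto intro!: finite_measure_count_space simp: UNIV_color UNIV_mark)

sublocale B: finite_measure B
  unfolding colored_def by (intro finite_measure_pair_measure L.finite_measure_axioms finite_C)

sublocale M: finite_list_measure M
proof (intro finite_list_measure.intro finite_list_measure_axioms.intro)
  show "finite_measure M"
    unfolding marked_def by (intro finite_measure_pair_measure L.finite_measure_axioms finite_C finite_U)
  show "space M = UNIV" by (simp add: marked_def space_pair_measure space_L)
qed

lemma measurable_pos [measurable]: "pos \<in> M \<rightarrow>\<^sub>M L"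
  unfolding pos_def[abs_def] marked_def by measurable

lemma measurable_col [measurable]: "col \<in> M \<rightarrow>\<^sub>M count_space UNIV"
  unfolding col_def[abs_def] marked_def by measurable

lemma measurable_is_u [measurable]: "Measurable.pred M is_u"
  unfolding is_u_def[abs_def] marked_def by measurable

lemma measurable_fst_B [measurable]: "fst \<in> B \<rightarrow>\<^sub>M L"
  unfolding colored_def by measurable

lemma measurable_snd_B [measurable]: "snd \<in> B \<rightarrow>\<^sub>M count_space UNIV"
  unfolding colored_def by measurable

lemma measurable_loc [measurable]: "loc \<in> M \<rightarrow>\<^sub>M B"
  unfolding loc_def[abs_def] colored_def by measurable

lemma measurable_as_u [measurable]: "as_u \<in> B \<rightarrow>\<^sub>M M"
  unfolding as_u_def[abs_def] marked_def by measurable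

lemma measurable_as_m [measurable]: "as_m \<in> B \<rightarrow>\<^sub>M M"
  unfolding as_m_def[abs_def] marked_def by measurable

lemma measurable_dist_less [measurable (raw)]:
  assumes [measurable]: "f \<in> N \<rightarrow>\<^sub>M L" "g \<in> N \<rightarrow>\<^sub>M L"
  shows "Measurable.pred N (\<lambda>x. dist (f x) (g x) < e)"
proof -
  have "(\<lambda>x. (f x, g x)) \<in> N \<rightarrow>\<^sub>M borel \<Otimes>\<^sub>M borel"
    using assms unfolding measurable_cong_sets[OF refl sets_L] by (rule measurable_Pair)
  from measurable_sets[OF this dist_less_measurable[OF compact_UNIV]]
  show ?thesis by (simp add: pred_def vimage_def Int_def conj_commute)
qed

lemma measurable_compatible [measurable (raw)]:
  assumes [measurable]: "f \<in> N \<rightarrow>\<^sub>M M" "g \<in> N \<rightarrow>\<^sub>M B"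
  shows "Measurable.pred N (\<lambda>x. compatible (f x) (g x))"
proof -
  have eq: "compatible (f x) (g x) \<longleftrightarrow> (is_u (f x) \<and> dist (pos (f x)) (fst (g x)) < 1 \<longrightarrow>
     (col (f x) = Red \<and> snd (g x) = Red \<or> col (f x) = Blue \<and> snd (g x) = Blue))" for x
    by (cases "col (f x)"; cases "snd (g x)") (auto simp: compatible_def nbhd_def)
  show ?thesis unfolding eq by measurable
qed

lemma ball_set_conv_drop: "(\<forall>x\<in>set xs. P x) \<longleftrightarrow> (\<forall>i<length xs. P (hd (drop i xs)))"
  by (auto simp: all_set_conv_all_nth hd_drop_conv_nth)

lemma measurable_compatible_list [measurable (raw)]:
  assumes [measurable]: "f \<in> N \<rightarrow>\<^sub>M list_space M" "g \<in> N \<rightarrow>\<^sub>M B"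
  shows "Measurable.pred N (\<lambda>x. \<forall>z\<in>set (f x). compatible z (g x))"
  unfolding ball_set_conv_drop by measurable

lemma measurable_head_ok [measurable]: "Measurable.pred (list_space M) head_ok"
proof -
  have eq: "head_ok xs \<longleftrightarrow> (length xs \<noteq> 0 \<longrightarrow> is_u (hd xs))" for xs :: "'a particle list"
    by (simp add: head_ok_def)
  show ?thesis unfolding eq[abs_def] by measurable
qed

lemma measurable_ordered [measurable]: "Measurable.pred (list_space M) ordered"
proof -
  have eq: "ordered xs \<longleftrightarrow> (\<forall>j<length xs. \<forall>i<j. compatible (hd (drop i xs)) (loc (hd (drop j xs))))" for xs :: "'a particle list"
    by (auto simp: sorted_wrt_iff_nth_less hd_drop_conv_nth)
  show ?thesis unfolding eq[abs_def] by measurable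
qed

lemma measurable_prune [measurable]: "prune \<in> list_space M \<rightarrow>\<^sub>M list_space M"
  unfolding prune_def[abs_def] by (rule M.measurable_dropWhile) (simp add: is_m_iff[abs_def])

section \<open>The product weight and its telescoping\<close>

abbreviation "r \<equiv> rho L \<mu>"

lemma rho_nonneg: "0 \<le> r n" and rho_Suc: "r (Suc n) = r n + \<mu>"
  using \<mu>_pos by (auto simp: rho_def algebra_simps)

lemma rho_pos: "0 < n \<Longrightarrow> 0 < r n"
  unfolding rho_def using \<mu>_pos by (intro add_nonneg_pos) auto

text \<open>The product of the reciprocal rates along a list that follows a prefix with q unmatched
  entries. Carrying q as an argument is what makes inductions from the front possible; q = 0 gives
  the product in \<open>fifm_weight\<close>.\<close>

primrec pw :: "nat \<Rightarrow> 'a particle list \<Rightarrow> real" where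
  "pw q [] = 1"
| "pw q (x # xs) = 1 / r (if is_u x then Suc q else q) * pw (if is_u x then Suc q else q) xs"

lemma pw_nonneg: "0 \<le> pw q xs"
  by (induction xs arbitrary: q) (simp_all add: rho_nonneg)

lemma pw_append: "pw q (xs @ ys) = pw q xs * pw (q + count_u xs) ys"
  by (induction xs arbitrary: q) simp_all

lemma Qu_Cons: "Qu (Suc i) (x # xs) = (if is_u x then Suc (Qu i xs) else Qu i xs)"
  by (simp add: Qu_def)

lemma prod_Qu: "(\<Prod>i=1..length xs. 1 / r (q + Qu i xs)) = pw q xs"
proof (induction xs arbitrary: q)
  case (Cons x xs)
  have "(\<Prod>i=1..length (x # xs). 1 / r (q + Qu i (x # xs))) =
      1 / r (q + Qu 1 (x # xs)) * (\<Prod>i=1..length xs. 1 / r (q + Qu (Suc i) (x # xs)))"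
    unfolding prod.atLeast1_atMost_eq length_Cons prod.lessThan_Suc_shift One_nat_def ..
  also have "\<dots> = pw q (x # xs)"
    using Cons[of q] Cons[of "Suc q"] by (simp add: Qu_Cons) (simp add: Qu_def)
  finally show ?case .
qed simp

lemma fifm_weight_eq: "fifm_weight L \<mu> xs = of_bool (valid xs) * pw 0 xs"
  using prod_Qu[of 0 xs] by (simp add: fifm_weight_def indicator_def)

lemma measurable_pw [measurable]: "pw q \<in> borel_measurable (list_space M)"
proof -
  have [measurable]: "(\<lambda>xs. pw q (take n xs)) \<in> borel_measurable (list_space M)" for n q
  proof (induction n arbitrary: q)
    case (Suc n)
    have [measurable]: "(\<lambda>xs. pw q (take n (tl xs))) \<in> borel_measurable (list_space M)" for q
      by (rule measurable_compose[OF M.measurable_tl Suc])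
    have eq: "(\<lambda>xs. pw q (take (Suc n) xs)) = (\<lambda>xs. if length xs = 0 then 1 else
        if is_u (hd xs) then 1 / r (Suc q) * pw (Suc q) (take n (tl xs)) else 1 / r q * pw q (take n (tl xs)))"
      by (rule ext) (simp add: take_Suc)
    show ?case unfolding eq by measurable
  qed simp
  have "(\<lambda>xs. pw q (take (length xs) xs)) \<in> borel_measurable (list_space M)"
    by (rule measurable_compose_countable[where f="\<lambda>n xs. pw q (take n xs)" and g=length]) measurable
  then show ?thesis by simp
qed

lemma measurable_count_u [measurable]: "count_u \<in> list_space M \<rightarrow>\<^sub>M count_space UNIV"
proof -
  have [measurable]: "(\<lambda>xs. count_u (take n xs)) \<in> list_space M \<rightarrow>\<^sub>M count_space UNIV" for n
  proof (induction n)
    case (Suc n)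
    have [measurable]: "(\<lambda>xs. count_u (take n (tl xs))) \<in> list_space M \<rightarrow>\<^sub>M count_space UNIV"
      by (rule measurable_compose[OF M.measurable_tl Suc])
    have eq: "(\<lambda>xs. count_u (take (Suc n) xs)) = (\<lambda>xs. if length xs = 0 then 0 else
        if is_u (hd xs) then Suc (count_u (take n (tl xs))) else count_u (take n (tl xs)))"
      by (rule ext) (simp add: take_Suc)
    show ?case unfolding eq by measurable
  qed simp
  have "(\<lambda>xs. count_u (take (length xs) xs)) \<in> list_space M \<rightarrow>\<^sub>M count_space UNIV"
    by (rule measurable_compose_countable[where f="\<lambda>n xs. count_u (take n xs)" and g=length]) measurable
  then show ?thesis by simp
qed

abbreviation "unblocked b xs \<equiv> (\<forall>y\<in>set xs. \<not> is_u y \<longrightarrow> compatible (as_u b) (loc y))"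

text \<open>Moving the newcomer \<open>b\<close> through the list from back to front, the weight telescopes: a step over an entry
  changes the weight by \<open>\<mu>\<close> times the weight of the list with \<open>b\<close> inserted right behind the entry, plus, at a
  matched entry that \<open>b\<close> could have been matched to, the weight of the list with that entry replaced by \<open>b\<close>.\<close>

lemma pw_telescope:
  assumes "0 < q \<or> head_ok v"
  shows "pw q v = of_bool (unblocked b v) * pw (Suc q) v +
    (\<Sum>i<length v. \<mu> * (of_bool (unblocked b (drop (Suc i) v)) * pw q (take (Suc i) v @ as_u b # drop (Suc i) v)) +
       of_bool (\<not> is_u (v ! i) \<and> \<not> compatible (as_u b) (loc (v ! i)) \<and> unblocked b (drop (Suc i) v)) *
         pw q (take i v @ as_u b # drop (Suc i) v))"
  using assms
proof (induction v arbitrary: q)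
  case (Cons x v)
  define p where "p = (if is_u x then Suc q else q)"
  \<comment> \<open>After the first entry at least one unmatched entry has been counted, so
    \<open>r p\<close> is positive even if \<open>L\<close> has mass 0.\<close>
  have p: "0 < p" using Cons.prems by (auto simp: p_def head_ok_def)
  define T where "T q v i = \<mu> * (of_bool (unblocked b (drop (Suc i) v)) * pw q (take (Suc i) v @ as_u b # drop (Suc i) v)) +
       of_bool (\<not> is_u (v ! i) \<and> \<not> compatible (as_u b) (loc (v ! i)) \<and> unblocked b (drop (Suc i) v)) *
         pw q (take i v @ as_u b # drop (Suc i) v)" for q v i
  define C where "C = of_bool (unblocked b v) * pw (Suc p) v"
  have IH: "pw p v = C + (\<Sum>i<length v. T p v i)"
    using Cons.IH[of p] p by (simp add: T_def C_def)
  have T_Suc: "T q (x # v) (Suc i) = 1 / r p * T p v i" for i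
    by (simp add: T_def p_def algebra_simps)
  have T_0: "T q (x # v) 0 = \<mu> / (r p * r (Suc p)) * C + of_bool (\<not> is_u x \<and> \<not> compatible (as_u b) (loc x)) / r (Suc p) * C"
    by (simp add: T_def p_def C_def)
  have rp: "0 < r p" "r (Suc p) = r p + \<mu>" using p by (simp_all add: rho_pos rho_Suc)
  have "of_bool (unblocked b (x # v)) * pw (Suc q) (x # v) + (\<Sum>i<length (x # v). T q (x # v) i) =
      of_bool (is_u x \<or> compatible (as_u b) (loc x)) / r (Suc p) * C + T q (x # v) 0 + 1 / r p * (\<Sum>i<length v. T p v i)"
    unfolding length_Cons sum.lessThan_Suc_shift
    by (simp add: T_Suc sum_distrib_left C_def p_def)
  \<comment> \<open>If \<open>x\<close> is a matched entry that conflicts with \<open>b\<close>, the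
    unblocked term vanishes and the exchange term in \<open>T_0\<close> supplies the same amount. So
    the coefficient of \<open>C\<close> is the same in all cases, and it equals
    \<open>1 / r p\<close> because \<open>r\<close> grows by \<mu> per unmatched entry.\<close>
  also have "\<dots> = (1 / r (Suc p) + \<mu> / (r p * r (Suc p))) * C + 1 / r p * (\<Sum>i<length v. T p v i)"
    by (auto simp: T_0 algebra_simps)
  also have "1 / r (Suc p) + \<mu> / (r p * r (Suc p)) = 1 / r p"
    using rp \<mu>_pos by (simp add: divide_simps)
  also have "1 / r p * C + 1 / r p * (\<Sum>i<length v. T p v i) = pw q (x # v)"
    using IH by (simp add: p_def algebra_simps)
  finally show ?case by (simp add: T_def)
qed simp

abbreviation "W xs \<equiv> of_bool (ordered xs) * pw 0 xs"

text \<open>For nonempty \<open>v\<close> the left side is the outflow from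
  \<open>v @ [as_m b]\<close>, and the sum on the right is the inflow from lists with
  \<open>b\<close> inserted behind an entry or replacing one. Insertion at the very front appears
  with the factor \<open>r 1\<close> where the inflow has \<mu>; this mismatch is the deficit that
  the pruned runs must cover.\<close>

lemma weight_telescope:
  assumes "head_ok v"
  shows "of_bool (ordered v \<and> (\<forall>x\<in>set v. compatible x b)) * pw 0 v = r 1 * W (as_u b # v) +
    (\<Sum>i<length v. \<mu> * W (take (Suc i) v @ as_u b # drop (Suc i) v) +
       of_bool (\<not> is_u (v ! i) \<and> \<not> compatible (as_u b) (loc (v ! i)) \<and> (\<forall>x\<in>set (take i v). compatible x (loc (v ! i)))) *
         W (take i v @ as_u b # drop (Suc i) v))"
proof -
  define e where "e \<longleftrightarrow> ordered v \<and> (\<forall>x\<in>set v. compatible x b)"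
  have 1: "ordered (take (Suc i) v @ as_u b # drop (Suc i) v) \<longleftrightarrow> e \<and> unblocked b (drop (Suc i) v)" for i
    unfolding ordered_insert_as_u append_take_drop_id e_def by blast
  have 2: "ordered (take i v @ as_u b # drop (Suc i) v) \<and> (\<forall>x\<in>set (take i v). compatible x (loc (v ! i))) \<longleftrightarrow>
      e \<and> unblocked b (drop (Suc i) v)" if "i < length v" "\<not> is_u (v ! i)" for i
    unfolding ordered_replace_as_m[OF that(2)] id_take_nth_drop[OF that(1), symmetric] e_def by blast
  have 3: "ordered (as_u b # v) \<longleftrightarrow> e \<and> unblocked b v"
    using ordered_insert_as_u[of "[]" b v] by (auto simp: e_def)
  have 4: "r 1 * pw 0 (as_u b # v) = pw (Suc 0) v" using rho_pos[of 1] by simp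
  have "of_bool e * pw 0 v = of_bool e * (of_bool (unblocked b v) * pw (Suc 0) v) +
    (\<Sum>i<length v. of_bool e * (\<mu> * (of_bool (unblocked b (drop (Suc i) v)) * pw 0 (take (Suc i) v @ as_u b # drop (Suc i) v)) +
       of_bool (\<not> is_u (v ! i) \<and> \<not> compatible (as_u b) (loc (v ! i)) \<and> unblocked b (drop (Suc i) v)) *
         pw 0 (take i v @ as_u b # drop (Suc i) v)))"
    by (subst pw_telescope[OF disjI2[OF assms], where b=b]) (simp only: distrib_left sum_distrib_left)
  also have "\<dots> = r 1 * W (as_u b # v) +
    (\<Sum>i<length v. \<mu> * W (take (Suc i) v @ as_u b # drop (Suc i) v) +
       of_bool (\<not> is_u (v ! i) \<and> \<not> compatible (as_u b) (loc (v ! i)) \<and> (\<forall>x\<in>set (take i v). compatible x (loc (v ! i)))) *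
         W (take i v @ as_u b # drop (Suc i) v))"
  proof (intro arg_cong2[where f="(+)"] sum.cong refl)
    show "of_bool e * (of_bool (unblocked b v) * pw (Suc 0) v) = r 1 * W (as_u b # v)"
      unfolding 3 4[symmetric] by (simp add: of_bool_conj)
    fix i assume "i \<in> {..<length v}"
    then have i: "i < length v" by simp
    show "of_bool e * (\<mu> * (of_bool (unblocked b (drop (Suc i) v)) * pw 0 (take (Suc i) v @ as_u b # drop (Suc i) v)) +
       of_bool (\<not> is_u (v ! i) \<and> \<not> compatible (as_u b) (loc (v ! i)) \<and> unblocked b (drop (Suc i) v)) *
         pw 0 (take i v @ as_u b # drop (Suc i) v)) =
      \<mu> * W (take (Suc i) v @ as_u b # drop (Suc i) v) +
       of_bool (\<not> is_u (v ! i) \<and> \<not> compatible (as_u b) (loc (v ! i)) \<and> (\<forall>x\<in>set (take i v). compatible x (loc (v ! i)))) *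
         W (take i v @ as_u b # drop (Suc i) v)"
      unfolding 1 using 2[OF i] by (auto simp: distrib_left)
  qed
  finally show ?thesis by (simp only: e_def)
qed

section \<open>The rate kernel\<close>

abbreviation "S \<equiv> list_space M"
abbreviation "rates \<equiv> fifm_rates L \<mu>"

text \<open>The jumps caused by the single entry z of \<open>p @ z # s\<close>. Departure and
  exchange are written through this cut so that the splitting formulas of the list measure
  apply.\<close>

definition jump_flow :: "('a particle list \<Rightarrow> ennreal) \<Rightarrow> 'a particle list \<Rightarrow> 'a particle \<Rightarrow> 'a particle list \<Rightarrow> ennreal" where
  "jump_flow f p z s = of_bool (is_u z) * (ennreal \<mu> * f (prune (p @ s @ [as_m (loc z)])) +
     (\<integral>\<^sup>+ y. of_bool (\<not> compatible z y \<and> (\<forall>x\<in>set p. compatible x y)) * f (prune (p @ as_m y # s @ [as_m (loc z)])) \<partial>B))"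

text \<open>The set function of \<open>fifm_rates\<close> with a function in place of the indicator,
  available before that set function is known to be a measure; compatibility with countable sums
  then proves that it is one.\<close>

definition rate_int :: "('a particle list \<Rightarrow> ennreal) \<Rightarrow> 'a particle list \<Rightarrow> ennreal" where
  "rate_int f xs = (\<Sum>i<length xs. jump_flow f (take i xs) (xs ! i) (drop (Suc i) xs)) +
     (\<integral>\<^sup>+ y. of_bool (\<forall>x\<in>set xs. compatible x y) * f (xs @ [as_u y]) \<partial>B)"

lemma measurable_jump_flow [measurable (raw)]:
  assumes [measurable]: "f \<in> borel_measurable S" "p \<in> N \<rightarrow>\<^sub>M S" "z \<in> N \<rightarrow>\<^sub>M M" "s \<in> N \<rightarrow>\<^sub>M S"
  shows "(\<lambda>x. jump_flow f (p x) (z x) (s x)) \<in> borel_measurable N"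
  unfolding jump_flow_def by measurable

lemma measurable_rate_int [measurable]:
  assumes [measurable]: "f \<in> borel_measurable S"
  shows "rate_int f \<in> borel_measurable S"
proof -
  have eq: "rate_int f = (\<lambda>xs. (\<Sum>i<length xs. jump_flow f (take i xs) (hd (drop i xs)) (drop (Suc i) xs)) +
     (\<integral>\<^sup>+ y. of_bool (\<forall>x\<in>set xs. compatible x y) * f (xs @ [as_u y]) \<partial>B))"
    unfolding rate_int_def by (auto simp: fun_eq_iff hd_drop_conv_nth intro!: arg_cong2[where f="(+)"] sum.cong)
  show ?thesis unfolding eq by measurable
qed

lemma rate_int_suminf:
  assumes [measurable]: "\<And>n. f n \<in> borel_measurable S"
  shows "rate_int (\<lambda>xs. \<Sum>n. f n xs) xs = (\<Sum>n. rate_int (f n) xs)"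
proof -
  have "jump_flow (\<lambda>xs. \<Sum>n. f n xs) p z s = (\<Sum>n. jump_flow (f n) p z s)" for p z s
    by (simp add: jump_flow_def suminf_add nn_integral_suminf flip: ennreal_suminf_cmult)
  then show ?thesis
    by (simp add: rate_int_def suminf_add[symmetric] nn_integral_suminf suminf_sum flip: ennreal_suminf_cmult)
qed

lemma depart_eq: "depart xs i = prune (take i xs @ drop (Suc i) xs @ [as_m (loc (xs ! i))])"
  by (simp add: depart_def as_m_def loc_def)

lemma exchange_eq:
  "i < length xs \<Longrightarrow> exchange xs i y = prune (take i xs @ as_m y # drop (Suc i) xs @ [as_m (loc (xs ! i))])"
  by (simp add: exchange_def as_m_def loc_def upd_conv_take_nth_drop)

lemma arrive_eq: "arrive xs y = xs @ [as_u y]"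
  by (simp add: arrive_def as_u_def)

lemma match_region_eq:
  "i < length xs \<Longrightarrow> is_u (xs ! i) \<Longrightarrow>
    match_region xs i = {y. \<not> compatible (xs ! i) y \<and> (\<forall>x\<in>set (take i xs). compatible x y)}"
  unfolding match_region_def compatible_def all_set_conv_all_nth set_eq_iff by auto

lemma free_region_eq: "free_region xs = {y. \<forall>x\<in>set xs. compatible x y}"
  unfolding free_region_def compatible_def all_set_conv_all_nth set_eq_iff by auto

lemma rates_formula:
  "(\<Sum>i | i < length xs \<and> is_u (xs ! i).
      ennreal \<mu> * indicator A (depart xs i)
      + (\<integral>\<^sup>+ y \<in> match_region xs i. indicator A (exchange xs i y) \<partial>B))
   + (\<integral>\<^sup>+ y \<in> free_region xs. indicator A (arrive xs y) \<partial>B) = rate_int (indicator A) xs"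
proof -
  have "(\<Sum>i | i < length xs \<and> is_u (xs ! i).
      ennreal \<mu> * indicator A (depart xs i)
      + (\<integral>\<^sup>+ y \<in> match_region xs i. indicator A (exchange xs i y) \<partial>B)) =
    (\<Sum>i | i < length xs \<and> is_u (xs ! i). jump_flow (indicator A) (take i xs) (xs ! i) (drop (Suc i) xs))"
    by (intro sum.cong refl)
      (auto simp: jump_flow_def depart_eq exchange_eq match_region_eq indicator_def intro!: arg_cong2[where f="(+)"] nn_integral_cong)
  also have "\<dots> = (\<Sum>i<length xs. jump_flow (indicator A) (take i xs) (xs ! i) (drop (Suc i) xs))"
    by (intro sum.mono_neutral_left) (auto simp: jump_flow_def)
  finally show ?thesis
    unfolding rate_int_def
    by (auto simp: free_region_eq arrive_eq indicator_def intro!: arg_cong2[where f="(+)"] nn_integral_cong)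
qed

lemma sets_rates [measurable_cong, simp]: "sets (rates xs) = sets S"
  unfolding fifm_rates_def by (subst sets_measure_of[OF sets.space_closed]) (rule sets.sigma_sets_eq)

lemma emeasure_rates:
  assumes "A \<in> sets S"
  shows "emeasure (rates xs) A = rate_int (indicator A) xs"
proof (rule emeasure_measure_of[of "rates xs" "space S" "sets S" "\<lambda>A. rate_int (indicator A) xs"])
  show "rates xs = measure_of (space S) (sets S) (\<lambda>A. rate_int (indicator A) xs)"
    unfolding fifm_rates_def rates_formula ..
  show "countably_additive (sets (rates xs)) (\<lambda>A. rate_int (indicator A) xs)"
  proof (rule countably_additiveI)
    fix A :: "nat \<Rightarrow> 'a particle list set" assume A: "range A \<subseteq> sets (rates xs)" "disjoint_family A"
    then have "(\<Sum>n. rate_int (indicator (A n)) xs) = rate_int (\<lambda>xs. \<Sum>n. indicator (A n) xs) xs"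
      by (intro rate_int_suminf[symmetric]) auto
    then show "(\<Sum>n. rate_int (indicator (A n)) xs) = rate_int (indicator (\<Union>n. A n)) xs"
      by (simp add: suminf_indicator[OF A(2)])
  qed
qed (use assms sets.space_closed[of S] in \<open>auto simp: positive_def rate_int_def jump_flow_def\<close>)

lemma emeasure_B_space: "emeasure B UNIV = ennreal a"
proof -
  have "emeasure B (UNIV \<times> UNIV) = emeasure L UNIV * emeasure (count_space (UNIV :: color set)) UNIV"
    unfolding colored_def using space_L
    by (intro sigma_finite_measure.emeasure_pair_measure_Times)
      (auto simp: finite_C[THEN finite_measure.sigma_finite_measure] sets_L)
  also have "emeasure (count_space (UNIV :: color set)) UNIV = 2"
    by (simp add: UNIV_color)
  finally show ?thesis
    by (simp add: L.emeasure_eq_measure space_L ennreal_mult'' mult.commute)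
qed

text \<open>Every potential arrival is claimed by the first unmatched entry that can be matched with
  it, or by none, so the regions partition the coloured space. This makes the total arrival and
  exchange rate independent of the list.\<close>

lemma region_sum:
  "(\<Sum>i<length xs. emeasure B {y. \<not> compatible (xs ! i) y \<and> (\<forall>x\<in>set (take i xs). compatible x y)}) +
    emeasure B {y. \<forall>x\<in>set xs. compatible x y} = ennreal a"
proof (induction xs rule: rev_induct)
  case (snoc x xs)
  let ?F = "{y. \<forall>x\<in>set xs. compatible x y}"
  have meas: "{y \<in> space B. \<forall>x\<in>set xs. compatible x y} \<in> sets B" "{y \<in> space B. compatible x y} \<in> sets B"
    by measurable
  have "(\<Sum>i<length (xs @ [x]). emeasure B {y. \<not> compatible ((xs @ [x]) ! i) y \<and> (\<forall>x\<in>set (take i (xs @ [x])). compatible x y)})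
    = (\<Sum>i<length xs. emeasure B {y. \<not> compatible (xs ! i) y \<and> (\<forall>x\<in>set (take i xs). compatible x y)}) +
      emeasure B (?F - {y. compatible x y})"
    by (auto simp: nth_append intro!: arg_cong2[where f="(+)"] sum.cong arg_cong[where f="emeasure B"])
  moreover have "{y. \<forall>x\<in>set (xs @ [x]). compatible x y} = ?F \<inter> {y. compatible x y}" by auto
  moreover have "emeasure B (?F - {y. compatible x y}) + emeasure B (?F \<inter> {y. compatible x y}) = emeasure B ?F"
    using meas
    by (subst plus_emeasure) (auto intro!: arg_cong[where f="emeasure B"])
  ultimately show ?case using snoc by (simp add: add.assoc)
qed (simp add: emeasure_B_space)

lemma rate_int_const: "rate_int (\<lambda>_. 1) xs = ennreal (r (count_u xs))"
proof -
  have meas: "{y. \<forall>x\<in>set xs. compatible x y} \<in> sets B" "{y. \<not> compatible x y \<and> (\<forall>x\<in>set xs. compatible x y)} \<in> sets B" for x xs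
  proof -
    have "{y \<in> space B. \<forall>x\<in>set xs. compatible x y} \<in> sets B" by measurable
    then show "{y. \<forall>x\<in>set xs. compatible x y} \<in> sets B" by simp
    have "{y \<in> space B. \<not> compatible x y \<and> (\<forall>x\<in>set xs. compatible x y)} \<in> sets B" by measurable
    then show "{y. \<not> compatible x y \<and> (\<forall>x\<in>set xs. compatible x y)} \<in> sets B" by simp
  qed
  have ind: "(\<integral>\<^sup>+ y. of_bool (P y) \<partial>B) = emeasure B {y. P y}" if "{y. P y} \<in> sets B" for P
    using nn_integral_indicator[OF that] by (simp add: indicator_def)
  have "(\<Sum>i<length xs. jump_flow (\<lambda>_. 1) (take i xs) (xs ! i) (drop (Suc i) xs)) =
     (\<Sum>i<length xs. ennreal \<mu> * of_bool (is_u (xs ! i))) +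
     (\<Sum>i<length xs. emeasure B {y. \<not> compatible (xs ! i) y \<and> (\<forall>x\<in>set (take i xs). compatible x y)})"
    unfolding sum.distrib[symmetric]
  proof (rule sum.cong[OF refl])
    fix i
    show "jump_flow (\<lambda>_. 1) (take i xs) (xs ! i) (drop (Suc i) xs) = ennreal \<mu> * of_bool (is_u (xs ! i)) +
       emeasure B {y. \<not> compatible (xs ! i) y \<and> (\<forall>x\<in>set (take i xs). compatible x y)}"
      by (cases "is_u (xs ! i)") (auto simp: jump_flow_def ind meas)
  qed
  also have "(\<Sum>i<length xs. ennreal \<mu> * of_bool (is_u (xs ! i))) = ennreal (real (count_u xs) * \<mu>)"
  proof (induction xs)
    case (Cons x xs)
    then show ?case using \<mu>_pos
      unfolding length_Cons sum.lessThan_Suc_shift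
      by (auto simp: algebra_simps ennreal_plus[symmetric] simp del: ennreal_plus)
  qed simp
  finally have "rate_int (\<lambda>_. 1) xs = ennreal (real (count_u xs) * \<mu>) + ennreal a"
    by (simp add: rate_int_def ind meas add.assoc region_sum)
  then show ?thesis using \<mu>_pos by (simp add: rho_def ennreal_plus[symmetric] add.commute del: ennreal_plus)
qed

lemma total_rate_rates: "total_rate rates xs = r (count_u xs)"
proof -
  have "emeasure (rates xs) (space (rates xs)) = rate_int (\<lambda>_. 1) xs"
    using emeasure_rates[OF sets.top, of xs] sets_eq_imp_space_eq[OF sets_rates, of xs] by simp
  then show ?thesis by (simp add: total_rate_def measure_def rate_int_const rho_nonneg)
qed

sublocale J: jump_kernel S rates
proof (rule jump_kernel.intro)
  show "finite_measure (rates x)" for x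
    using emeasure_rates[OF sets.top, of x] sets_eq_imp_space_eq[OF sets_rates, of x]
    by (intro finite_measureI) (simp add: rate_int_const)
  show "(\<lambda>x. emeasure (rates x) A) \<in> borel_measurable S" if "A \<in> sets S" for A
    using that by (simp add: emeasure_rates)
qed simp

lemma AE_rates_count_u: "AE ys in rates xs. count_u ys \<le> Suc (count_u xs)"
proof (rule AE_I')
  let ?N = "{ys. \<not> count_u ys \<le> Suc (count_u xs)}"
  have "{ys \<in> space S. \<not> count_u ys \<le> Suc (count_u xs)} \<in> sets S" by measurable
  then have N: "?N \<in> sets S" by simp
  have "count_u (take i xs) + count_u (drop (Suc i) xs) \<le> count_u xs" for i
  proof -
    have "count_u (tl ys) \<le> count_u ys" for ys :: "'a particle list" by (cases ys) auto
    then have "count_u (drop (Suc i) xs) \<le> count_u (drop i xs)" by (simp add: drop_Suc flip: tl_drop)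
    moreover have "count_u (take i xs) + count_u (drop i xs) = count_u xs"
      by (simp flip: count_u_simps(3))
    ultimately show ?thesis by linarith
  qed
  then have *: "count_u (take i xs) + count_u (drop (Suc i) xs) \<le> Suc (count_u xs)" for i
    using le_SucI by blast
  have "emeasure (rates xs) ?N = 0"
    unfolding emeasure_rates[OF N] rate_int_def jump_flow_def using * by (auto simp: indicator_def)
  then show "?N \<in> null_sets (rates xs)" using N by (simp add: null_sets_def)
qed auto

lemma transition_prob_honest: "0 \<le> t \<Longrightarrow> transition_prob rates t xs (space S) = 1"
  by (rule J.transition_prob_space_eq_1[of a \<mu> count_u])
    (use \<mu>_pos in \<open>auto simp: total_rate_rates rho_def AE_rates_count_u mult.commute\<close>)

lemma singleton_in_sets: "{xs} \<in> sets S"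
proof -
  have "{z} \<in> sets M" for z :: "'a particle"
  proof -
    have "{fst z} \<times> {fst (snd z)} \<times> {snd (snd z)} \<in> sets (L \<Otimes>\<^sub>M (count_space UNIV \<Otimes>\<^sub>M count_space UNIV))"
      by (intro pair_measureI) (auto simp: sets_L)
    then show ?thesis by (cases z) (simp add: marked_def)
  qed
  then have "listset (map (\<lambda>z. {z}) xs) \<in> sets S" by (intro M.listset_in_sets) auto
  also have "listset (map (\<lambda>z. {z}) xs) = {xs}"
    by (induction xs) (auto simp: set_Cons_def)
  finally show ?thesis .
qed

text \<open>The empty list is reached by letting the head depart repeatedly.\<close>

lemma jump_int_Nil_pos:
  assumes "head_ok xs" "0 < t"
  shows "0 < J.jump_int (count_u xs) (indicator {[]}) t xs"
  using assms
proof (induction "count_u xs" arbitrary: xs t)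
  case 0
  then have "xs = []" by (cases xs) (auto simp: head_ok_def)
  then show ?case using 0 by simp
next
  case (Suc n)
  note [measurable] = singleton_in_sets
  obtain x xs' where xs: "xs = x # xs'" using Suc by (cases xs) auto
  then have x: "is_u x" using Suc.prems by (simp add: head_ok_def)
  \<comment> \<open>The result of the departure of the head: one unmatched entry fewer, and again no
    matched entry in front. Departures have discrete targets, so the rate kernel has an atom of mass
    at least \<mu> here.\<close>
  define d where "d = prune (xs' @ [as_m (loc x)])"
  have d: "count_u d = n" "head_ok d" using Suc.hyps(2) by (auto simp: d_def xs x)
  have "ennreal \<mu> \<le> emeasure (rates xs) {d}"
    unfolding emeasure_rates[OF singleton_in_sets] rate_int_def xs length_Cons sum.lessThan_Suc_shift
    by (simp add: jump_flow_def x d_def add.assoc)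
  have lower: "0 < (\<integral>\<^sup>+ y. J.jump_int n (indicator {[]}) s y \<partial>rates xs)" if "0 < s" for s
  proof -
    have "0 < J.jump_int n (indicator {[]}) s d * emeasure (rates xs) {d}"
      using Suc.hyps(1)[of d s] d that \<mu>_pos \<open>ennreal \<mu> \<le> emeasure (rates xs) {d}\<close>
      by (auto simp: ennreal_zero_less_mult_iff intro: less_le_trans[of 0 "ennreal \<mu>"])
    also have "\<dots> = (\<integral>\<^sup>+ y. J.jump_int n (indicator {[]}) s d * indicator {d} y \<partial>rates xs)"
      by (rule nn_integral_cmult_indicator[symmetric]) (simp add: singleton_in_sets)
    also have "\<dots> \<le> (\<integral>\<^sup>+ y. J.jump_int n (indicator {[]}) s y \<partial>rates xs)"
      by (intro nn_integral_mono) (auto simp: indicator_def)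
    finally show ?thesis .
  qed
  let ?g = "\<lambda>s. ennreal (exp (- total_rate rates xs * s)) * (\<integral>\<^sup>+ y. J.jump_int n (indicator {[]}) (t - s) y \<partial>rates xs) * indicator {0..t} s"
  have meas: "?g \<in> borel_measurable lborel" by measurable
  have "(\<integral>\<^sup>+ s. ?g s \<partial>lborel) \<noteq> 0"
  proof
    assume "(\<integral>\<^sup>+ s. ?g s \<partial>lborel) = 0"
    then have "AE s in lborel. ?g s = 0" using meas by (simp add: nn_integral_0_iff_AE)
    \<comment> \<open>For s strictly between 0 and t there is time left after the first jump, so the
      integrand is nonzero on an interval of positive length.\<close>
    moreover have "?g s \<noteq> 0" if "s \<in> {0<..<t}" for s
      using lower[of "t - s"] that by auto
    ultimately have "AE s in lborel. s \<notin> {0<..<t}" by (auto elim!: eventually_mono)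
    then have "emeasure lborel {0<..<t} = 0" by (subst (asm) AE_iff_null_sets[symmetric]) auto
    then show False using Suc.prems by simp
  qed
  then show ?case unfolding Suc.hyps(2)[symmetric] by (simp add: zero_less_iff_neq_zero)
qed

lemma transition_prob_Nil_pos:
  assumes "head_ok xs" "0 < t"
  shows "0 < transition_prob rates t xs {[]}"
proof -
  have "J.jump_int (count_u xs) (indicator {[]}) t xs \<le> transition_prob rates t xs {[]}"
    unfolding transition_prob_def J.jump_prob_eq_jump_int
    using sum_le_suminf[of "\<lambda>n. J.jump_int n (indicator {[]}) t xs" "{count_u xs}"] by simp
  with jump_int_Nil_pos[OF assms] show ?thesis by (rule less_le_trans)
qed

section \<open>The balance equation for the product weight\<close>

abbreviation "\<Lambda> \<equiv> list_measure M"

lemma nn_integral_B: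
  assumes [measurable]: "h \<in> borel_measurable B"
  shows "(\<integral>\<^sup>+ y. h y \<partial>B) = (\<integral>\<^sup>+ p. h (p, Red) + h (p, Blue) \<partial>L)"
proof -
  interpret C: finite_measure "count_space (UNIV :: color set)" by (rule finite_C)
  have "(\<integral>\<^sup>+ y. h y \<partial>B) = (\<integral>\<^sup>+ p. (\<integral>\<^sup>+ c. h (p, c) \<partial>count_space UNIV) \<partial>L)"
    unfolding colored_def by (rule C.nn_integral_fst[symmetric]) (use assms in \<open>simp add: colored_def\<close>)
  also have "\<dots> = (\<integral>\<^sup>+ p. h (p, Red) + h (p, Blue) \<partial>L)"
    by (simp add: nn_integral_count_space_finite UNIV_color)
  finally show ?thesis .
qed

lemma nn_integral_M:
  assumes [measurable]: "g \<in> borel_measurable M"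
  shows "(\<integral>\<^sup>+ z. g z \<partial>M) = (\<integral>\<^sup>+ y. g (as_u y) + g (as_m y) \<partial>B)"
proof -
  let ?C = "count_space (UNIV :: color set) \<Otimes>\<^sub>M count_space (UNIV :: mark set)"
  interpret C: finite_measure ?C
    by (intro finite_measure_pair_measure finite_C finite_U)
  have C: "?C = count_space (UNIV \<times> UNIV)"
    by (intro pair_measure_countable) (simp_all add: UNIV_color UNIV_mark)
  have "(\<integral>\<^sup>+ z. g z \<partial>M) = (\<integral>\<^sup>+ p. (\<integral>\<^sup>+ c. g (p, c) \<partial>?C) \<partial>L)"
    unfolding marked_def by (rule C.nn_integral_fst[symmetric]) (use assms in \<open>simp add: marked_def\<close>)
  also have "\<dots> = (\<integral>\<^sup>+ p. (g (as_u (p, Red)) + g (as_m (p, Red))) + (g (as_u (p, Blue)) + g (as_m (p, Blue))) \<partial>L)"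
    unfolding C by (simp add: nn_integral_count_space_finite UNIV_color UNIV_mark insert_Times_insert as_u_def as_m_def add.assoc)
  also have "\<dots> = (\<integral>\<^sup>+ y. g (as_u y) + g (as_m y) \<partial>B)"
    by (subst nn_integral_B) simp_all
  finally show ?thesis .
qed

sublocale BL: pair_sigma_finite B \<Lambda>
  by (simp add: pair_sigma_finite_def B.sigma_finite_measure_axioms M.sigma_finite_list_measure)

definition wt :: "'a particle list \<Rightarrow> ennreal" where
  "wt xs = ennreal (fifm_weight L \<mu> xs)"

lemma wt_eq: "wt xs = of_bool (head_ok xs) * ennreal (W xs)"
  by (simp add: wt_def fifm_weight_eq valid_iff)

lemma measurable_wt [measurable]: "wt \<in> borel_measurable S"
  unfolding wt_eq[abs_def] by measurable

lemma wt_Nil [simp]: "wt [] = 1"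
  by (simp add: wt_eq head_ok_def)

lemma head_ok_snoc_as_u: "head_ok (v @ [as_u b]) \<longleftrightarrow> head_ok v"
  and head_ok_snoc_as_m: "head_ok (v @ [as_m b]) \<longleftrightarrow> v \<noteq> [] \<and> head_ok v"
  and head_ok_Cons: "head_ok (x # v) \<longleftrightarrow> is_u x"
  by (cases v; simp add: head_ok_def)+

text \<open>The last factor of the weight is the reciprocal of the exit rate and cancels it. What
  remains is the weight of \<open>v\<close> restricted to arrivals \<open>b\<close> in its free
  region, so outflow equals inflow by arrivals.\<close>

lemma wt_snoc_as_u:
  "wt (v @ [as_u b]) * ennreal (r (count_u (v @ [as_u b]))) = wt v * of_bool (\<forall>x\<in>set v. compatible x b)"
proof -
  have "pw 0 (v @ [as_u b]) * r (count_u (v @ [as_u b])) = pw 0 v"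
    using rho_pos[of "Suc (count_u v)"] by (simp add: pw_append)
  moreover have "ordered (v @ [as_u b]) \<longleftrightarrow> ordered v \<and> (\<forall>x\<in>set v. compatible x b)"
    by (simp add: ordered_append)
  ultimately show ?thesis
    by (simp add: wt_eq head_ok_snoc_as_u pw_nonneg rho_nonneg flip: ennreal_mult)
qed

text \<open>The same cancellation for a matched last entry. The case \<open>v = []\<close> drops out
  because a single matched entry is not valid.\<close>

lemma wt_snoc_as_m:
  "wt (v @ [as_m b]) * ennreal (r (count_u (v @ [as_m b]))) =
    of_bool (v \<noteq> []) * (wt v * of_bool (\<forall>x\<in>set v. compatible x b))"
proof (cases "v \<noteq> [] \<and> head_ok v")
  case True
  then have "0 < count_u v" by (cases v) (auto simp: head_ok_def)
  then have "pw 0 (v @ [as_m b]) * r (count_u (v @ [as_m b])) = pw 0 v"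
    using rho_pos[of "count_u v"] by (simp add: pw_append)
  moreover have "ordered (v @ [as_m b]) \<longleftrightarrow> ordered v \<and> (\<forall>x\<in>set v. compatible x b)"
    by (simp add: ordered_append)
  ultimately show ?thesis using True
    by (simp add: wt_eq head_ok_snoc_as_m pw_nonneg rho_nonneg flip: ennreal_mult)
qed (auto simp: wt_eq head_ok_snoc_as_m)

text \<open>Behind a leading \<open>b\<close> a matched entry has to respect \<open>b\<close> only
  and contributes one factor \<open>1 / r 1\<close>. This is the ratio of the geometric recursion
  along a run of matched entries.\<close>

lemma wt_as_u_as_m:
  "wt (as_u b # as_m y # s) = of_bool (compatible (as_u b) y) * (ennreal (1 / r 1) * wt (as_u b # s))"
proof -
  have "pw 0 (as_u b # as_m y # s) = 1 / r 1 * pw 0 (as_u b # s)" by simp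
  moreover have "ordered (as_u b # as_m y # s) \<longleftrightarrow> compatible (as_u b) y \<and> ordered (as_u b # s)"
    by (simp add: conj_assoc)
  ultimately show ?thesis
    by (simp add: wt_eq head_ok_Cons pw_nonneg rho_nonneg flip: ennreal_mult del: sorted_wrt.simps pw.simps)
qed

text \<open>Splits off a matched first entry; the runs removed by pruning are treated through this,
  one entry at a time.\<close>

lemma nn_integral_head_ok:
  assumes [measurable]: "h \<in> borel_measurable S"
  shows "(\<integral>\<^sup>+ v. h v \<partial>\<Lambda>) = (\<integral>\<^sup>+ v. of_bool (head_ok v) * h v \<partial>\<Lambda>) + (\<integral>\<^sup>+ y. (\<integral>\<^sup>+ s. h (as_m y # s) \<partial>\<Lambda>) \<partial>B)"
proof -
  have "(\<integral>\<^sup>+ v. h v \<partial>\<Lambda>) = h [] + ((\<integral>\<^sup>+ y. (\<integral>\<^sup>+ s. h (as_u y # s) \<partial>\<Lambda>) \<partial>B) + (\<integral>\<^sup>+ y. (\<integral>\<^sup>+ s. h (as_m y # s) \<partial>\<Lambda>) \<partial>B))"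
    by (subst M.nn_integral_list_measure_Cons) (simp_all add: nn_integral_M nn_integral_add)
  moreover have "(\<integral>\<^sup>+ v. of_bool (head_ok v) * h v \<partial>\<Lambda>) = h [] + (\<integral>\<^sup>+ y. (\<integral>\<^sup>+ s. h (as_u y # s) \<partial>\<Lambda>) \<partial>B)"
    by (subst M.nn_integral_list_measure_Cons) (simp_all add: nn_integral_M head_ok_Cons, simp add: head_ok_def)
  ultimately show ?thesis by (simp add: add.assoc)
qed

lemma nn_integral_not_Nil:
  assumes [measurable]: "h \<in> borel_measurable S"
  shows "(\<integral>\<^sup>+ v. h v \<partial>\<Lambda>) = h [] + (\<integral>\<^sup>+ v. of_bool (v \<noteq> []) * h v \<partial>\<Lambda>)"
proof -
  have "(\<lambda>v. of_bool (v \<notin> {[]}) * h v) \<in> borel_measurable S" by measurable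
  then show ?thesis
    by (simp add: M.nn_integral_list_measure_Cons[of h] M.nn_integral_list_measure_Cons[of "\<lambda>v. of_bool (v \<noteq> []) * h v"])
qed

text \<open>The weighted inflow, through departures and exchanges of an unmatched \<open>b\<close>,
  into \<open>v @ [as_m b]\<close> before pruning. In the first sum \<open>b\<close> stood between
  entries of \<open>v\<close>, in the second it stood in place of a matched entry to which it was
  matched.\<close>

definition gain :: "'a \<times> color \<Rightarrow> 'a particle list \<Rightarrow> ennreal" where
  "gain b v = (\<Sum>i\<le>length v. ennreal \<mu> * wt (take i v @ as_u b # drop i v)) +
    (\<Sum>i<length v. of_bool (\<not> is_u (v ! i) \<and> \<not> compatible (as_u b) (loc (v ! i)) \<and>
        (\<forall>x\<in>set (take i v). compatible x (loc (v ! i)))) * wt (take i v @ as_u b # drop (Suc i) v))"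

text \<open>An additive form of the statement that the gain misses the required value by
  \<open>r 1 - \<mu> = a\<close> times the weight of \<open>as_u b # v\<close>; subtraction is
  avoided because the values are in \<open>ennreal\<close>.\<close>

lemma gain_head_ok:
  assumes "head_ok v"
  shows "gain b v + ennreal (r 1) * wt (as_u b # v) =
    wt v * of_bool (\<forall>x\<in>set v. compatible x b) + ennreal \<mu> * wt (as_u b # v)"
proof -
  define f where "f i = \<mu> * W (take (Suc i) v @ as_u b # drop (Suc i) v)" for i
  define P where "P i \<longleftrightarrow> \<not> is_u (v ! i) \<and> \<not> compatible (as_u b) (loc (v ! i)) \<and>
        (\<forall>x\<in>set (take i v). compatible x (loc (v ! i)))" for i
  define g where "g i = of_bool (P i) * W (take i v @ as_u b # drop (Suc i) v)" for i
  have nn: "0 \<le> W xs" for xs by (simp add: pw_nonneg)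
  have fg: "0 \<le> f i" "0 \<le> g i" for i
    unfolding f_def g_def using nn \<mu>_pos by (auto intro!: mult_nonneg_nonneg)
  have wt_W: "wt xs = ennreal (W xs)" if "head_ok xs" for xs using that by (simp add: wt_eq)
  have F: "ennreal \<mu> * wt (take (Suc i) v @ as_u b # drop (Suc i) v) = ennreal (f i)" if "i < length v" for i
  proof -
    have "head_ok (take (Suc i) v @ as_u b # drop (Suc i) v)"
      using assms that by (cases v) (auto simp: head_ok_def)
    then show ?thesis using nn \<mu>_pos unfolding f_def by (subst wt_W) (simp_all add: ennreal_mult' del: of_bool_eq)
  qed
  have G: "of_bool (P i) * wt (take i v @ as_u b # drop (Suc i) v) = ennreal (g i)" if "i < length v" for i
  proof (cases "P i")
    case True
    then have "head_ok (take i v @ as_u b # drop (Suc i) v)"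
      using assms that by (cases v; cases i) (auto simp: head_ok_def P_def)
    then show ?thesis by (simp only: wt_W g_def True of_bool_eq mult_1_left)
  qed (simp add: g_def)
  have "gain b v = ennreal \<mu> * wt (as_u b # v) + (\<Sum>i<length v. ennreal (f i)) + (\<Sum>i<length v. ennreal (g i))"
    unfolding gain_def P_def[symmetric] sum.atMost_shift using F G by (intro arg_cong2[where f="(+)"] sum.cong) auto
  also have "\<dots> = ennreal \<mu> * wt (as_u b # v) + ennreal (\<Sum>i<length v. f i + g i)"
    using fg by (simp add: sum.distrib sum_nonneg add.assoc)
  finally have 1: "gain b v = ennreal \<mu> * wt (as_u b # v) + ennreal (\<Sum>i<length v. f i + g i)" .
  have "of_bool (ordered v \<and> (\<forall>x\<in>set v. compatible x b)) * pw 0 v = r 1 * W (as_u b # v) + (\<Sum>i<length v. f i + g i)"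
    using weight_telescope[OF assms, of b] by (simp only: f_def g_def P_def)
  moreover have "ennreal (of_bool (ordered v \<and> (\<forall>x\<in>set v. compatible x b)) * pw 0 v) = wt v * of_bool (\<forall>x\<in>set v. compatible x b)"
    using assms by (simp add: wt_eq)
  moreover have "ennreal (r 1 * W (as_u b # v) + (\<Sum>i<length v. f i + g i)) =
      ennreal (r 1) * wt (as_u b # v) + ennreal (\<Sum>i<length v. f i + g i)"
  proof -
    have "0 \<le> (\<Sum>i<length v. f i + g i)" using fg by (intro sum_nonneg add_nonneg_nonneg) auto
    moreover have "0 \<le> r 1 * W (as_u b # v)" by (rule mult_nonneg_nonneg[OF rho_nonneg nn])
    moreover have "wt (as_u b # v) = ennreal (W (as_u b # v))" by (rule wt_W) (simp add: head_ok_Cons)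
    ultimately show ?thesis by (simp only: ennreal_plus ennreal_mult[OF rho_nonneg nn])
  qed
  ultimately have e: "wt v * of_bool (\<forall>x\<in>set v. compatible x b) =
      ennreal (r 1) * wt (as_u b # v) + ennreal (\<Sum>i<length v. f i + g i)"
    by (simp only:)
  show ?thesis unfolding 1 e by (simp only: ac_simps)
qed

text \<open>Any source list that keeps \<open>y\<close> as its first entry is invalid. Only two
  sources remain: \<open>b\<close> inserted in front of \<open>y\<close>, and \<open>b\<close> in
  place of \<open>y\<close>.\<close>

lemma gain_as_m:
  "gain b (as_m y # s) = ennreal \<mu> * wt (as_u b # as_m y # s) + of_bool (\<not> compatible (as_u b) y) * wt (as_u b # s)"
proof -
  have z: "wt (as_m y # xs) = 0" for xs by (simp add: wt_eq head_ok_Cons)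
  show ?thesis
    unfolding gain_def length_Cons sum.atMost_Suc_shift sum.lessThan_Suc_shift by (simp add: z)
qed

lemma measurable_gain [measurable (raw)]:
  assumes [measurable]: "b \<in> N \<rightarrow>\<^sub>M B" "v \<in> N \<rightarrow>\<^sub>M S"
  shows "(\<lambda>x. gain (b x) (v x)) \<in> borel_measurable N"
proof -
  have eq: "gain b v = (\<Sum>i\<le>length v. ennreal \<mu> * wt (take i v @ as_u b # drop i v)) +
    (\<Sum>i<length v. of_bool (\<not> is_u (hd (drop i v)) \<and> \<not> compatible (as_u b) (loc (hd (drop i v))) \<and>
        (\<forall>x\<in>set (take i v). compatible x (loc (hd (drop i v))))) * wt (take i v @ as_u b # drop (Suc i) v))" for b v
    unfolding gain_def by (intro arg_cong2[where f="(+)"] sum.cong refl) (simp add: hd_drop_conv_nth)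
  show ?thesis unfolding eq by measurable
qed

text \<open>Pruning makes the test function blind to a matched first entry, so
  \<open>F = H + K\<close> with \<open>K\<close> equal to c / \<open>r 1\<close> times
  \<open>F\<close>, where c and n are the masses compatible and incompatible with \<open>b\<close>.
  The lists with a matched head bring in \<mu> \<open>K\<close> + n \<open>F\<close>, and with c + n
  = \<open>a\<close> this is \<open>a\<close> times \<open>H\<close>, the deficit of the other
  lists. Finiteness of \<open>F\<close> permits the cancellations.\<close>

lemma nn_integral_gain:
  assumes f [measurable]: "f \<in> borel_measurable S" and fin: "(\<integral>\<^sup>+ v. f (prune (v @ [as_m b])) * wt (as_u b # v) \<partial>\<Lambda>) \<noteq> \<infinity>"
  shows "(\<integral>\<^sup>+ v. f (prune (v @ [as_m b])) * gain b v \<partial>\<Lambda>) =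
    (\<integral>\<^sup>+ v. f (prune (v @ [as_m b])) * (wt v * of_bool (\<forall>x\<in>set v. compatible x b)) \<partial>\<Lambda>)"
proof -
  define g where "g v = f (prune (v @ [as_m b]))" for v
  have [measurable]: "g \<in> borel_measurable S" unfolding g_def by measurable
  have g_as_m: "g (as_m y # s) = g s" for y s by (simp add: g_def)
  define F where "F = (\<integral>\<^sup>+ v. g v * wt (as_u b # v) \<partial>\<Lambda>)"
  define H where "H = (\<integral>\<^sup>+ v. of_bool (head_ok v) * (g v * wt (as_u b # v)) \<partial>\<Lambda>)"
  define K where "K = (\<integral>\<^sup>+ y. (\<integral>\<^sup>+ s. g s * wt (as_u b # as_m y # s) \<partial>\<Lambda>) \<partial>B)"
  define X where "X = (\<integral>\<^sup>+ v. of_bool (head_ok v) * (g v * gain b v) \<partial>\<Lambda>)"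
  define Y where "Y = (\<integral>\<^sup>+ v. g v * (wt v * of_bool (\<forall>x\<in>set v. compatible x b)) \<partial>\<Lambda>)"
  define n where "n = emeasure B {y. \<not> compatible (as_u b) y}"
  define c where "c = emeasure B {y. compatible (as_u b) y}"
  have "{y \<in> space B. compatible (as_u b) y} \<in> sets B" "{y \<in> space B. \<not> compatible (as_u b) y} \<in> sets B" by measurable
  then have meas: "{y. compatible (as_u b) y} \<in> sets B" "{y. \<not> compatible (as_u b) y} \<in> sets B" by simp_all
  have nc: "n + c = ennreal a"
    unfolding n_def c_def emeasure_B_space[symmetric] using meas
    by (subst plus_emeasure) (auto intro!: arg_cong[where f="emeasure B"])
  have n: "(\<integral>\<^sup>+ y. of_bool (\<not> compatible (as_u b) y) \<partial>B) = n" and c: "(\<integral>\<^sup>+ y. of_bool (compatible (as_u b) y) \<partial>B) = c"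
    using nn_integral_indicator[OF meas(1)] nn_integral_indicator[OF meas(2)] by (simp_all add: n_def c_def indicator_def)
  have r1: "r 1 = \<mu> + a" "0 < r 1" using rho_pos[of 1] by (simp_all add: rho_def)
  have FHK: "F = H + K"
    unfolding F_def H_def K_def by (subst nn_integral_head_ok) (simp_all add: g_as_m)
  \<comment> \<open>The first matched entry integrates out to the factor c / \<open>r 1\<close>, and
    the rest of the list gives \<open>F\<close> again.\<close>
  have KF: "ennreal (r 1) * K = c * F"
  proof -
    have "K = (\<integral>\<^sup>+ y. of_bool (compatible (as_u b) y) * (ennreal (1 / r 1) * F) \<partial>B)"
      unfolding K_def F_def wt_as_u_as_m
      by (intro nn_integral_cong) (simp add: nn_integral_cmult[symmetric] mult.left_commute del: of_bool_eq_iff)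
    also have "\<dots> = ennreal (1 / r 1) * (c * F)"
      by (subst nn_integral_multc) (simp_all add: c ac_simps)
    finally show ?thesis
      using r1(2) by (simp add: mult.assoc[symmetric] flip: ennreal_mult)
  qed
  have E: "(\<integral>\<^sup>+ v. g v * gain b v \<partial>\<Lambda>) = X + (ennreal \<mu> * K + n * F)"
  proof -
    have "(\<integral>\<^sup>+ v. g v * gain b v \<partial>\<Lambda>) = X + (\<integral>\<^sup>+ y. (\<integral>\<^sup>+ s. g s * gain b (as_m y # s) \<partial>\<Lambda>) \<partial>B)"
      unfolding X_def by (subst nn_integral_head_ok) (simp_all add: g_as_m)
    also have "(\<integral>\<^sup>+ y. (\<integral>\<^sup>+ s. g s * gain b (as_m y # s) \<partial>\<Lambda>) \<partial>B) =
        (\<integral>\<^sup>+ y. ennreal \<mu> * (\<integral>\<^sup>+ s. g s * wt (as_u b # as_m y # s) \<partial>\<Lambda>) + of_bool (\<not> compatible (as_u b) y) * F \<partial>B)"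
    proof (rule nn_integral_cong)
      fix y
      have "(\<integral>\<^sup>+ s. g s * gain b (as_m y # s) \<partial>\<Lambda>) =
          (\<integral>\<^sup>+ s. ennreal \<mu> * (g s * wt (as_u b # as_m y # s)) + of_bool (\<not> compatible (as_u b) y) * (g s * wt (as_u b # s)) \<partial>\<Lambda>)"
        by (intro nn_integral_cong) (simp add: gain_as_m distrib_left mult.left_commute)
      also have "\<dots> = ennreal \<mu> * (\<integral>\<^sup>+ s. g s * wt (as_u b # as_m y # s) \<partial>\<Lambda>) + of_bool (\<not> compatible (as_u b) y) * F"
        unfolding F_def by (subst nn_integral_add) (simp_all add: nn_integral_cmult)
      finally show "(\<integral>\<^sup>+ s. g s * gain b (as_m y # s) \<partial>\<Lambda>) = \<dots>" .
    qed
    also have "\<dots> = ennreal \<mu> * K + n * F"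
      unfolding K_def by (subst nn_integral_add) (simp_all add: nn_integral_cmult nn_integral_multc n)
    finally show ?thesis .
  qed
  have XH: "X + ennreal (r 1) * H = Y + ennreal \<mu> * H"
  proof -
    have "X + ennreal (r 1) * H = (\<integral>\<^sup>+ v. of_bool (head_ok v) * (g v * (gain b v + ennreal (r 1) * wt (as_u b # v))) \<partial>\<Lambda>)"
      unfolding X_def H_def
      by (simp add: nn_integral_add nn_integral_cmult[symmetric] distrib_left mult.left_commute)
    also have "\<dots> = (\<integral>\<^sup>+ v. g v * (wt v * of_bool (\<forall>x\<in>set v. compatible x b)) +
        ennreal \<mu> * (of_bool (head_ok v) * (g v * wt (as_u b # v))) \<partial>\<Lambda>)"
    proof (rule nn_integral_cong)
      fix v
      show "of_bool (head_ok v) * (g v * (gain b v + ennreal (r 1) * wt (as_u b # v))) =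
        g v * (wt v * of_bool (\<forall>x\<in>set v. compatible x b)) + ennreal \<mu> * (of_bool (head_ok v) * (g v * wt (as_u b # v)))"
      proof (cases "head_ok v")
        case True
        show ?thesis
          by (simp only: gain_head_ok[OF True] True of_bool_eq mult_1_left) (simp only: distrib_left mult.left_commute)
      qed (simp add: wt_eq)
    qed
    also have "\<dots> = Y + ennreal \<mu> * H"
      unfolding Y_def H_def by (simp add: nn_integral_add nn_integral_cmult)
    finally show ?thesis .
  qed
  have F_fin: "F \<noteq> top" using fin by (simp add: F_def g_def)
  then have fin': "H \<noteq> top" "K \<noteq> top" by (auto simp: FHK)
  have "c \<noteq> top" using nc by auto
  then have c_fin: "c * F \<noteq> top"
    using F_fin by (simp add: ennreal_mult_eq_top_iff)
  have "c * F + ennreal (r 1) * H = ennreal (r 1) * F"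
    unfolding KF[symmetric] by (simp only: FHK distrib_left add.commute)
  also have "\<dots> = c * F + (ennreal \<mu> + n) * F"
    using \<mu>_pos unfolding r1(1) by (simp add: nc[symmetric] distrib_right distrib_left ac_simps)
  finally have rH: "ennreal (r 1) * H = (ennreal \<mu> + n) * F"
    using c_fin by (simp add: ennreal_add_left_cancel)
  have "ennreal (r 1) * H + (\<integral>\<^sup>+ v. g v * gain b v \<partial>\<Lambda>) = (X + ennreal (r 1) * H) + (ennreal \<mu> * K + n * F)"
    unfolding E by (simp add: ac_simps)
  also have "\<dots> = Y + (ennreal \<mu> + n) * F"
    unfolding XH by (simp add: FHK distrib_left distrib_right ac_simps)
  also have "\<dots> = ennreal (r 1) * H + Y"
    unfolding rH by (simp add: add.commute)
  finally have "(\<integral>\<^sup>+ v. g v * gain b v \<partial>\<Lambda>) = Y"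
    using fin'(1) by (simp add: ennreal_add_left_cancel ennreal_mult_eq_top_iff)
  then show ?thesis by (simp add: Y_def g_def)
qed

lemma measurable_eq_Nil [measurable]: "Measurable.pred S (\<lambda>v. v = [])"
proof -
  have "Measurable.pred S (\<lambda>v. v \<in> {[]})" by measurable
  then show ?thesis by simp
qed

text \<open>A change of variables from the source, cut at \<open>b\<close>, to the target before
  pruning: \<open>v = p @ s\<close> for a departure, and \<open>p\<close> followed by the partner
  and \<open>s\<close> for an exchange. The splitting formulas turn the integrals over the pieces
  into sums over the positions in \<open>v\<close>.\<close>

lemma nn_integral_flow:
  assumes f [measurable]: "f \<in> borel_measurable S"
  shows "(\<integral>\<^sup>+ p. (\<integral>\<^sup>+ s. wt (p @ as_u b # s) * jump_flow f p (as_u b) s \<partial>\<Lambda>) \<partial>\<Lambda>) =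
    (\<integral>\<^sup>+ v. f (prune (v @ [as_m b])) * gain b v \<partial>\<Lambda>)"
proof -
  define P where "P p z \<longleftrightarrow> \<not> is_u z \<and> \<not> compatible (as_u b) (loc z) \<and> (\<forall>x\<in>set p. compatible x (loc z))" for p z
  have [measurable]: "Measurable.pred N (\<lambda>x. P (h x) (k x))"
    if [measurable]: "h \<in> N \<rightarrow>\<^sub>M S" "k \<in> N \<rightarrow>\<^sub>M M" for h k and N :: "'b measure"
    unfolding P_def by measurable
  define G where "G p s = ennreal \<mu> * wt (p @ as_u b # s) * f (prune (p @ s @ [as_m b]))" for p s
  have [measurable]: "(\<lambda>x. G (h x) (k x)) \<in> borel_measurable N"
    if [measurable]: "h \<in> N \<rightarrow>\<^sub>M S" "k \<in> N \<rightarrow>\<^sub>M S" for h k and N :: "'b measure"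
    unfolding G_def by measurable
  define E where "E p z s = of_bool (P p z) * wt (p @ as_u b # s) * f (prune (p @ z # s @ [as_m b]))" for p z s
  have [measurable]: "(\<lambda>x. E (h x) (j x) (k x)) \<in> borel_measurable N"
    if [measurable]: "h \<in> N \<rightarrow>\<^sub>M S" "j \<in> N \<rightarrow>\<^sub>M M" "k \<in> N \<rightarrow>\<^sub>M S" for h j k and N :: "'b measure"
    unfolding E_def by measurable
  \<comment> \<open>As \<open>E\<close> vanishes at unmatched entries, the integral over partners in
    \<open>B\<close> can be read as an integral over all entries in \<open>M\<close>.\<close>
  have E_as_u: "E p (as_u y) = (\<lambda>_. 0)" for p y by (simp add: E_def P_def fun_eq_iff)
  have "(\<integral>\<^sup>+ s. wt (p @ as_u b # s) * jump_flow f p (as_u b) s \<partial>\<Lambda>) =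
      (\<integral>\<^sup>+ s. G p s \<partial>\<Lambda>) + (\<integral>\<^sup>+ z. (\<integral>\<^sup>+ s. E p z s \<partial>\<Lambda>) \<partial>M)" for p
  proof -
    have "wt (p @ as_u b # s) * jump_flow f p (as_u b) s = G p s + (\<integral>\<^sup>+ y. E p (as_m y) s \<partial>B)" for s
      by (simp add: jump_flow_def G_def E_def P_def distrib_left nn_integral_cmult[symmetric] ac_simps)
    then have "(\<integral>\<^sup>+ s. wt (p @ as_u b # s) * jump_flow f p (as_u b) s \<partial>\<Lambda>) =
        (\<integral>\<^sup>+ s. G p s \<partial>\<Lambda>) + (\<integral>\<^sup>+ s. (\<integral>\<^sup>+ y. E p (as_m y) s \<partial>B) \<partial>\<Lambda>)"
      by (simp add: nn_integral_add)
    also have "(\<integral>\<^sup>+ s. (\<integral>\<^sup>+ y. E p (as_m y) s \<partial>B) \<partial>\<Lambda>) = (\<integral>\<^sup>+ y. (\<integral>\<^sup>+ s. E p (as_m y) s \<partial>\<Lambda>) \<partial>B)"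
      by (rule BL.Fubini') measurable
    also have "\<dots> = (\<integral>\<^sup>+ z. (\<integral>\<^sup>+ s. E p z s \<partial>\<Lambda>) \<partial>M)"
      by (subst nn_integral_M) (simp_all add: E_as_u)
    finally show ?thesis .
  qed
  then have "(\<integral>\<^sup>+ p. (\<integral>\<^sup>+ s. wt (p @ as_u b # s) * jump_flow f p (as_u b) s \<partial>\<Lambda>) \<partial>\<Lambda>) =
      (\<integral>\<^sup>+ p. (\<integral>\<^sup>+ s. G p s \<partial>\<Lambda>) \<partial>\<Lambda>) + (\<integral>\<^sup>+ p. (\<integral>\<^sup>+ z. (\<integral>\<^sup>+ s. E p z s \<partial>\<Lambda>) \<partial>M) \<partial>\<Lambda>)"
    by (simp add: nn_integral_add)
  also have "(\<integral>\<^sup>+ p. (\<integral>\<^sup>+ s. G p s \<partial>\<Lambda>) \<partial>\<Lambda>) = (\<integral>\<^sup>+ v. (\<Sum>i\<le>length v. G (take i v) (drop i v)) \<partial>\<Lambda>)"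
    by (rule M.nn_integral_list_measure_split[symmetric]) measurable
  also have "(\<integral>\<^sup>+ p. (\<integral>\<^sup>+ z. (\<integral>\<^sup>+ s. E p z s \<partial>\<Lambda>) \<partial>M) \<partial>\<Lambda>) =
      (\<integral>\<^sup>+ v. (\<Sum>i<length v. E (take i v) (v ! i) (drop (Suc i) v)) \<partial>\<Lambda>)"
    by (rule M.nn_integral_list_measure_marked[symmetric]) measurable
  also have "(\<integral>\<^sup>+ v. (\<Sum>i<length v. E (take i v) (v ! i) (drop (Suc i) v)) \<partial>\<Lambda>) =
      (\<integral>\<^sup>+ v. (\<Sum>i<length v. E (take i v) (hd (drop i v)) (drop (Suc i) v)) \<partial>\<Lambda>)"
    by (intro nn_integral_cong sum.cong refl) (simp add: hd_drop_conv_nth)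
  also have "(\<integral>\<^sup>+ v. (\<Sum>i\<le>length v. G (take i v) (drop i v)) \<partial>\<Lambda>) + (\<integral>\<^sup>+ v. (\<Sum>i<length v. E (take i v) (hd (drop i v)) (drop (Suc i) v)) \<partial>\<Lambda>) =
     (\<integral>\<^sup>+ v. (\<Sum>i\<le>length v. G (take i v) (drop i v)) + (\<Sum>i<length v. E (take i v) (hd (drop i v)) (drop (Suc i) v)) \<partial>\<Lambda>)"
    by (rule nn_integral_add[symmetric]) measurable
  also have "\<dots> = (\<integral>\<^sup>+ v. f (prune (v @ [as_m b])) * gain b v \<partial>\<Lambda>)"
  proof (rule nn_integral_cong)
    fix v
    have "(\<Sum>i\<le>length v. G (take i v) (drop i v)) =
        f (prune (v @ [as_m b])) * (\<Sum>i\<le>length v. ennreal \<mu> * wt (take i v @ as_u b # drop i v))"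
      unfolding sum_distrib_left G_def append_assoc[symmetric] append_take_drop_id
      by (intro sum.cong refl) (simp only: ac_simps)
    moreover have "(\<Sum>i<length v. E (take i v) (hd (drop i v)) (drop (Suc i) v)) =
        f (prune (v @ [as_m b])) * (\<Sum>i<length v. of_bool (P (take i v) (v ! i)) * wt (take i v @ as_u b # drop (Suc i) v))"
      unfolding sum_distrib_left
    proof (intro sum.cong refl)
      fix i assume "i \<in> {..<length v}"
      then have i: "i < length v" by simp
      have "take i v @ v ! i # drop (Suc i) v @ [as_m b] = v @ [as_m b]"
        using id_take_nth_drop[OF i] by (metis append.assoc append_Cons)
      then show "E (take i v) (hd (drop i v)) (drop (Suc i) v) =
          f (prune (v @ [as_m b])) * (of_bool (P (take i v) (v ! i)) * wt (take i v @ as_u b # drop (Suc i) v))"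
        unfolding E_def hd_drop_conv_nth[OF i] by (simp only: ac_simps)
    qed
    ultimately show "(\<Sum>i\<le>length v. G (take i v) (drop i v)) + (\<Sum>i<length v. E (take i v) (hd (drop i v)) (drop (Suc i) v)) =
        f (prune (v @ [as_m b])) * gain b v"
      by (simp only: gain_def P_def distrib_left)
  qed
  finally show ?thesis .
qed

text \<open>The finiteness needed for a single \<open>b\<close> is only available for almost every
  \<open>b\<close>: the bound 1 on f and the finite total weight control the integral over
  \<open>b\<close>.\<close>

lemma nn_integral_jump_flow:
  assumes f [measurable]: "f \<in> borel_measurable S" and f_le: "\<And>x. f x \<le> 1" and fin: "(\<integral>\<^sup>+ v. wt v \<partial>\<Lambda>) \<noteq> \<infinity>"
  shows "(\<integral>\<^sup>+ xs. wt xs * (\<Sum>i<length xs. jump_flow f (take i xs) (xs ! i) (drop (Suc i) xs)) \<partial>\<Lambda>) =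
    (\<integral>\<^sup>+ v. (\<integral>\<^sup>+ b. wt v * of_bool (\<forall>x\<in>set v. compatible x b) * f (prune (v @ [as_m b])) \<partial>B) \<partial>\<Lambda>)"
proof -
  have "(\<integral>\<^sup>+ xs. wt xs * (\<Sum>i<length xs. jump_flow f (take i xs) (xs ! i) (drop (Suc i) xs)) \<partial>\<Lambda>) =
      (\<integral>\<^sup>+ xs. (\<Sum>i<length xs. wt (take i xs @ xs ! i # drop (Suc i) xs) * jump_flow f (take i xs) (xs ! i) (drop (Suc i) xs)) \<partial>\<Lambda>)"
    by (intro nn_integral_cong) (simp add: sum_distrib_left id_take_nth_drop[symmetric])
  also have "\<dots> = (\<integral>\<^sup>+ p. (\<integral>\<^sup>+ z. (\<integral>\<^sup>+ s. wt (p @ z # s) * jump_flow f p z s \<partial>\<Lambda>) \<partial>M) \<partial>\<Lambda>)"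
    by (rule M.nn_integral_list_measure_marked) measurable
  also have "\<dots> = (\<integral>\<^sup>+ p. (\<integral>\<^sup>+ b. (\<integral>\<^sup>+ s. wt (p @ as_u b # s) * jump_flow f p (as_u b) s \<partial>\<Lambda>) \<partial>B) \<partial>\<Lambda>)"
  proof -
    have "jump_flow f p (as_m b) s = 0" for p b s by (simp add: jump_flow_def)
    then show ?thesis by (simp add: nn_integral_M)
  qed
  also have "\<dots> = (\<integral>\<^sup>+ b. (\<integral>\<^sup>+ p. (\<integral>\<^sup>+ s. wt (p @ as_u b # s) * jump_flow f p (as_u b) s \<partial>\<Lambda>) \<partial>\<Lambda>) \<partial>B)"
    by (rule BL.Fubini') measurable
  also have "\<dots> = (\<integral>\<^sup>+ b. (\<integral>\<^sup>+ v. f (prune (v @ [as_m b])) * gain b v \<partial>\<Lambda>) \<partial>B)"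
    by (simp only: nn_integral_flow[OF f])
  also have "\<dots> = (\<integral>\<^sup>+ b. (\<integral>\<^sup>+ v. f (prune (v @ [as_m b])) * (wt v * of_bool (\<forall>x\<in>set v. compatible x b)) \<partial>\<Lambda>) \<partial>B)"
  proof (rule nn_integral_cong_AE)
    have "(\<integral>\<^sup>+ b. (\<integral>\<^sup>+ v. f (prune (v @ [as_m b])) * wt (as_u b # v) \<partial>\<Lambda>) \<partial>B) \<le> (\<integral>\<^sup>+ b. (\<integral>\<^sup>+ v. wt (as_u b # v) \<partial>\<Lambda>) \<partial>B)"
      using mult_right_mono[OF f_le] by (intro nn_integral_mono) fastforce
    also have "\<dots> \<le> (\<integral>\<^sup>+ v. wt v \<partial>\<Lambda>)"
      by (subst (2) M.nn_integral_list_measure_Cons, measurable, subst nn_integral_M, measurable, subst nn_integral_add, measurable)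
    finally have "(\<integral>\<^sup>+ b. (\<integral>\<^sup>+ v. f (prune (v @ [as_m b])) * wt (as_u b # v) \<partial>\<Lambda>) \<partial>B) \<noteq> \<infinity>"
      using fin by (auto simp: top_unique)
    then have "AE b in B. (\<integral>\<^sup>+ v. f (prune (v @ [as_m b])) * wt (as_u b # v) \<partial>\<Lambda>) \<noteq> \<infinity>"
      by (rule nn_integral_PInf_AE[rotated]) measurable
    then show "AE b in B. (\<integral>\<^sup>+ v. f (prune (v @ [as_m b])) * gain b v \<partial>\<Lambda>) =
        (\<integral>\<^sup>+ v. f (prune (v @ [as_m b])) * (wt v * of_bool (\<forall>x\<in>set v. compatible x b)) \<partial>\<Lambda>)"
      by eventually_elim (rule nn_integral_gain[OF f])
  qed
  also have "\<dots> = (\<integral>\<^sup>+ v. (\<integral>\<^sup>+ b. f (prune (v @ [as_m b])) * (wt v * of_bool (\<forall>x\<in>set v. compatible x b)) \<partial>B) \<partial>\<Lambda>)"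
    by (rule BL.Fubini'[symmetric]) measurable
  finally show ?thesis by (simp only: ac_simps)
qed

text \<open>The right side is split according to the last entry. Lists ending in an unmatched entry
  meet the arrivals, lists ending in a matched one meet departures and exchanges, and the empty list
  is fed by complete pruning.\<close>

lemma weighted_balance:
  assumes f [measurable]: "f \<in> borel_measurable S" and f_le: "\<And>x. f x \<le> 1" and fin: "(\<integral>\<^sup>+ v. wt v \<partial>\<Lambda>) \<noteq> \<infinity>"
  shows "(\<integral>\<^sup>+ xs. wt xs * rate_int f xs \<partial>\<Lambda>) = (\<integral>\<^sup>+ xs. wt xs * ennreal (r (count_u xs)) * f xs \<partial>\<Lambda>)"
proof -
  define c where "c v b = wt v * of_bool (\<forall>x\<in>set v. compatible x b)" for v b
  have [measurable]: "(\<lambda>x. c (h x) (k x)) \<in> borel_measurable N"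
    if [measurable]: "h \<in> N \<rightarrow>\<^sub>M S" "k \<in> N \<rightarrow>\<^sub>M B" for h k and N :: "'b measure"
    unfolding c_def by measurable
  have flow_meas: "(\<lambda>xs. \<Sum>i<length xs. jump_flow f (take i xs) (xs ! i) (drop (Suc i) xs)) \<in> borel_measurable S"
  proof -
    have eq: "(\<Sum>i<length xs. jump_flow f (take i xs) (xs ! i) (drop (Suc i) xs)) =
       (\<Sum>i<length xs. jump_flow f (take i xs) (hd (drop i xs)) (drop (Suc i) xs))" for xs
      by (intro sum.cong) (auto simp: hd_drop_conv_nth)
    show ?thesis unfolding eq by measurable
  qed
  note [measurable] = flow_meas
  have "(\<integral>\<^sup>+ xs. wt xs * rate_int f xs \<partial>\<Lambda>) =
      (\<integral>\<^sup>+ xs. wt xs * (\<Sum>i<length xs. jump_flow f (take i xs) (xs ! i) (drop (Suc i) xs)) +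
         (\<integral>\<^sup>+ b. c xs b * f (xs @ [as_u b]) \<partial>B) \<partial>\<Lambda>)"
    by (intro nn_integral_cong) (simp add: rate_int_def c_def distrib_left nn_integral_cmult[symmetric] mult.assoc)
  also have "\<dots> = (\<integral>\<^sup>+ xs. wt xs * (\<Sum>i<length xs. jump_flow f (take i xs) (xs ! i) (drop (Suc i) xs)) \<partial>\<Lambda>) +
      (\<integral>\<^sup>+ v. (\<integral>\<^sup>+ b. c v b * f (v @ [as_u b]) \<partial>B) \<partial>\<Lambda>)"
    by (rule nn_integral_add) measurable
  also have "(\<integral>\<^sup>+ xs. wt xs * (\<Sum>i<length xs. jump_flow f (take i xs) (xs ! i) (drop (Suc i) xs)) \<partial>\<Lambda>) =
      (\<integral>\<^sup>+ v. (\<integral>\<^sup>+ b. c v b * f (prune (v @ [as_m b])) \<partial>B) \<partial>\<Lambda>)"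
    unfolding c_def by (rule nn_integral_jump_flow[OF f f_le fin])
  \<comment> \<open>For \<open>v = []\<close> pruning also removes the appended entry, so all these
    terms land in the empty list; their total rate \<open>a\<close> is its exit rate.\<close>
  also have "\<dots> = ennreal a * f [] + (\<integral>\<^sup>+ v. of_bool (v \<noteq> []) * (\<integral>\<^sup>+ b. c v b * f (prune (v @ [as_m b])) \<partial>B) \<partial>\<Lambda>)"
    by (subst nn_integral_not_Nil) (simp_all add: c_def emeasure_B_space mult.commute)
  also have "(\<integral>\<^sup>+ v. of_bool (v \<noteq> []) * (\<integral>\<^sup>+ b. c v b * f (prune (v @ [as_m b])) \<partial>B) \<partial>\<Lambda>) =
      (\<integral>\<^sup>+ v. (\<integral>\<^sup>+ b. of_bool (v \<noteq> []) * c v b * f (v @ [as_m b]) \<partial>B) \<partial>\<Lambda>)"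
  proof (intro nn_integral_cong)
    fix v
    have "c v b * f (prune (v @ [as_m b])) = c v b * f (v @ [as_m b])" if "v \<noteq> []" for b
      using prune_head_ok[OF that] by (cases "head_ok v") (auto simp: c_def wt_eq)
    then show "of_bool (v \<noteq> []) * (\<integral>\<^sup>+ b. c v b * f (prune (v @ [as_m b])) \<partial>B) =
        (\<integral>\<^sup>+ b. of_bool (v \<noteq> []) * c v b * f (v @ [as_m b]) \<partial>B)"
      by (cases "v = []") simp_all
  qed
  finally have lhs: "(\<integral>\<^sup>+ xs. wt xs * rate_int f xs \<partial>\<Lambda>) = ennreal a * f [] +
      (\<integral>\<^sup>+ v. (\<integral>\<^sup>+ b. of_bool (v \<noteq> []) * c v b * f (v @ [as_m b]) \<partial>B) \<partial>\<Lambda>) + (\<integral>\<^sup>+ v. (\<integral>\<^sup>+ b. c v b * f (v @ [as_u b]) \<partial>B) \<partial>\<Lambda>)" .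
  have "(\<integral>\<^sup>+ xs. wt xs * ennreal (r (count_u xs)) * f xs \<partial>\<Lambda>) = ennreal a * f [] +
      (\<integral>\<^sup>+ v. (\<integral>\<^sup>+ x. wt (v @ [x]) * ennreal (r (count_u (v @ [x]))) * f (v @ [x]) \<partial>M) \<partial>\<Lambda>)"
    by (subst M.nn_integral_list_measure_snoc, measurable) (simp add: rho_def)
  also have "(\<integral>\<^sup>+ v. (\<integral>\<^sup>+ x. wt (v @ [x]) * ennreal (r (count_u (v @ [x]))) * f (v @ [x]) \<partial>M) \<partial>\<Lambda>) =
      (\<integral>\<^sup>+ v. (\<integral>\<^sup>+ b. c v b * f (v @ [as_u b]) + of_bool (v \<noteq> []) * c v b * f (v @ [as_m b]) \<partial>B) \<partial>\<Lambda>)"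
    by (intro nn_integral_cong, subst nn_integral_M, simp)
      (simp only: wt_snoc_as_u wt_snoc_as_m c_def mult.assoc)
  also have "\<dots> = (\<integral>\<^sup>+ v. (\<integral>\<^sup>+ b. c v b * f (v @ [as_u b]) \<partial>B) \<partial>\<Lambda>) + (\<integral>\<^sup>+ v. (\<integral>\<^sup>+ b. of_bool (v \<noteq> []) * c v b * f (v @ [as_m b]) \<partial>B) \<partial>\<Lambda>)"
    by (simp add: nn_integral_add)
  finally show ?thesis unfolding lhs by (simp only: ac_simps)
qed

section \<open>Finiteness of the normalizing sum\<close>

lemma nn_integral_length_pw_Suc:
  "M.nn_integral_length (Suc n) (\<lambda>v. ennreal (pw q v)) =
    ennreal a * (ennreal (1 / r (Suc q)) * M.nn_integral_length n (\<lambda>v. ennreal (pw (Suc q) v)) +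
      ennreal (1 / r q) * M.nn_integral_length n (\<lambda>v. ennreal (pw q v)))"
proof -
  have cmult: "M.nn_integral_length n (\<lambda>v. ennreal c * ennreal (pw q v)) = ennreal c * M.nn_integral_length n (\<lambda>v. ennreal (pw q v))" for c q
    unfolding M.nn_integral_length_def by (rule nn_integral_cmult) measurable
  have "M.nn_integral_length (Suc n) (\<lambda>v. ennreal (pw q v)) = (\<integral>\<^sup>+ x. M.nn_integral_length n (\<lambda>v. ennreal (pw q (x # v))) \<partial>M)"
    by (rule M.nn_integral_length_Cons) measurable
  also have "\<dots> = (\<integral>\<^sup>+ b. M.nn_integral_length n (\<lambda>v. ennreal (1 / r (Suc q)) * ennreal (pw (Suc q) v)) +
      M.nn_integral_length n (\<lambda>v. ennreal (1 / r q) * ennreal (pw q v)) \<partial>B)"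
    by (subst nn_integral_M, measurable) (simp add: rho_nonneg pw_nonneg flip: ennreal_mult)
  finally show ?thesis
    unfolding cmult by (simp add: emeasure_B_space mult.commute)
qed

text \<open>Compatibility is dropped and the partial sums \<open>T N q\<close> over all
  continuations are bounded. The ansatz \<open>r q * h q\<close> for the bound turns the recursion
  into \<open>1 + a * h (Suc q) + a * h q \<le> r q * h q\<close>. Since \<open>r q - a\<close> is
  \<mu> q, this is the supersolution inequality.\<close>

lemma nn_integral_wt_finite: "(\<integral>\<^sup>+ v. wt v \<partial>\<Lambda>) \<noteq> \<infinity>"
proof -
  obtain h :: "nat \<Rightarrow> real" where h: "\<And>j. 1 \<le> j \<Longrightarrow> 0 \<le> h j" "\<And>j. 1 \<le> j \<Longrightarrow> 1 + a * h (Suc j) \<le> \<mu> * real j * h j"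
    using ex_supersolution[OF \<mu>_pos, of a] by auto
  define T where "T N q = (\<Sum>n<N. M.nn_integral_length n (\<lambda>v. ennreal (pw q v)))" for N q
  have T_Suc: "T (Suc N) q = 1 + ennreal a * (ennreal (1 / r (Suc q)) * T N (Suc q) + ennreal (1 / r q) * T N q)" for N q
    unfolding T_def sum.lessThan_Suc_shift nn_integral_length_pw_Suc
    by (simp add: M.nn_integral_length_0 sum.distrib sum_distrib_left distrib_left)
  have T_le: "T N q \<le> ennreal (r q * h q)" if "1 \<le> q" for N q
    using that
  proof (induction N arbitrary: q)
    case (Suc N)
    have rq: "0 < r q" "0 < r (Suc q)" using Suc.prems by (simp_all add: rho_pos)
    have hq: "0 \<le> h q" "0 \<le> h (Suc q)" using h(1) Suc.prems by auto
    have "T (Suc N) q \<le> 1 + ennreal a * (ennreal (1 / r (Suc q)) * ennreal (r (Suc q) * h (Suc q)) + ennreal (1 / r q) * ennreal (r q * h q))"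
      unfolding T_Suc using Suc.IH[of q] Suc.IH[of "Suc q"] Suc.prems
      by (intro add_mono mult_left_mono order.refl) auto
    also have "\<dots> = ennreal (1 + a * (h (Suc q) + h q))"
      using rq hq by (simp flip: ennreal_mult ennreal_plus ennreal_1)
    also have "\<dots> \<le> ennreal (r q * h q)"
      using h(2)[OF Suc.prems] by (intro ennreal_leI) (simp add: rho_def algebra_simps)
    finally show ?case .
  qed (simp add: T_def)
  \<comment> \<open>The first entry of a valid list is unmatched, which moves the counter to 1, the
    first index at which the bound is available.\<close>
  have wt_le: "M.nn_integral_length (Suc n) wt \<le> ennreal a * (ennreal (1 / r 1) * M.nn_integral_length n (\<lambda>v. ennreal (pw 1 v)))" for n
  proof -
    have "M.nn_integral_length (Suc n) wt = (\<integral>\<^sup>+ b. M.nn_integral_length n (\<lambda>v. wt (as_u b # v)) + M.nn_integral_length n (\<lambda>v. wt (as_m b # v)) \<partial>B)"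
      by (subst M.nn_integral_length_Cons, measurable, subst nn_integral_M, measurable)
    also have "\<dots> \<le> (\<integral>\<^sup>+ b. ennreal (1 / r 1) * M.nn_integral_length n (\<lambda>v. ennreal (pw 1 v)) \<partial>B)"
    proof (rule nn_integral_mono)
      fix b
      have "M.nn_integral_length n (\<lambda>v. wt (as_u b # v)) \<le> M.nn_integral_length n (\<lambda>v. ennreal (1 / r 1) * ennreal (pw 1 v))"
        unfolding M.nn_integral_length_def
        by (intro nn_integral_mono) (simp add: wt_eq head_ok_Cons pw_nonneg rho_nonneg flip: ennreal_mult)
      also have "\<dots> = ennreal (1 / r 1) * M.nn_integral_length n (\<lambda>v. ennreal (pw 1 v))"
        unfolding M.nn_integral_length_def by (rule nn_integral_cmult) measurable
      finally show "M.nn_integral_length n (\<lambda>v. wt (as_u b # v)) + M.nn_integral_length n (\<lambda>v. wt (as_m b # v)) \<le>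
          ennreal (1 / r 1) * M.nn_integral_length n (\<lambda>v. ennreal (pw 1 v))"
        by (simp add: wt_eq[of "as_m b # _"] head_ok_Cons M.nn_integral_length_def)
    qed
    also have "\<dots> = ennreal a * (ennreal (1 / r 1) * M.nn_integral_length n (\<lambda>v. ennreal (pw 1 v)))"
      by (simp add: emeasure_B_space mult.commute)
    finally show ?thesis .
  qed
  have "(\<Sum>n<N. M.nn_integral_length n wt) \<le> ennreal (1 + a * h 1)" for N
  proof (cases N)
    case (Suc N')
    have "(\<Sum>n<N. M.nn_integral_length n wt) \<le> 1 + (\<Sum>n<N'. ennreal a * (ennreal (1 / r 1) * M.nn_integral_length n (\<lambda>v. ennreal (pw 1 v))))"
      unfolding Suc sum.lessThan_Suc_shift using wt_le by (intro add_mono sum_mono) (simp_all add: M.nn_integral_length_0)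
    also have "\<dots> = 1 + ennreal a * (ennreal (1 / r 1) * T N' 1)"
      by (simp add: T_def sum_distrib_left)
    also have "\<dots> \<le> 1 + ennreal a * (ennreal (1 / r 1) * ennreal (r 1 * h 1))"
      by (intro add_left_mono mult_left_mono T_le) auto
    also have "\<dots> = ennreal (1 + a * h 1)"
      using rho_pos[of 1] h(1)[of 1] by (simp flip: ennreal_mult ennreal_plus ennreal_1)
    finally show ?thesis .
  qed simp
  then have "(\<Sum>n. M.nn_integral_length n wt) \<le> ennreal (1 + a * h 1)"
    by (intro suminf_le_const) auto
  then show ?thesis
    by (auto simp: M.nn_integral_list_measure top_unique)
qed

section \<open>The normalized law and its uniqueness\<close>

definition Z :: real where "Z = enn2real (\<integral>\<^sup>+ v. wt v \<partial>\<Lambda>)"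

lemma ennreal_Z: "ennreal Z = (\<integral>\<^sup>+ v. wt v \<partial>\<Lambda>)"
  using nn_integral_wt_finite by (simp add: Z_def less_top)

lemma Z_pos: "0 < Z"
proof -
  have "0 < (\<integral>\<^sup>+ v. wt v \<partial>\<Lambda>)"
    by (subst M.nn_integral_list_measure_Cons) (simp_all add: add_pos_nonneg)
  then show ?thesis unfolding ennreal_Z[symmetric] by simp
qed

definition \<pi> :: "'a particle list measure" where
  "\<pi> = density \<Lambda> (\<lambda>xs. ennreal (1 / Z * fifm_weight L \<mu> xs))"

lemma \<pi>_eq: "\<pi> = density \<Lambda> (\<lambda>xs. ennreal (1 / Z) * wt xs)"
  using Z_pos by (simp add: \<pi>_def wt_def fifm_weight_eq pw_nonneg flip: ennreal_mult)

lemma sets_\<pi> [measurable_cong, simp]: "sets \<pi> = sets S"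
  by (simp add: \<pi>_eq)

lemma space_\<pi> [simp]: "space \<pi> = UNIV"
  by (simp add: \<pi>_eq)

lemma nn_integral_\<pi>:
  assumes [measurable]: "f \<in> borel_measurable S"
  shows "(\<integral>\<^sup>+ xs. f xs \<partial>\<pi>) = ennreal (1 / Z) * (\<integral>\<^sup>+ xs. wt xs * f xs \<partial>\<Lambda>)"
  by (simp add: \<pi>_eq nn_integral_density nn_integral_cmult mult.assoc)

lemma prob_space_\<pi>: "prob_space \<pi>"
proof
  have "emeasure \<pi> (space \<pi>) = (\<integral>\<^sup>+ xs. 1 \<partial>\<pi>)" by simp
  also have "\<dots> = ennreal (1 / Z) * ennreal Z"
    unfolding ennreal_Z by (subst nn_integral_\<pi>) simp_all
  also have "\<dots> = 1"
    using Z_pos by (simp flip: ennreal_mult)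
  finally show "emeasure \<pi> (space \<pi>) = 1" .
qed

lemma stationary_\<pi>: "stationary_distribution S rates \<pi>"
proof (rule J.stationary_distribution_if_balance[OF prob_space_\<pi>])
  show "sets \<pi> = sets S" by simp
  show "transition_prob rates t x (space S) = 1" if "0 \<le> t" for t x
    using that by (rule transition_prob_honest)
  fix A assume [measurable]: "A \<in> sets S"
  have "(\<integral>\<^sup>+ x. emeasure (rates x) A \<partial>\<pi>) = ennreal (1 / Z) * (\<integral>\<^sup>+ x. wt x * rate_int (indicator A) x \<partial>\<Lambda>)"
    by (simp add: emeasure_rates nn_integral_\<pi>)
  also have "\<dots> = ennreal (1 / Z) * (\<integral>\<^sup>+ x. wt x * ennreal (r (count_u x)) * indicator A x \<partial>\<Lambda>)"
    by (subst weighted_balance[OF _ _ nn_integral_wt_finite]) (auto simp: indicator_def)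
  also have "\<dots> = (\<integral>\<^sup>+ x\<in>A. ennreal (total_rate rates x) \<partial>\<pi>)"
    by (simp add: nn_integral_\<pi> total_rate_rates mult.assoc)
  finally show "(\<integral>\<^sup>+ x. emeasure (rates x) A \<partial>\<pi>) = (\<integral>\<^sup>+ x\<in>A. ennreal (total_rate rates x) \<partial>\<pi>)" .
qed

lemma AE_\<pi>_valid: "AE xs in \<pi>. valid xs"
  unfolding \<pi>_eq by (subst AE_density) (auto simp: wt_eq valid_iff)

text \<open>Validity gives an unmatched head, from which the empty list is reachable. Among all
  lists uniqueness may fail: if \<open>L\<close> is the zero measure, a nonempty list of matched
  entries is absorbing, and its point mass is stationary too.\<close>

lemma stationary_unique:
  assumes "stationary_distribution S rates \<nu>" "AE xs in \<nu>. valid xs"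
  shows "\<nu> = \<pi>"
proof (rule J.stationary_distribution_unique[where t=1 and e="[]", OF assms(1) stationary_\<pi>])
  have "valid xs \<Longrightarrow> 0 < transition_prob rates 1 xs {[]}" for xs
    by (rule transition_prob_Nil_pos) (auto simp: valid_iff)
  then show "AE xs in \<nu>. 0 < transition_prob rates 1 xs {[]}" "AE xs in \<pi>. 0 < transition_prob rates 1 xs {[]}"
    using assms(2) AE_\<pi>_valid by (auto elim: eventually_mono)
qed (use transition_prob_honest[of 1] in \<open>auto intro: singleton_in_sets\<close>)

lemma ennreal_Z_sum:
  "ennreal Z = (\<Sum>n. \<integral>\<^sup>+ \<omega>. ennreal (fifm_weight L \<mu> (map \<omega> [0..<n])) \<partial>Pi\<^sub>M {..<n} (\<lambda>_. M))"
  unfolding ennreal_Z by (simp add: M.nn_integral_list_measure M.nn_integral_length_def wt_def)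

end

theorem theorem2p3:
  fixes L :: "'a::metric_space measure" and \<mu> :: real
  assumes "compact (UNIV :: 'a set)"
    and "radon_measure L"
    and "\<mu> > 0"
  shows "\<exists>K::real. K > 0 \<and>
    ennreal (1 / K) =
      (\<Sum>n. \<integral>\<^sup>+ \<omega>. ennreal (fifm_weight L \<mu> (map \<omega> [0..<n])) \<partial>Pi\<^sub>M {..<n} (\<lambda>_. marked L)) \<and>
    K * fifm_weight L \<mu> [] = K \<and>
    (\<forall>\<nu>. stationary_distribution (list_space (marked L)) (fifm_rates L \<mu>) \<nu> \<and>
          (AE xs in \<nu>. valid xs) \<longleftrightarrow>
        \<nu> = density (list_measure (marked L)) (\<lambda>xs. ennreal (K * fifm_weight L \<mu> xs)))"
proof -
  interpret fifm L \<mu> using assms by unfold_locales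
  show ?thesis
  proof (intro exI[of _ "1 / Z"] conjI allI)
    show "0 < 1 / Z" using Z_pos by simp
    show "ennreal (1 / (1 / Z)) = (\<Sum>n. \<integral>\<^sup>+ \<omega>. ennreal (fifm_weight L \<mu> (map \<omega> [0..<n])) \<partial>Pi\<^sub>M {..<n} (\<lambda>_. M))"
      using ennreal_Z_sum by simp
    show "1 / Z * fifm_weight L \<mu> [] = 1 / Z"
      by (simp add: fifm_weight_eq valid_iff head_ok_def)
    show "stationary_distribution S rates \<nu> \<and> (AE xs in \<nu>. valid xs) \<longleftrightarrow>
        \<nu> = density \<Lambda> (\<lambda>xs. ennreal (1 / Z * fifm_weight L \<mu> xs))" for \<nu>
      unfolding \<pi>_def[symmetric] using stationary_unique stationary_\<pi> AE_\<pi>_valid by blast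
  qed
qed

end
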